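(* Let $\Gamma$ be a finite simple graph and $A(\Gamma)$ its right-angled Artin group. There exist constants $\alpha,\beta>0$ such that for every finite symmetric subset $U\subset A(\Gamma)$ at least one of the following holds: 1. $\langle U\rangle$ is a subgroup of a direct product of the form $H\times\mathbb{Z}$, where the restriction to $\langle U\rangle$ of the projection $H\times\mathbb{Z}\to H$ is not injective; 2. $|U^n|\geqslant(\alpha|U|)^{\beta n}$ for every $n\in\mathbb{N}$.
   Context: For a finite simple graph $\Gamma=(V,E)$, $A(\Gamma)=\langle V \mid [v,w]=1 \text{ whenever } \{v,w\}\in E\rangle$. For a finite subset $U$ of a group, $U^n=\{u_1\cdots u_n: u_i\in U\}$; $U$ is symmetric if $U=U^{-1}$. *)

theory Defs
  imports "HOL-Algebra.Algebra"
begin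

definition finite_simple_graph :: "'v set \<Rightarrow> ('v \<times> 'v) set \<Rightarrow> bool" where
  "finite_simple_graph V E \<longleftrightarrow> finite V \<and> E \<subseteq> V \<times> V \<and> sym E \<and> irrefl E"

text \<open>Words in the generators V and their inverses: a letter (v, True) is v, (v, False) is v^-1.
The congruence on words generated by free cancellation and commutation of adjacent
generators joined by an edge.\<close>
inductive raag_eq :: "'v set \<Rightarrow> ('v \<times> 'v) set \<Rightarrow> ('v \<times> bool) list \<Rightarrow> ('v \<times> bool) list \<Rightarrow> bool"
  for V E where
  refl: "raag_eq V E w w"
| sym: "raag_eq V E w w' \<Longrightarrow> raag_eq V E w' w"
| trans: "raag_eq V E w w' \<Longrightarrow> raag_eq V E w' w'' \<Longrightarrow> raag_eq V E w w''"
| cancel: "v \<in> V \<Longrightarrow> raag_eq V E (xs @ [(v, b), (v, \<not> b)] @ ys) (xs @ ys)"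
| commute: "(v, u) \<in> E \<Longrightarrow>
     raag_eq V E (xs @ [(v, b), (u, c)] @ ys) (xs @ [(u, c), (v, b)] @ ys)"

definition raag_class :: "'v set \<Rightarrow> ('v \<times> 'v) set \<Rightarrow> ('v \<times> bool) list \<Rightarrow> ('v \<times> bool) list set" where
  "raag_class V E w = {w'. raag_eq V E w w'}"

definition raag :: "'v set \<Rightarrow> ('v \<times> 'v) set \<Rightarrow> ('v \<times> bool) list set monoid" where
  "raag V E = \<lparr> carrier = raag_class V E ` lists (V \<times> UNIV),
     monoid.mult = (\<lambda>A B. raag_class V E ((SOME a. a \<in> A) @ (SOME b. b \<in> B))),
     one = raag_class V E [] \<rparr>"

fun set_power :: "('a, 'b) monoid_scheme \<Rightarrow> 'a set \<Rightarrow> nat \<Rightarrow> 'a set" where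
  "set_power G U 0 = {\<one>\<^bsub>G\<^esub>}"
| "set_power G U (Suc n) = {x \<otimes>\<^bsub>G\<^esub> u | x u. x \<in> set_power G U n \<and> u \<in> U}"

definition symmetric_subset :: "('a, 'b) monoid_scheme \<Rightarrow> 'a set \<Rightarrow> bool" where
  "symmetric_subset G U \<longleftrightarrow> U \<subseteq> carrier G \<and> (\<lambda>u. inv\<^bsub>G\<^esub> u) ` U = U"

text \<open>Alternative 1: the subgroup K = <U> embeds (via an injective homomorphism) into
a direct product H x Z such that the projection onto H restricted to the image of K
is not injective. The group H is given element type 'a set set (large enough to contain
any quotient of K, which is all that is needed).\<close>
definition embeds_in_product_with_Z :: "('a, 'b) monoid_scheme \<Rightarrow> 'a set \<Rightarrow> bool" where
  "embeds_in_product_with_Z G K \<longleftrightarrow>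
     (\<exists>(H :: 'a set set monoid) \<phi>. group H \<and>
        \<phi> \<in> hom (G\<lparr>carrier := K\<rparr>) (H \<times>\<times> integer_group) \<and> inj_on \<phi> K \<and>
        \<not> inj_on (fst \<circ> \<phi>) K)"

end

theory Submission
  imports Defs "HOL-Library.Function_Algebras"
begin

text \<open>Let the group act by the contragredient Tits representation of the right-angled Coxeter
group obtained by doubling each vertex. For every vertex \<open>v\<close> the halfspaces of type \<open>v\<close> are nested
(they are the half-trees of the Bass-Serre tree of the HNN decomposition with stable letter \<open>v\<close>), and
an element that skewers one of them has an axis on which it translates. Two axes of conjugates of
\<open>h\<close> either coincide or overlap in a number of translation lengths bounded by the dimension: an element
fixing the walls \<open>K, h K, \<dots>, h ^^ (n - 1) K\<close> fixes a Krylov space of functionals, hence all \<open>h ^^ i K\<close>.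

If the symmetric set \<open>U\<close> generates a group with trivial centre, the centralizer of \<open>U\<close> is already the
centralizer of boundedly many elements of \<open>U\<close>, since matrices live in a space of bounded dimension.
So some \<open>h \<in> U\<close> has a power of \<open>card U\<close> many conjugates by elements of \<open>U\<close>. These are distinguished by
their axes for boundedly many walls, so for one wall there are many distinct translates of the axis
by elements of \<open>U\<close>, and a ping-pong argument produces a large free basis of a semigroup inside a bounded
power of \<open>U\<close>. If instead the centre contains \<open>z \<noteq> 1\<close>, the centralizer of \<open>z\<close> acts on an axis of \<open>z\<close>
by translations, which gives a homomorphism \<open>f\<close> to the integers with \<open>f z \<noteq> 0\<close>, and \<open>H\<close> can be taken to
be the quotient by the subgroup generated by \<open>z\<close>.\<close>

section \<open>Linear algebra in spaces of real functions\<close>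

text \<open>The constants may not depend on \<open>U\<close>, while translation lengths are
  unbounded and stabilizers of walls may be infinite, so there is no acylindricity to rely on.
  Linear algebra replaces it: stabilizing a halfspace amounts to fixing a linear functional, hence
  overlaps of axes are bounded by \<open>card D\<close> times the translation length
  \<open>t\<close>, and one fixed power of \<open>h\<close> moves points past every exceptional band
  whatever \<open>t\<close> is. Each counting step separates elements by at most
  \<open>card D\<close> or \<open>card D * card D\<close> functions, so it costs only a bounded root
  of \<open>card U\<close>; the cube of \<open>card D\<close> is the product of these losses. The
  case distinction is narrower than triviality of the centre. It asks whether
  \<open>finv u \<circ> v\<close> centralizes \<open>U\<close> for some distinct \<open>u\<close>
  and \<open>v\<close> in \<open>U\<close>. If so, this quotient is the central element; if not,
  conjugation of elements of \<open>U\<close> tells the members of \<open>U\<close> apart, which is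
  all that the counting uses. Vertices are doubled since a reflection has order two, whereas the
  product of two noncommuting ones has infinite order.\<close>

interpretation fun_space: vector_space "\<lambda>(r::real) (f :: 'i \<Rightarrow> real) x. r * f x"
  by unfold_locales (auto simp: fun_eq_iff algebra_simps)

text \<open>A maximal independent subset of the image, pulled back to one index per vector. Indices
  are returned because they will be group elements (for centralizers) or positions in a word (for
  walls).\<close>

lemma finite_spanning_subfamily:
  fixes \<Phi> :: "'u \<Rightarrow> 'i \<Rightarrow> real"
  assumes "finite T" "\<And>u. u \<in> U \<Longrightarrow> \<Phi> u \<in> fun_space.span T"
  obtains B where "B \<subseteq> U" "finite B" "card B \<le> card T"
    "\<And>u. u \<in> U \<Longrightarrow> \<Phi> u \<in> fun_space.span (\<Phi> ` B)"
proof -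
  obtain C where C: "C \<subseteq> \<Phi> ` U" "fun_space.independent C" "\<Phi> ` U \<subseteq> fun_space.span C"
    using fun_space.maximal_independent_subset by blast
  have fin: "finite C" "card C \<le> card T"
    using fun_space.independent_span_bound[OF assms(1) C(2)] C(1) assms(2) by auto
  define B where "B = inv_into U \<Phi> ` C"
  have "\<Phi> ` B = C"
    unfolding B_def using C(1) by (rule image_inv_into_cancel[OF HOL.refl])
  moreover have "B \<subseteq> U"
    unfolding B_def using C(1) by (auto intro: inv_into_into)
  moreover have "card B \<le> card T" "finite B"
    unfolding B_def using fin card_image_le[of C] le_trans by blast+
  ultimately show ?thesis using that C(3) by blast
qed

text \<open>Among \<open>v 0, ..., v n\<close> some vector depends on its predecessors. The span of
  these predecessors is then invariant under \<open>M\<close> and contains the whole orbit.\<close>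

lemma krylov_span:
  fixes v :: "nat \<Rightarrow> 'i \<Rightarrow> real"
  assumes T: "finite T" "card T \<le> n" "\<And>i. v i \<in> fun_space.span T"
    and M: "\<And>i. M (v i) = v (Suc i)"
    and lin: "\<And>f g. M (f + g) = M f + M g" "\<And>r f. M (\<lambda>x. r * f x) = (\<lambda>x. r * M f x)"
  shows "v i \<in> fun_space.span (v ` {..<n})"
proof -
  have "\<exists>m\<le>n. v m \<in> fun_space.span (v ` {..<m})"
  proof (rule ccontr)
    assume no: "\<not> ?thesis"
    have "fun_space.independent (v ` {..<k}) \<and> card (v ` {..<k}) = k" if "k \<le> Suc n" for k
      using that
    proof (induction k)
      case (Suc k)
      then have "k \<le> n" by simp
      with no have *: "v k \<notin> fun_space.span (v ` {..<k})" by blast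
      then have "v k \<notin> v ` {..<k}" by (rule contrapos_nn) (rule fun_space.span_base)
      moreover have "v ` {..<Suc k} = insert (v k) (v ` {..<k})" by (auto simp: less_Suc_eq)
      moreover have "fun_space.independent (v ` {..<k})" "card (v ` {..<k}) = k" using Suc by auto
      ultimately show ?case using * fun_space.independent_insertI by (metis card_insert_disjoint finite_imageI finite_lessThan)
    qed (simp add: fun_space.independent_empty)
    from this[of "Suc n"] have "fun_space.independent (v ` {..<Suc n})" "card (v ` {..<Suc n}) = Suc n"
      by auto
    with fun_space.independent_span_bound[OF T(1), of "v ` {..<Suc n}"] T show False by auto
  qed
  then obtain m where m: "m \<le> n" "v m \<in> fun_space.span (v ` {..<m})" by blast
  let ?W = "fun_space.span (v ` {..<m})"
  have step: "M f \<in> ?W" if "f \<in> ?W" for f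
    using that
  proof (induction rule: fun_space.span_induct_alt)
    case base
    have "M 0 = M 0 + M 0" using lin(1)[of 0 0] by simp
    then have "M 0 = 0" by (metis add_cancel_left_right)
    then show ?case using fun_space.span_zero by metis
  next
    case (step c x y)
    then obtain j where j: "j < m" "x = v j" by auto
    have "v (Suc j) \<in> ?W"
      using j(1) m(2) by (cases "Suc j = m") (auto intro: fun_space.span_base)
    then have "(\<lambda>a. c * v (Suc j) a) + M y \<in> ?W"
      using step by (intro fun_space.span_add fun_space.span_scale) auto
    then show ?case using j by (simp only: lin M)
  qed
  have "v i \<in> ?W"
  proof (induction i)
    case 0
    show ?case using m(2) by (cases "m = 0") (auto intro: fun_space.span_base)
  next
    case (Suc i)
    then show ?case using step M by metis
  qed
  then show ?thesis
    using fun_space.span_mono[OF image_mono[of "{..<m}" "{..<n}" v]] m(1) by auto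
qed

section \<open>A linear representation of the right-angled Artin group\<close>

type_synonym 'v vec = "'v \<times> bool \<Rightarrow> real"

definition letter_inv :: "'v \<times> bool \<Rightarrow> 'v \<times> bool" where
  "letter_inv a = (fst a, \<not> snd a)"

definition word_inv :: "('v \<times> bool) list \<Rightarrow> ('v \<times> bool) list" where
  "word_inv w = rev (map letter_inv w)"

lemma letter_inv_simps [simp]:
  "fst (letter_inv a) = fst a" "snd (letter_inv a) \<longleftrightarrow> \<not> snd a"
  "letter_inv (letter_inv a) = a" "letter_inv a \<noteq> a" "a \<noteq> letter_inv a"
  by (auto simp: letter_inv_def prod_eq_iff)

lemma same_vertex: "fst c = fst d \<longleftrightarrow> c = d \<or> c = letter_inv d"
  by (cases c; cases d) (auto simp: letter_inv_def)

lemma word_inv_simps [simp]: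
  "word_inv [] = []" "word_inv (a # w) = word_inv w @ [letter_inv a]"
  "word_inv (u @ w) = word_inv w @ word_inv u" "length (word_inv w) = length w"
  "word_inv (word_inv w) = w"
  by (auto simp: word_inv_def rev_map o_def)

locale raag_graph =
  fixes V :: "'v set" and E :: "('v \<times> 'v) set"
  assumes graph: "finite_simple_graph V E"
begin

lemma finV: "finite V" and E_sym: "(u, v) \<in> E \<Longrightarrow> (v, u) \<in> E"
  and E_irrefl: "(v, v) \<notin> E"
  using graph by (auto simp: finite_simple_graph_def sym_def irrefl_def)

definition D :: "('v \<times> bool) set" where "D = V \<times> UNIV"

lemma finD: "finite D" unfolding D_def using finV by simp

lemma letter_inv_D [simp]: "letter_inv a \<in> D \<longleftrightarrow> a \<in> D"
  by (cases a) (auto simp: D_def letter_inv_def)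

lemma word_inv_D [simp]: "word_inv w \<in> lists D \<longleftrightarrow> w \<in> lists D"
  by (induction w) auto

text \<open>The contragredient Tits representation of the right-angled Coxeter group on the set of
  letters, in which \<open>(v, True)\<close> and \<open>(v, False)\<close> do not commute; the vertex \<open>v\<close> acts as the
  product of their two reflections.\<close>

definition reflect :: "'v \<times> bool \<Rightarrow> 'v vec \<Rightarrow> 'v vec" where
  "reflect c x = (\<lambda>d. if d = c then - x c else if (fst c, fst d) \<in> E then x d else x d + 2 * x c)"

definition act1 :: "'v \<times> bool \<Rightarrow> 'v vec \<Rightarrow> 'v vec" where
  "act1 a = reflect a \<circ> reflect (letter_inv a)"

primrec act :: "('v \<times> bool) list \<Rightarrow> 'v vec \<Rightarrow> 'v vec" where
  "act [] = id"
| "act (a # w) = act1 a \<circ> act w"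

lemma act_append: "act (u @ w) = act u \<circ> act w"
  by (induction u) auto

lemma reflect_invol: "reflect c (reflect c x) = x"
  using E_irrefl by (auto simp: reflect_def fun_eq_iff)

lemma reflect_comm: "(fst c, fst d) \<in> E \<Longrightarrow> reflect c (reflect d x) = reflect d (reflect c x)"
  using E_irrefl E_sym by (auto simp: reflect_def fun_eq_iff)

lemma act1_inv: "act1 a (act1 (letter_inv a) x) = x"
  by (simp add: act1_def reflect_invol)

lemma act1_inv_left: "act1 (letter_inv a) (act1 a x) = x"
  by (simp add: act1_def reflect_invol)

lemma act1_comm: "(fst c, fst d) \<in> E \<Longrightarrow> act1 c (act1 d x) = act1 d (act1 c x)"
  unfolding act1_def o_def by (metis letter_inv_simps(1) reflect_comm)

text \<open>On the two coordinates of its own vertex a letter acts by a unipotent matrix that keeps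
  their sum.\<close>

lemma act1_values:
  "act1 a x a = - x a - 2 * x (letter_inv a)"
  "act1 a x (letter_inv a) = 2 * x a + 3 * x (letter_inv a)"
  "(fst a, fst d) \<in> E \<Longrightarrow> act1 a x d = x d"
  "fst a \<noteq> fst d \<Longrightarrow> (fst a, fst d) \<notin> E \<Longrightarrow> act1 a x d = x d + 2 * x a + 6 * x (letter_inv a)"
  using E_irrefl by (auto simp: act1_def reflect_def)

lemma act_inv: "act w (act (word_inv w) x) = x" "act (word_inv w) (act w x) = x"
  by (induction w arbitrary: x) (auto simp: act_append act1_inv act1_inv_left)

lemma act_inv_comp: "act w \<circ> act (word_inv w) = id" "act (word_inv w) \<circ> act w = id"
  by (auto simp: fun_eq_iff act_inv)

lemma act_cong: "raag_eq V E w w' \<Longrightarrow> act w = act w'"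
proof (induction rule: raag_eq.induct)
  case (cancel v xs b ys)
  have "act1 (v, b) (act1 (v, \<not> b) x) = x" for x
    using act1_inv[of "(v, b)"] by (simp add: letter_inv_def)
  then show ?case by (simp add: act_append o_def)
next
  case (commute v u xs b c ys)
  then show ?case using act1_comm[of "(v, b)" "(u, c)"] by (simp add: act_append o_def)
qed auto

lemma raag_eq_context: "raag_eq V E w w' \<Longrightarrow> raag_eq V E (xs @ w @ ys) (xs @ w' @ ys)"
proof (induction rule: raag_eq.induct)
  case (cancel v us b vs)
  then show ?case using raag_eq.cancel[of v V E "xs @ us" b "vs @ ys"] by simp
next
  case (commute v u us b c vs)
  then show ?case using raag_eq.commute[of v u E V "xs @ us" b c "vs @ ys"] by simp
qed (auto intro: raag_eq.intros)

lemma raag_eq_Cons: "raag_eq V E w w' \<Longrightarrow> raag_eq V E (a # w) (a # w')"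
  using raag_eq_context[of w w' "[a]" "[]"] by simp

lemma raag_eq_cancel_Cons: "a \<in> D \<Longrightarrow> raag_eq V E (a # letter_inv a # w) w"
  using raag_eq.cancel[of "fst a" V E "[]" "snd a" w]
  by (cases a) (auto simp: D_def letter_inv_def)

lemma raag_eq_swap_Cons: "(fst a, fst b) \<in> E \<Longrightarrow> raag_eq V E (a # b # w) (b # a # w)"
  using raag_eq.commute[of "fst a" "fst b" E V "[]" "snd a" "snd b" w] by simp

section \<open>Reduced words and faithfulness of the representation\<close>

definition p0 :: "'v vec" where "p0 = (\<lambda>_. 1)"

text \<open>The invariant of the orbit of \<open>p0\<close>: the point lies on no simple wall, and
  of two noncommuting coordinates at most one is negative, in a form that survives reflection in a
  positive coordinate.\<close>

definition nice :: "'v vec \<Rightarrow> bool" where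
  "nice x \<longleftrightarrow> (\<forall>c\<in>D. x c \<noteq> 0) \<and>
     (\<forall>c\<in>D. \<forall>d\<in>D. c \<noteq> d \<longrightarrow> (fst c, fst d) \<notin> E \<longrightarrow> x c + x d > 0)"

text \<open>A word is \<open>good\<close> if it is built up letter by letter on the positive side of the
  reflection walls; these turn out to be the reduced words.\<close>

primrec good :: "('v \<times> bool) list \<Rightarrow> bool" where
  "good [] = True"
| "good (a # w) = (a \<in> D \<and> act w p0 (letter_inv a) > 0 \<and> good w)"

lemma good_lists: "good w \<Longrightarrow> w \<in> lists D"
  by (induction w) auto

lemma reflect_nice:
  assumes "nice x" "c \<in> D" "x c > 0" "\<forall>d\<in>D. reflect c x d \<noteq> 0"
  shows "nice (reflect c x)"
  unfolding nice_def
proof (intro conjI ballI impI)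
  fix d e assume de: "d \<in> D" "e \<in> D" "d \<noteq> e" "(fst d, fst e) \<notin> E"
  have *: "x d + x e > 0" "e \<noteq> c \<Longrightarrow> (fst c, fst e) \<notin> E \<Longrightarrow> x c + x e > 0"
     "d \<noteq> c \<Longrightarrow> (fst c, fst d) \<notin> E \<Longrightarrow> x c + x d > 0"
    using assms de by (auto simp: nice_def)
  have "(fst e, fst d) \<notin> E" using de E_sym by blast
  with * assms(3) de show "reflect c x d + reflect c x e > 0"
    by (auto simp: reflect_def)
qed (use assms in auto)

lemma nice_sum: "nice x \<Longrightarrow> c \<in> D \<Longrightarrow> d \<in> D \<Longrightarrow> c \<noteq> d \<Longrightarrow> (fst c, fst d) \<notin> E \<Longrightarrow> x c + x d > 0"
  by (auto simp: nice_def)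

lemma nice_pair: "nice x \<Longrightarrow> c \<in> D \<Longrightarrow> x c + x (letter_inv c) > 0"
  using E_irrefl by (auto simp: nice_def)

text \<open>The new value is \<open>(x a + x c) + (x a + x (letter_inv a)) + 5 * x (letter_inv
  a)\<close>, with all three summands positive.\<close>

lemma act1_noncomm_pos:
  assumes "nice x" "a \<in> D" "c \<in> D" "x (letter_inv a) > 0" "fst a \<noteq> fst c" "(fst a, fst c) \<notin> E"
  shows "act1 a x c > 0"
proof -
  have "c \<noteq> a" "c \<noteq> letter_inv a" using assms(5) by auto
  then have "x a + x c > 0" "x a + x (letter_inv a) > 0" 
    using assms by (auto intro: nice_sum nice_pair)
  then show ?thesis using assms act1_values(4)[of a c x] by auto
qed

lemma act1_nice:
  assumes x: "nice x" and a: "a \<in> D" "x (letter_inv a) > 0"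
  shows "nice (act1 a x)"
proof -
  let ?y = "reflect (letter_inv a) x"
  have "?y d \<noteq> 0" if d: "d \<in> D" for d
  proof (cases "d = letter_inv a \<or> (fst a, fst d) \<in> E")
    case True
    then show ?thesis using x a d by (auto simp: reflect_def nice_def)
  next
    case False
    then have "x (letter_inv a) + x d > 0" using x a d by (auto intro!: nice_sum)
    then show ?thesis using False a by (auto simp: reflect_def)
  qed
  then have y: "nice ?y" using reflect_nice[OF x, of "letter_inv a"] a by auto
  \<comment> \<open>This coordinate is now \<open>x a + 2 * x (letter_inv a)\<close>, so the second
    reflection also starts on the positive side.\<close>
  have ya: "?y a > 0" using nice_pair[OF x a(1)] a(2) E_irrefl by (auto simp: reflect_def)
  have "reflect a ?y d \<noteq> 0" if d: "d \<in> D" for d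
  proof (cases "d = a \<or> (fst a, fst d) \<in> E")
    case True
    then show ?thesis using y a d ya by (auto simp: reflect_def[of a] nice_def)
  next
    case False
    then have "?y a + ?y d > 0" using y a d by (auto intro!: nice_sum)
    then show ?thesis using False ya by (auto simp: reflect_def[of a])
  qed
  then show ?thesis using reflect_nice[OF y, of a] a ya by (auto simp: act1_def)
qed

lemma good_nice: "good w \<Longrightarrow> nice (act w p0)"
proof (induction w)
  case Nil
  then show ?case by (auto simp: nice_def p0_def)
next
  case (Cons a w)
  then show ?case using act1_nice by auto
qed

text \<open>The exchange property. The head \<open>d\<close> of a good word makes the coordinates of
  all letters other than \<open>d\<close> that do not commute with it positive. So unless
  \<open>d = c\<close>, the negative coordinate comes from the tail, and \<open>c\<close> commutes
  past \<open>d\<close>.\<close>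

lemma good_split:
  assumes "good w" "c \<in> D" "act w p0 c < 0"
  obtains w' where "good (c # w')" "raag_eq V E w (c # w')" "Suc (length w') = length w"
  using assms
proof (induction w arbitrary: thesis)
  case Nil
  then show ?case by (auto simp: p0_def)
next
  case (Cons d w)
  let ?x = "act w p0"
  have x: "nice ?x" "?x (letter_inv d) > 0" "d \<in> D" "good w" using Cons by (auto intro: good_nice)
  consider "d = c" | "c = letter_inv d" | "fst d \<noteq> fst c" "(fst d, fst c) \<notin> E" | "(fst d, fst c) \<in> E"
    using same_vertex[of c d] by metis
  then show ?case
  proof cases
    case 1
    then show ?thesis using Cons(2)[of w] Cons.prems by (auto intro: raag_eq.refl)
  next
    case 2
    then have "act1 d ?x c > 0" using nice_pair[OF x(1,3)] x(2) by (simp add: act1_values)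
    then show ?thesis using Cons by simp
  next
    case 3
    then have "act1 d ?x c > 0" using act1_noncomm_pos x Cons by auto
    then show ?thesis using Cons by simp
  next
    case 4
    then have "?x c < 0" using Cons by (simp add: act1_values)
    then obtain w' where w': "good (c # w')" "raag_eq V E w (c # w')" "Suc (length w') = length w"
      using Cons.IH x Cons.prems by blast
    have "act w' p0 = act1 (letter_inv c) ?x" using act_cong[OF w'(2)] by (simp add: act1_inv_left)
    moreover have "(fst c, fst d) \<in> E" using 4 E_sym by blast
    ultimately have "good (c # d # w')" using w' x 4 E_sym by (simp add: act1_values)
    moreover have "raag_eq V E (d # w) (c # d # w')"
      using raag_eq_Cons[OF w'(2)] raag_eq_swap_Cons[OF 4] raag_eq.trans by blast
    ultimately show ?thesis using Cons(2)[of "d # w'"] w' by simp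
  qed
qed

text \<open>Prepending \<open>a\<close> to a good word is bad only if the word can be rewritten to
  start with the inverse of \<open>a\<close>, and then the two cancel.\<close>

lemma good_exists:
  assumes "w \<in> lists D"
  obtains w' where "good w'" "raag_eq V E w w'" "length w' \<le> length w"
  using assms
proof (induction w arbitrary: thesis)
  case Nil
  then show ?case using raag_eq.refl by force
next
  case (Cons a w)
  then obtain w' where w': "good w'" "raag_eq V E w w'" "length w' \<le> length w" by auto
  have a: "a \<in> D" using Cons by auto
  show ?case
  proof (cases "act w' p0 (letter_inv a) > 0")
    case True
    then show ?thesis using Cons.prems(1)[of "a # w'"] w' a by (auto intro: raag_eq_Cons)
  next
    case False
    then have "act w' p0 (letter_inv a) < 0"
      using good_nice[OF w'(1)] a unfolding nice_def by (metis letter_inv_D less_eq_real_def not_less)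
    then obtain w'' where w'': "good (letter_inv a # w'')" "raag_eq V E w' (letter_inv a # w'')" "Suc (length w'') = length w'"
      using good_split[OF w'(1), of "letter_inv a"] a by auto
    have "raag_eq V E (a # w) (a # letter_inv a # w'')"
      using raag_eq_Cons raag_eq.trans w' w'' by metis
    then have "raag_eq V E (a # w) w''" using raag_eq_cancel_Cons[OF a] raag_eq.trans by metis
    then show ?thesis using Cons.prems(1)[of w''] w'' w' by auto
  qed
qed

lemma good_head_neg:
  assumes "good (a # w)" shows "act (a # w) p0 a < 0"
  using assms nice_pair[OF good_nice[of w], of a] by (auto simp: act1_values)

text \<open>A nonempty good word makes the coordinate of its first letter negative, whereas here all
  are 1. So faithfulness is already visible at the single point \<open>p0\<close>.\<close>

lemma act_trivial_raag_eq:
  assumes "w \<in> lists D" "\<forall>d\<in>D. act w p0 d = 1"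
  shows "raag_eq V E w []"
proof -
  obtain w' where w': "good w'" "raag_eq V E w w'" by (rule good_exists[OF assms(1)])
  have "w' = []"
  proof (cases w')
    case (Cons a u)
    then have "act w p0 a < 0" "a \<in> D" using good_head_neg[of a u] w' act_cong[OF w'(2)] by auto
    then show ?thesis using assms(2) by auto
  qed
  then show ?thesis using w' by simp
qed

lemma raag_eq_inv: "w \<in> lists D \<Longrightarrow> raag_eq V E (word_inv w @ w) []"
  using act_trivial_raag_eq[of "word_inv w @ w"]
  by (auto simp: act_append act_inv p0_def)

lemma raag_eq_inv': "w \<in> lists D \<Longrightarrow> raag_eq V E (w @ word_inv w) []"
  using raag_eq_inv[of "word_inv w"] by simp

text \<open>Vectors also have coordinates outside \<open>D\<close>, but these never feed back into
  \<open>D\<close>.\<close>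

lemma act_local:
  assumes "w \<in> lists D" "\<forall>d\<in>D. x d = y d"
  shows "\<forall>d\<in>D. act w x d = act w y d"
  using assms(1)
proof (induction w)
  case (Cons a w)
  then show ?case by (auto simp: act1_def reflect_def)
qed (use assms in auto)

lemma act_faithful:
  assumes w: "w \<in> lists D" "w' \<in> lists D" and eq: "\<forall>d\<in>D. act w p0 d = act w' p0 d"
  shows "raag_eq V E w w'"
proof -
  have "\<forall>d\<in>D. act (word_inv w' @ w) p0 d = act (word_inv w') (act w' p0) d"
    using act_local[OF word_inv_D[THEN iffD2, OF w(2)] eq] by (auto simp: act_append)
  then have "raag_eq V E (word_inv w' @ w) []"
    using w act_inv(2)[of w' p0] by (intro act_trivial_raag_eq) (auto simp: p0_def)
  then have "raag_eq V E (w' @ word_inv w' @ w) w'"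
    using raag_eq_context[of _ _ w' "[]"] by fastforce
  moreover have "raag_eq V E (w' @ word_inv w' @ w) w"
    using raag_eq_context[OF raag_eq_inv'[OF w(2)], of "[]" w] by simp
  ultimately show ?thesis using raag_eq.sym raag_eq.trans by metis
qed

end

text \<open>The notation \<open>inv\<close> is taken by the inverse of a group.\<close>

abbreviation finv :: "('a \<Rightarrow> 'b) \<Rightarrow> 'b \<Rightarrow> 'a" where "finv \<equiv> inv_into UNIV"

context raag_graph
begin

section \<open>The group as operators on vectors, and the orbit of \<open>p0\<close>\<close>

definition ops :: "('v vec \<Rightarrow> 'v vec) set" where "ops = act ` lists D"

lemma ops_id [simp]: "id \<in> ops"
  unfolding ops_def by (rule image_eqI[of _ _ "[]"]) auto

lemma ops_comp [simp]: "g \<in> ops \<Longrightarrow> h \<in> ops \<Longrightarrow> g \<circ> h \<in> ops"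
proof -
  assume "g \<in> ops" "h \<in> ops"
  then obtain u w where *: "u \<in> lists D" "w \<in> lists D" "g = act u" "h = act w" by (auto simp: ops_def)
  then have "g \<circ> h = act (u @ w)" "u @ w \<in> lists D" by (simp_all add: act_append)
  then show ?thesis unfolding ops_def by (rule image_eqI)
qed

lemma inv_act: "finv (act w) = act (word_inv w)"
  by (rule inv_unique_comp) (rule act_inv_comp)+

lemma bij_act: "bij (act w)"
  by (rule o_bij) (rule act_inv_comp)+

lemma ops_bij: "g \<in> ops \<Longrightarrow> bij g"
  unfolding ops_def using bij_act by auto

lemma ops_inv [simp]: "g \<in> ops \<Longrightarrow> finv g \<in> ops"
proof -
  assume "g \<in> ops"
  then obtain u where *: "u \<in> lists D" "g = act u" by (auto simp: ops_def)
  then have "finv g = act (word_inv u)" "word_inv u \<in> lists D" by (simp_all add: inv_act)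
  then show ?thesis unfolding ops_def by (rule image_eqI)
qed

lemma ops_pow [simp]: "g \<in> ops \<Longrightarrow> g ^^ n \<in> ops"
  by (induction n) auto

lemma act_ops [simp]: "w \<in> lists D \<Longrightarrow> act w \<in> ops"
  unfolding ops_def by auto

lemma act1_ops [simp]: "a \<in> D \<Longrightarrow> act1 a \<in> ops"
  using act_ops[of "[a]"] by simp

lemma ops_invs: 
  assumes "g \<in> ops" shows "finv g (g x) = x" "g (finv g x) = x" "finv g \<circ> g = id" "g \<circ> finv g = id" "finv (finv g) = g"
  using ops_bij[OF assms]
  by (auto simp: bij_is_inj surj_f_inv_f bij_is_surj inv_inv_eq fun_eq_iff)

lemma ops_inv_comp: "g \<in> ops \<Longrightarrow> h \<in> ops \<Longrightarrow> finv (g \<circ> h) = finv h \<circ> finv g"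
  by (rule o_inv_distrib) (auto intro: ops_bij)

lemma ops_good:
  assumes "g \<in> ops" obtains w where "good w" "act w = g"
proof -
  obtain u where "u \<in> lists D" "g = act u" using assms by (auto simp: ops_def)
  then show ?thesis using that good_exists[of u] act_cong by metis
qed

text \<open>Agreement at \<open>p0\<close> makes the underlying words congruent, and congruent words
  act identically on every vector, including the coordinates outside \<open>D\<close>.\<close>

lemma ops_eqI:
  assumes "g \<in> ops" "h \<in> ops" "\<And>d. d \<in> D \<Longrightarrow> g p0 d = h p0 d"
  shows "g = h"
proof -
  obtain u w where *: "u \<in> lists D" "w \<in> lists D" "g = act u" "h = act w"
    using assms(1,2) by (auto simp: ops_def)
  then show ?thesis using act_cong[OF act_faithful[of u w]] assms(3) by simp
qed

lemma ops_linear: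
  assumes "g \<in> ops" "d \<in> D"
  shows "\<exists>c. \<forall>x. g x d = (\<Sum>e\<in>D. c e * x e)"
proof -
  have unit: "\<exists>c. \<forall>x :: 'v vec. x d = (\<Sum>e\<in>D. c e * x e)" if "d \<in> D" for d
  proof (rule exI[of _ "\<lambda>e. if e = d then 1 else 0"], rule allI)
    fix x :: "'v vec"
    have "(\<Sum>e\<in>D. (if e = d then 1 else 0) * x e) = (\<Sum>e\<in>D. if e = d then x e else 0)"
      by (intro sum.cong) auto
    then show "x d = (\<Sum>e\<in>D. (if e = d then 1 else 0) * x e)" using that finD by simp
  qed
  have refl: "\<exists>c. \<forall>x :: 'v vec. reflect b (g x) d = (\<Sum>e\<in>D. c e * x e)"
    if lin: "\<And>d. d \<in> D \<Longrightarrow> \<exists>c. \<forall>x :: 'v vec. g x d = (\<Sum>e\<in>D. c e * x e)"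
      and b: "b \<in> D" and d: "d \<in> D" for g b d
  proof -
    obtain c1 where c1: "\<forall>x. g x d = (\<Sum>e\<in>D. c1 e * x e)" using lin[OF d] ..
    obtain c2 where c2: "\<forall>x. g x b = (\<Sum>e\<in>D. c2 e * x e)" using lin[OF b] ..
    define r where "r = (if d = b then (0::real) else 1)"
    define s where "s = (if d = b then (-1::real) else if (fst b, fst d) \<in> E then 0 else 2)"
    have "reflect b (g x) d = r * g x d + s * g x b" for x
      by (auto simp: r_def s_def reflect_def)
    then have "\<forall>x. reflect b (g x) d = (\<Sum>e\<in>D. (r * c1 e + s * c2 e) * x e)"
      using c1 c2 by (simp add: sum_distrib_left sum.distrib algebra_simps)
    then show ?thesis by (rule exI[of _ "\<lambda>e. r * c1 e + s * c2 e"])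
  qed
  obtain w where w: "w \<in> lists D" "g = act w" using assms unfolding ops_def by auto
  have "\<forall>d\<in>D. \<exists>c. \<forall>x. act w x d = (\<Sum>e\<in>D. c e * x e)"
    using w(1)
  proof (induction w)
    case Nil
    show ?case using unit by simp
  next
    case (Cons a w)
    have "\<exists>c. \<forall>x. reflect (letter_inv a) (act w x) d = (\<Sum>e\<in>D. c e * x e)" if "d \<in> D" for d
      using refl[of "act w"] Cons that by auto
    then show ?case using refl[of "\<lambda>x. reflect (letter_inv a) (act w x)"] Cons
      by (simp add: act1_def)
  qed
  then show ?thesis using assms(2) w(2) by blast
qed

text \<open>The group acts freely on \<open>p0\<close>, so this is the vertex set of the Cayley
  graph; \<open>g p0\<close> and \<open>g (act1 a p0)\<close> are the ends of an edge labelled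
  \<open>a\<close>.\<close>

definition orb :: "'v vec set" where "orb = (\<lambda>g. g p0) ` ops"

lemma p0_orb [simp]: "p0 \<in> orb"
  unfolding orb_def by (rule image_eqI[of _ _ id]) auto

lemma ops_p0_orb [simp]: "g \<in> ops \<Longrightarrow> g p0 \<in> orb"
  unfolding orb_def by auto

lemma ops_orb [simp]: "g \<in> ops \<Longrightarrow> x \<in> orb \<Longrightarrow> g x \<in> orb"
  unfolding orb_def using ops_comp by (force simp: o_def)

lemma ops_image_orb: assumes g: "g \<in> ops" shows "g ` orb = orb"
proof
  show "g ` orb \<subseteq> orb" using g by auto
  show "orb \<subseteq> g ` orb"
  proof
    fix x assume "x \<in> orb"
    then have "finv g x \<in> orb" "x = g (finv g x)" using g ops_invs(2) by auto
    then show "x \<in> g ` orb" by blast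
  qed
qed

lemma orb_nice: "x \<in> orb \<Longrightarrow> nice x"
proof -
  assume "x \<in> orb"
  then obtain g where g: "g \<in> ops" "x = g p0" by (auto simp: orb_def)
  obtain w where "good w" "act w = g" using ops_good[OF g(1)] .
  then show ?thesis using good_nice g by blast
qed

lemma orb_nz: "x \<in> orb \<Longrightarrow> a \<in> D \<Longrightarrow> x a \<noteq> 0"
  using orb_nice by (auto simp: nice_def)

text \<open>By \<open>good_split\<close> and \<open>good_head_neg\<close>, the elements having a
  reduced word that starts with \<open>a\<close>.\<close>

definition H :: "'v \<times> bool \<Rightarrow> 'v vec set" where "H a = {x \<in> orb. x a < 0}"

lemma p0_notin_H [simp]: "p0 \<notin> H a" by (auto simp: H_def p0_def)

lemma act1_p0_H: "a \<in> D \<Longrightarrow> act1 a p0 \<in> H a"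
  using ops_p0_orb[OF act1_ops] by (auto simp: H_def act1_values p0_def)

lemma notin_H: "x \<in> orb \<Longrightarrow> a \<in> D \<Longrightarrow> x \<notin> H a \<longleftrightarrow> x a > 0"
  using orb_nz[of x a] by (auto simp: H_def)

text \<open>No reduced word for \<open>x\<close> starts with \<open>a\<close> exactly if prepending
  the inverse of \<open>a\<close> causes no cancellation. So the other side of a wall is again a
  translate of a basic halfspace, that of the inverse letter.\<close>

lemma H_compl:
  assumes "a \<in> D" shows "orb - H a = act1 a ` H (letter_inv a)"
proof -
  have "x \<notin> H a \<longleftrightarrow> act1 (letter_inv a) x \<in> H (letter_inv a)" if x: "x \<in> orb" for x
  proof -
    have y: "act1 (letter_inv a) x \<in> orb" using x assms by simp
    have val: "act1 (letter_inv a) x (letter_inv a) = - x (letter_inv a) - 2 * x a"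
      using act1_values(1)[of "letter_inv a" x] by simp
    have sum: "x a + x (letter_inv a) > 0" using nice_pair orb_nice x assms by auto
    show ?thesis
    proof (cases "x a > 0")
      case True
      then show ?thesis using sum y val by (auto simp: H_def)
    next
      case False
      then have xa: "x a < 0" using orb_nz[OF x assms] by auto
      obtain g where g: "g \<in> ops" "x = g p0" using x by (auto simp: orb_def)
      obtain w where w: "good w" "act w = g" using ops_good[OF g(1)] .
      obtain w' where w': "good (a # w')" "raag_eq V E w (a # w')"
        using good_split[OF w(1) assms] xa g w by metis
      have "act1 (letter_inv a) x = act w' p0"
        using act_cong[OF w'(2)] g w act1_inv_left[of a] by simp
      then show ?thesis using w' xa x by (auto simp: H_def)
    qed
  qed
  note * = this
  show ?thesis
  proof (rule subset_antisym; rule subsetI)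
    fix x assume "x \<in> orb - H a"
    then show "x \<in> act1 a ` H (letter_inv a)"
      using * by (intro image_eqI[of _ _ "act1 (letter_inv a) x"]) (auto simp: act1_inv)
  next
    fix x assume "x \<in> act1 a ` H (letter_inv a)"
    then obtain y where y: "x = act1 a y" "y \<in> H (letter_inv a)" by auto
    then have "x \<in> orb" using assms by (auto simp: H_def)
    then show "x \<in> orb - H a" using * y by (auto simp: act1_inv_left)
  qed
qed

section \<open>Walls crossed by edges, and their stabilizers\<close>

definition in_link :: "'v \<times> bool \<Rightarrow> ('v \<times> bool) list \<Rightarrow> bool" where
  "in_link a w \<longleftrightarrow> (\<forall>b\<in>set w. (fst b, fst a) \<in> E)"

lemma in_link_comm:
  "in_link a w \<Longrightarrow> act w (act1 a x) = act1 a (act w x)"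
proof (induction w)
  case (Cons b w)
  then show ?case using act1_comm[of b a] by (auto simp: in_link_def)
qed auto

lemma in_link_coord: "in_link a w \<Longrightarrow> act w x a = x a"
  by (induction w) (auto simp: in_link_def act1_values)

text \<open>A letter becomes first only by commuting forward, so it must occur in the word.\<close>

lemma coord_pos:
  assumes "good w" "c \<in> D" "c \<notin> set w"
  shows "act w p0 c > 0"
proof (rule ccontr)
  assume "\<not> ?thesis"
  then have neg: "act w p0 c < 0"
    using good_nice[OF assms(1)] assms(2) by (auto simp: nice_def less_le)
  show False using assms neg
  proof (induction w)
    case (Cons b w)
    let ?x = "act w p0"
    have x: "nice ?x" "?x (letter_inv b) > 0" "b \<in> D" using Cons by (auto intro: good_nice)
    consider "c = letter_inv b" | "fst b \<noteq> fst c" "(fst b, fst c) \<notin> E" | "(fst b, fst c) \<in> E"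
      using same_vertex[of c b] Cons(4) by (metis list.set_intros(1))
    then show False
    proof cases
      case 1
      then show ?thesis using nice_pair[OF x(1,3)] x(2) Cons by (simp add: act1_values)
    next
      case 2
      then show ?thesis using act1_noncomm_pos[of ?x b c] x Cons by auto
    next
      case 3
      then show ?thesis using Cons by (auto simp: act1_values)
    qed
  qed (auto simp: p0_def)
qed

text \<open>Geometrically, appending a letter on the right crosses exactly one wall.\<close>

lemma exchange:
  assumes "good w" "a \<in> D" "c \<in> D" "act w p0 c > 0" "act w (act1 a p0) c < 0"
  shows "c = a \<and> in_link a w"
  using assms
proof (induction w arbitrary: c)
  case Nil
  have "nice (act1 a p0)" using orb_nice ops_orb[of "act1 a" p0] Nil by auto
  show ?case
  proof (rule ccontr)
    assume "\<not> ?thesis"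
    then have "c \<noteq> a" by (auto simp: in_link_def)
    then consider "c = letter_inv a" | "fst a \<noteq> fst c" "(fst a, fst c) \<notin> E" | "(fst a, fst c) \<in> E"
      using same_vertex[of c a] by metis
    then show False using Nil by cases (auto simp: act1_values p0_def)
  qed
next
  case (Cons b w)
  let ?x = "act w p0" and ?y = "act w (act1 a p0)"
  have w: "good w" "b \<in> D" "?x (letter_inv b) > 0" using Cons by auto
  have "?y = (act w \<circ> act1 a) p0" "act w \<circ> act1 a \<in> ops" using w good_lists Cons by auto
  then have y: "nice ?y" using orb_nice ops_p0_orb by metis
  have yb: "?y (letter_inv b) < 0 \<Longrightarrow> letter_inv b = a \<and> in_link a w"
    using Cons.IH[of "letter_inv b"] w Cons.prems by auto
  have ynz: "?y (letter_inv b) > 0 \<or> ?y (letter_inv b) < 0" using y w unfolding nice_def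
    by (metis letter_inv_D not_less_iff_gr_or_eq)
  have pos: "?y b + ?y (letter_inv b) > 0" using nice_pair[OF y w(2)] .
  \<comment> \<open>If the wall of the inverse of \<open>b\<close> is crossed, the appended
    \<open>a\<close> is that inverse and commutes past \<open>w\<close>, so it cancels the head
    \<open>b\<close>.\<close>
  have undo: "act1 b ?y = ?x" if "letter_inv b = a" "in_link a w"
    using in_link_comm[OF that(2)] act1_inv[of b] that(1) by metis
  consider "c = b" | "c = letter_inv b" | "fst b \<noteq> fst c" "(fst b, fst c) \<notin> E" | "(fst b, fst c) \<in> E"
    using same_vertex[of c b] by metis
  then show ?case
  proof cases
    case 1
    then show ?thesis using good_head_neg[OF Cons(2)] Cons by auto
  next
    case 2
    have "?y (letter_inv b) < 0"
      using ynz pos Cons.prems 2 by (auto simp: act1_values)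
    with yb undo have "act (b # w) (act1 a p0) c = ?x c" by auto
    then show ?thesis using w 2 Cons by auto
  next
    case 3
    have "?y (letter_inv b) < 0"
      using ynz act1_noncomm_pos[OF y w(2) Cons(4) _ 3] Cons.prems by auto
    with yb undo have *: "act (b # w) (act1 a p0) c = ?x c" "letter_inv b = a" "in_link a w" by auto
    have "c \<notin> set w"
    proof
      assume "c \<in> set w"
      then have "(fst c, fst b) \<in> E" using *(2,3) by (auto simp: in_link_def)
      then show False using 3 E_sym by blast
    qed
    then have "?x c > 0" using coord_pos w Cons by auto
    then show ?thesis using * Cons by auto
  next
    case 4
    then have "c = a \<and> in_link a w" using Cons.IH[of c] Cons.prems w by (auto simp: act1_values)
    then show ?thesis using 4 by (auto simp: in_link_def)
  qed
qed

text \<open>A word stabilizing \<open>H a\<close> carries the edge from \<open>p0\<close> to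
  \<open>act1 a p0\<close> to an edge across the same wall, and \<open>exchange\<close> describes
  all of these.\<close>

lemma H_stab_link:
  assumes "good w" "a \<in> D" "act w ` H a = H a"
  shows "in_link a w"
proof -
  have w: "act w \<in> ops" using assms good_lists by auto
  have "act w p0 \<notin> H a"
  proof
    assume "act w p0 \<in> H a"
    then have "act w p0 \<in> act w ` H a" using assms by simp
    then show False using ops_bij[OF w] p0_notin_H by (metis bij_is_inj inj_image_mem_iff)
  qed
  then have 1: "act w p0 a > 0" using notin_H assms w by auto
  have "act w (act1 a p0) \<in> H a" using assms act1_p0_H by blast
  then have 2: "act w (act1 a p0) a < 0" by (auto simp: H_def)
  show ?thesis using exchange[OF assms(1,2,2) 1 2] by simp
qed

lemma in_link_H: "in_link a w \<Longrightarrow> w \<in> lists D \<Longrightarrow> act w ` H a = H a"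
proof -
  assume w: "in_link a w" "w \<in> lists D"
  have "act w y \<in> H a \<longleftrightarrow> y \<in> H a" if "y \<in> orb" for y
    using that in_link_coord[OF w(1)] w by (auto simp: H_def)
  then have *: "act w ` H a = act w ` orb \<inter> H a" by (auto simp: H_def)
  then show ?thesis using ops_image_orb[of "act w"] w by (auto simp: H_def)
qed

text \<open>The bridge to linear algebra: a stabilizer consists of link words, and these leave the
  coordinate \<open>a\<close> of every vector alone.\<close>

lemma H_stab_coord:
  assumes "f \<in> ops" "a \<in> D"
  shows "f ` H a = H a \<longleftrightarrow> (\<forall>x. f x a = x a)"
proof
  assume "f ` H a = H a"
  then show "\<forall>x. f x a = x a"
    using ops_good[OF assms(1)] H_stab_link assms in_link_coord by metis
next
  assume *: "\<forall>x. f x a = x a"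
  then have "f ` H a = f ` orb \<inter> H a" using assms ops_orb by (auto simp: H_def)
  then show "f ` H a = H a" using ops_image_orb[OF assms(1)] by (auto simp: H_def)
qed

text \<open>The root of a wall: the functional whose negative side in the orbit is the translate of
  \<open>H a\<close> by \<open>k\<close>.\<close>

definition wall_fun :: "('v vec \<Rightarrow> 'v vec) \<Rightarrow> 'v \<times> bool \<Rightarrow> 'v vec \<Rightarrow> real" where
  "wall_fun k a x = finv k x a"

lemma halfspace_stab:
  assumes "f \<in> ops" "k \<in> ops" "a \<in> D"
  shows "f ` k ` H a = k ` H a \<longleftrightarrow> (\<forall>x. wall_fun k a (f x) = wall_fun k a x)"
proof -
  have "f ` k ` H a = k ` H a \<longleftrightarrow> finv k ` f ` k ` H a = finv k ` k ` H a"
    using ops_bij[of "finv k"] assms by (simp add: bij_is_inj inj_image_eq_iff)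
  also have "\<dots> \<longleftrightarrow> (finv k \<circ> f \<circ> k) ` H a = H a"
    using ops_invs[OF assms(2)] by (simp add: image_comp o_assoc)
  also have "\<dots> \<longleftrightarrow> (\<forall>x. (finv k \<circ> f \<circ> k) x a = x a)"
    using assms by (intro H_stab_coord) auto
  also have "\<dots> \<longleftrightarrow> (\<forall>x. wall_fun k a (f x) = wall_fun k a x)"
    unfolding wall_fun_def using ops_invs[OF assms(2)] by (metis comp_apply)
  finally show ?thesis .
qed

definition coord_funs :: "('v vec \<Rightarrow> real) set" where "coord_funs = (\<lambda>d x. x d) ` D"

lemma coord_funs: "finite coord_funs" "card coord_funs \<le> card D"
  unfolding coord_funs_def using finD card_image_le by auto

lemma sum_real_fun_apply: "(\<Sum>e\<in>A. f e) x = (\<Sum>e\<in>A. (f e x :: real))"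
  by (induction A rule: infinite_finite_induct) auto

lemma wall_fun_span:
  assumes "k \<in> ops" "a \<in> D"
  shows "wall_fun k a \<in> fun_space.span coord_funs"
proof -
  obtain c where c: "\<forall>x. finv k x a = (\<Sum>e\<in>D. c e * x e)" using ops_linear assms ops_inv by blast
  have "wall_fun k a = (\<Sum>e\<in>D. (\<lambda>x. c e * x e))"
    using c by (auto simp: wall_fun_def fun_eq_iff sum_real_fun_apply)
  also have "\<dots> \<in> fun_space.span coord_funs"
    by (intro fun_space.span_sum fun_space.span_scale[of "\<lambda>x. x _"] fun_space.span_base)
       (auto simp: coord_funs_def)
  finally show ?thesis .
qed

lemma invariant_subspace: "fun_space.subspace {\<psi> :: 'v vec \<Rightarrow> real. \<forall>x. \<psi> (f x) = \<psi> x}"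
  by (auto simp: fun_space.subspace_def)

text \<open>Roots move under \<open>h\<close> by the linear map \<open>\<psi> \<circ> finv h\<close>
  within the span of \<open>card D\<close> coordinate functionals, so the first
  \<open>card D\<close> of them span the others; the functionals invariant under \<open>f\<close>
  form a subspace.\<close>

lemma krylov_stab:
  assumes f: "f \<in> ops" and h: "h \<in> ops" and k: "k \<in> ops" and a: "a \<in> D"
    and fixed: "\<And>i. i < card D \<Longrightarrow> f ` (h ^^ i) ` k ` H a = (h ^^ i) ` k ` H a"
  shows "f ` (h ^^ i) ` k ` H a = (h ^^ i) ` k ` H a"
proof -
  define v where "v i = wall_fun (h ^^ i \<circ> k) a" for i
  have step: "v i \<circ> finv h = v (Suc i)" for i
    using h k by (auto simp: v_def wall_fun_def fun_eq_iff ops_inv_comp)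
  have stab: "f ` (h ^^ i) ` k ` H a = (h ^^ i) ` k ` H a \<longleftrightarrow> (\<forall>x. v i (f x) = v i x)" for i
    using halfspace_stab[of f "h ^^ i \<circ> k" a] assms by (simp add: v_def image_comp o_assoc)
  have "v i \<in> fun_space.span (v ` {..<card D})"
    by (rule krylov_span[where M = "\<lambda>\<psi>. \<psi> \<circ> finv h", OF coord_funs])
       (use step wall_fun_span h k a in \<open>auto simp: v_def fun_eq_iff\<close>)
  moreover have "fun_space.span (v ` {..<card D}) \<subseteq> {\<psi>. \<forall>x. \<psi> (f x) = \<psi> x}"
    using fixed stab by (intro fun_space.span_minimal invariant_subspace) auto
  ultimately show ?thesis using stab by blast
qed

end

section \<open>Nested families of halfspaces\<close>

lemma int_Max_below:
  fixes P :: "int \<Rightarrow> bool"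
  assumes "P a" "\<And>i. P i \<Longrightarrow> i \<le> b"
  obtains m where "P m" "\<And>i. P i \<Longrightarrow> i \<le> m"
proof -
  let ?A = "{i. a \<le> i \<and> i \<le> b \<and> P i}"
  have fin: "finite ?A" by (rule finite_subset[of _ "{a..b}"]) auto
  have ne: "?A \<noteq> {}" using assms by auto
  have "P (Max ?A)" "a \<le> Max ?A" using Max_in[OF fin ne] by auto
  moreover have "i \<le> Max ?A" if "P i" for i
  proof (cases "a \<le> i")
    case True
    then show ?thesis using Max_ge[OF fin, of i] assms that by auto
  next
    case False
    then show ?thesis using \<open>a \<le> Max ?A\<close> by linarith
  qed
  ultimately show ?thesis using that by blast
qed

text \<open>The half-trees of a tree, without the tree. Points of \<open>\<Omega>\<close> determine
  vertices, possibly many points the same one.\<close>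

locale tree_family =
  fixes \<Omega> :: "'x set" and Hs :: "'x set set"
  assumes Hs_sub: "K \<in> Hs \<Longrightarrow> K \<subseteq> \<Omega>"
    and Hs_ne: "K \<in> Hs \<Longrightarrow> K \<noteq> {}" "K \<in> Hs \<Longrightarrow> K \<noteq> \<Omega>"
    and Hs_compl: "K \<in> Hs \<Longrightarrow> \<Omega> - K \<in> Hs"
    and nested: "K \<in> Hs \<Longrightarrow> L \<in> Hs \<Longrightarrow> K \<subseteq> L \<or> L \<subseteq> K \<or> K \<inter> L = {} \<or> K \<union> L = \<Omega>"
    and fin_sep: "x \<in> \<Omega> \<Longrightarrow> y \<in> \<Omega> \<Longrightarrow> finite {K \<in> Hs. x \<in> K \<and> y \<notin> K}"
begin

text \<open>An oriented bi-infinite geodesic, recorded by the half-trees that it enters in turn; the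
  last conjunct says that it skips none.\<close>

definition line :: "(int \<Rightarrow> 'x set) \<Rightarrow> bool" where
  "line e \<longleftrightarrow> range e \<subseteq> Hs \<and> (\<forall>i. e (i + 1) \<subset> e i) \<and>
     (\<forall>K\<in>Hs. \<forall>i j. e j \<subseteq> K \<longrightarrow> K \<subseteq> e i \<longrightarrow> K \<in> range e)"

lemma line_Hs: "line e \<Longrightarrow> e i \<in> Hs"
  by (auto simp: line_def)

lemma line_convex: "line e \<Longrightarrow> K \<in> Hs \<Longrightarrow> e j \<subseteq> K \<Longrightarrow> K \<subseteq> e i \<Longrightarrow> K \<in> range e"
  by (auto simp: line_def)

lemma line_less:
  assumes "line e" "i < j" shows "e j \<subset> e i"
proof -
  have "e (i + int n + 1) \<subset> e i" for n
  proof (induction n)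
    case 0
    show ?case using assms by (simp add: line_def)
  next
    case (Suc n)
    have "e (i + int (Suc n) + 1) \<subset> e (i + int n + 1)"
      using assms(1)[unfolded line_def] by (metis add.assoc add.commute of_nat_Suc)
    with Suc show ?case by blast
  qed
  from this[of "nat (j - i - 1)"] assms(2) show ?thesis by simp
qed

lemma line_le_iff: "line e \<Longrightarrow> e j \<subseteq> e i \<longleftrightarrow> i \<le> j"
  using line_less[of e j i] line_less[of e i j] by (cases i j rule: linorder_cases) auto

lemma line_eq_iff: "line e \<Longrightarrow> e j = e i \<longleftrightarrow> i = j"
  using line_le_iff[of e i j] line_le_iff[of e j i] by auto

lemma line_inj: "line e \<Longrightarrow> inj e"
  by (auto simp: inj_def line_eq_iff)

lemma line_leave:
  assumes "line e" "x \<in> \<Omega>" shows "\<exists>j. x \<notin> e j"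
proof (rule ccontr)
  assume *: "\<not> ?thesis"
  obtain y where y: "y \<in> \<Omega>" "y \<notin> e 0" using Hs_sub Hs_ne line_Hs[OF assms(1)] by blast
  have "y \<notin> e (int n)" for n using y line_le_iff[OF assms(1), of "int n" 0] by auto
  then have "range (\<lambda>n. e (int n)) \<subseteq> {K \<in> Hs. x \<in> K \<and> y \<notin> K}"
    using * line_Hs[OF assms(1)] by auto
  then have "finite (range (\<lambda>n. e (int n)))" using fin_sep[OF assms(2) y(1)] finite_subset by blast
  moreover have "inj (\<lambda>n. e (int n))" using assms by (auto simp: inj_def line_eq_iff)
  ultimately show False using finite_imageD infinite_UNIV_nat by blast
qed

lemma line_rev:
  assumes "line e" shows "line (\<lambda>i. \<Omega> - e (- i))"
proof -
  have sub: "e i \<subseteq> \<Omega>" for i using line_Hs[OF assms] Hs_sub by blast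
  have "\<Omega> - e (- (i + 1)) \<subset> \<Omega> - e (- i)" for i
    using line_less[OF assms, of "- (i + 1)" "- i"] sub[of "- i"] sub[of "- (i + 1)"] by auto
  moreover have "K \<in> range (\<lambda>i. \<Omega> - e (- i))"
    if K: "K \<in> Hs" "\<Omega> - e (- j) \<subseteq> K" "K \<subseteq> \<Omega> - e (- i)" for K i j
  proof -
    have "\<Omega> - K \<in> range e"
      using K line_convex[OF assms, of "\<Omega> - K" "- i" "- j"] Hs_compl[of K] sub[of "- i"] by blast
    then obtain l where "\<Omega> - K = e l" by auto
    then have "K = \<Omega> - e (- (- l))" using Hs_sub[OF K(1)] by auto
    then show ?thesis by blast
  qed
  ultimately show ?thesis
    unfolding line_def using Hs_compl line_Hs[OF assms] by auto
qed

lemma line_enter: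
  assumes "line e" "x \<in> \<Omega>" shows "\<exists>j. x \<in> e j"
  using line_leave[OF line_rev[OF assms(1)] assms(2)] assms by auto

text \<open>The nearest point projection to the line, given as the index of the last half-tree of
  the line that contains \<open>x\<close>.\<close>

definition level :: "(int \<Rightarrow> 'x set) \<Rightarrow> 'x \<Rightarrow> int" where
  "level e x = (THE l. \<forall>i. x \<in> e i \<longleftrightarrow> i \<le> l)"

lemma level_iff:
  assumes "line e" "x \<in> \<Omega>" shows "x \<in> e i \<longleftrightarrow> i \<le> level e x"
proof -
  obtain lo hi where *: "x \<in> e lo" "x \<notin> e hi" using line_enter line_leave assms by metis
  have down: "x \<in> e i \<Longrightarrow> j \<le> i \<Longrightarrow> x \<in> e j" for i j using line_le_iff[OF assms(1), of i j] by auto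
  obtain m where m: "x \<in> e m" "\<And>i. x \<in> e i \<Longrightarrow> i \<le> m"
  proof (rule int_Max_below[of "\<lambda>i. x \<in> e i" lo hi])
    show "i \<le> hi" if "x \<in> e i" for i using that *(2) down[of i hi] by linarith
  qed (use * in blast)+
  have "\<exists>!l. \<forall>i. x \<in> e i \<longleftrightarrow> i \<le> l"
  proof (rule ex1I[of _ m])
    show "\<forall>i. x \<in> e i \<longleftrightarrow> i \<le> m" using m down by blast
    fix l assume "\<forall>i. x \<in> e i \<longleftrightarrow> i \<le> l"
    then show "l = m" using m by (metis order_antisym order_refl)
  qed
  from theI'[OF this] show ?thesis unfolding level_def by blast
qed

lemma level_eqI: "line e \<Longrightarrow> x \<in> \<Omega> \<Longrightarrow> (\<And>i. x \<in> e i \<longleftrightarrow> i \<le> l) \<Longrightarrow> level e x = l"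
  using level_iff by (metis order_antisym order_refl)

lemma level_surj:
  assumes "line e" shows "\<exists>x\<in>\<Omega>. level e x = l"
proof -
  obtain x where x: "x \<in> e l" "x \<notin> e (l + 1)" using line_less[OF assms, of l "l + 1"] by auto
  then have "x \<in> \<Omega>" using Hs_sub line_Hs[OF assms] by blast
  then show ?thesis using x level_iff[OF assms, of x] by (intro bexI[of _ x]) (auto simp: not_le)
qed

text \<open>Let \<open>e j\<close> be the last half-tree of the line containing \<open>K\<close>. As
  \<open>e (j + 1) \<subseteq> K\<close> would put \<open>K\<close> on the line, nestedness leaves
  only that \<open>K\<close> and \<open>e (j + 1)\<close> are disjoint.\<close>

lemma off_line_aux:
  assumes e: "line e" and K: "K \<in> Hs" "K \<notin> range e" "K \<subseteq> e j0"
  shows "\<exists>j. \<forall>x\<in>K. level e x = j"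
proof -
  obtain x where x: "x \<in> K" using Hs_ne K by blast
  obtain j where j: "K \<subseteq> e j" "\<And>i. K \<subseteq> e i \<Longrightarrow> i \<le> j"
  proof (rule int_Max_below[of "\<lambda>i. K \<subseteq> e i" j0 "level e x"])
    show "i \<le> level e x" if "K \<subseteq> e i" for i
      using level_iff[OF e, of x i] that x Hs_sub[OF K(1)] by blast
  qed (use K in blast)+
  then have "\<not> K \<subseteq> e (j + 1)" by force
  moreover have "\<not> e (j + 1) \<subseteq> K" using line_convex[OF e K(1) _ j(1)] K by blast
  moreover have "K \<union> e (j + 1) \<noteq> \<Omega>"
    using j(1) line_less[OF e, of j "j + 1"] Hs_ne(2)[OF line_Hs[OF e, of j]] Hs_sub[OF line_Hs[OF e, of j]] by auto
  ultimately have "K \<inter> e (j + 1) = {}" using nested[OF K(1) line_Hs[OF e]] by blast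
  then have "level e y = j" if "y \<in> K" for y
  proof -
    have "y \<in> e j" "y \<notin> e (j + 1)" "y \<in> \<Omega>" 
      using that j(1) \<open>K \<inter> e (j + 1) = {}\<close> Hs_sub[OF K(1)] by auto
    then show ?thesis using level_iff[OF e, of y] by force
  qed
  then show ?thesis by blast
qed

lemma off_line:
  assumes e: "line e" and K: "K \<in> Hs" "K \<notin> range e" "\<Omega> - K \<notin> range e"
  shows "(\<exists>j. \<forall>x\<in>K. level e x = j) \<or> (\<exists>j. \<forall>x\<in>\<Omega> - K. level e x = j)"
proof -
  obtain x where x: "x \<in> K" "x \<in> \<Omega>" using Hs_ne Hs_sub K by blast
  obtain y where y: "y \<notin> K" "y \<in> \<Omega>" using Hs_ne Hs_sub K by blast
  define j where "j = min (level e x) (level e y)"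
  have "x \<in> e j" "y \<in> e j" using level_iff[OF e] x y by (auto simp: j_def)
  then have "K \<subseteq> e j \<or> \<Omega> - K \<subseteq> e j" using nested[OF K(1) line_Hs[OF e, of j]] x y by blast
  then show ?thesis using off_line_aux[OF e] K Hs_compl by blast
qed

section \<open>Overlaps of two lines\<close>

definition meets :: "(int \<Rightarrow> 'x set) \<Rightarrow> (int \<Rightarrow> 'x set) \<Rightarrow> int \<Rightarrow> bool" where
  "meets e f i \<longleftrightarrow> e i \<in> range f \<or> \<Omega> - e i \<in> range f"

text \<open>Otherwise the complement of every \<open>e i\<close> would project to a single point of
  \<open>f\<close>. These complements exhaust the space as \<open>i\<close> grows, so
  \<open>level f\<close> would be constant.\<close>

lemma line_bands_aux:
  assumes e: "line e" and f: "line f" and gap: "\<And>a. \<exists>i\<in>{a..a + M}. \<not> meets e f i"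
  shows "\<exists>i j. \<forall>x\<in>e i. level f x = j"
proof (rule ccontr)
  assume no: "\<not> ?thesis"
  have all: "\<exists>j. \<forall>x\<in>\<Omega> - e i. level f x = j" for i
  proof -
    obtain i' where i': "i' \<ge> i" "\<not> meets e f i'" using gap[of i] by auto
    then obtain j where j: "\<forall>x\<in>\<Omega> - e i'. level f x = j"
      using off_line[OF f line_Hs[OF e], of i'] no unfolding meets_def by blast
    have "e i' \<subseteq> e i" using line_le_iff[OF e] i'(1) by blast
    then show ?thesis using j by blast
  qed
  obtain j where j: "\<forall>x\<in>\<Omega> - e 0. level f x = j" using all by blast
  obtain y where y: "y \<in> \<Omega>" "y \<notin> e 0" using Hs_sub Hs_ne line_Hs[OF e] by blast
  have "level f x = j" if x: "x \<in> \<Omega>" for x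
  proof -
    obtain i where i: "x \<notin> e i" using line_leave[OF e x] by blast
    define k where "k = max i 0"
    obtain j' where j': "\<forall>x\<in>\<Omega> - e k. level f x = j'" using all by blast
    have "e k \<subseteq> e i" "e k \<subseteq> e 0" using line_le_iff[OF e] by (auto simp: k_def)
    then have "level f x = j'" "level f y = j'" using i x y j' by auto
    then show ?thesis using j y by auto
  qed
  moreover obtain x where "x \<in> \<Omega>" "level f x = j + 1" using level_surj[OF f] by blast
  ultimately show False by force
qed

text \<open>Two lines with short overlap: every point of one of them, except those near a fixed place,
  projects near a fixed place of the other.\<close>

lemma line_bands:
  assumes e: "line e" and f: "line f" and gap: "\<And>a. \<exists>i\<in>{a..a + M}. \<not> meets e f i"
  obtains q q' where "\<And>x. x \<in> \<Omega> \<Longrightarrow> \<bar>level f x - q'\<bar> > M + 2 \<Longrightarrow> \<bar>level e x - q\<bar> \<le> M + 2"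
proof -
  have sub: "e i \<subseteq> \<Omega>" "f i \<subseteq> \<Omega>" for i using line_Hs e f Hs_sub by blast+
  \<comment> \<open>By \<open>off_line\<close> one of \<open>up i\<close> and \<open>dn i\<close>
    holds wherever the lines do not meet. Both cannot hold, because \<open>f\<close> has more than
    two levels.\<close>
  define up where "up i \<longleftrightarrow> (\<exists>j. \<forall>x\<in>e i. level f x = j)" for i
  define dn where "dn i \<longleftrightarrow> (\<exists>j. \<forall>x\<in>\<Omega> - e i. level f x = j)" for i
  have up_mono: "up i \<Longrightarrow> i \<le> k \<Longrightarrow> up k" for i k
    using line_le_iff[OF e, of k i] unfolding up_def by blast
  have dn_mono: "dn i \<Longrightarrow> k \<le> i \<Longrightarrow> dn k" for i k
    using line_le_iff[OF e, of i k] unfolding dn_def by blast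
  have excl: "\<not> (up i \<and> dn i)" for i
  proof
    assume "up i \<and> dn i"
    then obtain j j' where *: "\<forall>x\<in>e i. level f x = j" "\<forall>x\<in>\<Omega> - e i. level f x = j'"
      unfolding up_def dn_def by blast
    obtain x where "x \<in> \<Omega>" "level f x = max j j' + 1" using level_surj[OF f] by blast
    then show False using * by (cases "x \<in> e i") force+
  qed
  have "\<exists>i. up i" using line_bands_aux[OF e f gap] unfolding up_def by blast
  then obtain u where u: "up u" by blast
  have gap': "\<exists>i\<in>{a..a + M}. \<not> meets (\<lambda>i. \<Omega> - e (- i)) f i" for a
  proof -
    obtain i where i: "i \<in> {- a - M..- a - M + M}" "\<not> meets e f i" using gap by blast
    moreover have "\<Omega> - (\<Omega> - e i) = e i" using sub by blast
    ultimately show ?thesis by (intro bexI[of _ "- i"]) (auto simp: meets_def)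
  qed
  obtain d where d: "dn d" using line_bands_aux[OF line_rev[OF e] f gap'] unfolding dn_def by blast
  obtain i0 where i0: "dn i0" "\<And>i. dn i \<Longrightarrow> i \<le> i0"
  proof (rule int_Max_below[of dn d u])
    show "i \<le> u" if "dn i" for i using that excl[of i] up_mono[OF u, of i] by linarith
  qed (use d in blast)+
  obtain m where m: "up (- m)" "\<And>i. up (- i) \<Longrightarrow> i \<le> m"
  proof (rule int_Max_below[of "\<lambda>i. up (- i)" "- u" "- d"])
    show "up (- (- u))" using u by simp
    show "i \<le> - d" if "up (- i)" for i using that d excl[of d] up_mono[of "- i" d] by linarith
  qed blast
  define i1 where "i1 = - m"
  have i1: "up i1" "\<And>i. up i \<Longrightarrow> i1 \<le> i" using m(1) m(2)[of "- _"] by (force simp: i1_def)+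
  have lt: "i0 < i1" using excl[of i0] up_mono[OF i1(1), of i0] i0 by linarith
  \<comment> \<open>Strictly between \<open>i0\<close> and \<open>i1\<close> neither property holds,
    so the lines meet at every index there.\<close>
  have "i1 - i0 - 1 \<le> M"
  proof (rule ccontr)
    assume "\<not> ?thesis"
    obtain i where i: "i \<in> {i0 + 1..i0 + 1 + M}" "\<not> meets e f i" using gap by blast
    then have "up i \<or> dn i"
      using off_line[OF f line_Hs[OF e], of i] unfolding meets_def up_def dn_def by blast
    then show False using i0(2)[of i] i1(2)[of i] i \<open>\<not> i1 - i0 - 1 \<le> M\<close> by auto
  qed
  obtain j0 where j0: "\<And>x. x \<in> \<Omega> - e i0 \<Longrightarrow> level f x = j0" using i0 unfolding dn_def by blast
  obtain j1 where j1: "\<And>x. x \<in> e i1 \<Longrightarrow> level f x = j1" using i1 unfolding up_def by blast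
  have inside: "i0 \<le> level e x \<and> level e x < i1" if "x \<in> \<Omega>" "level f x \<noteq> j0" "level f x \<noteq> j1" for x
    using that j0[of x] j1[of x] level_iff[OF e that(1)] by force
  \<comment> \<open>Half-trees of \<open>f\<close> separating the levels \<open>j0\<close> and
    \<open>j1\<close> lie, up to complement, between \<open>e i1\<close> and \<open>e i0\<close>.
    They belong to \<open>e\<close> by convexity, so there are at most \<open>i1 - i0 + 1\<close> of
    them; this is the origin of \<open>M + 2\<close>.\<close>
  have count: "int (card A) \<le> M + 2"
    if inj: "inj_on \<phi> A" and A: "\<And>j. j \<in> A \<Longrightarrow> \<phi> j \<in> Hs \<and> e i1 \<subseteq> \<phi> j \<and> \<phi> j \<subseteq> e i0" for A :: "int set" and \<phi>
  proof -
    have "\<phi> ` A \<subseteq> e ` {i0..i1}"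
    proof
      fix K assume "K \<in> \<phi> ` A"
      then have K: "K \<in> Hs" "e i1 \<subseteq> K" "K \<subseteq> e i0" using A by auto
      then obtain k where "K = e k" using line_convex[OF e] by blast
      then show "K \<in> e ` {i0..i1}" using K line_le_iff[OF e] by auto
    qed
    then have "card (\<phi> ` A) \<le> card (e ` {i0..i1})" by (intro card_mono) auto
    also have "\<dots> \<le> nat (i1 - i0 + 1)" using card_image_le[of "{i0..i1}" e] by simp
    finally have "card A \<le> nat (i1 - i0 + 1)" using card_image[OF inj] by simp
    then show ?thesis using \<open>i1 - i0 - 1 \<le> M\<close> lt by linarith
  qed
  have "j1 - j0 \<le> M + 2"
  proof -
    have "int (card {j0 + 1..j1}) \<le> M + 2"
    proof (rule count)
      show "inj_on f {j0 + 1..j1}" using line_inj[OF f] by (rule inj_on_subset) simp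
      fix j assume j: "j \<in> {j0 + 1..j1}"
      have "e i1 \<subseteq> f j" using j j1 level_iff[OF f] sub by fastforce
      moreover have "f j \<subseteq> e i0"
      proof
        fix x assume x: "x \<in> f j"
        then have "x \<in> \<Omega>" using sub(2)[of j] by blast
        then have "x \<in> \<Omega>" "level f x \<noteq> j0" using x level_iff[OF f, of x j] j by auto
        then show "x \<in> e i0" using j0 by blast
      qed
      ultimately show "f j \<in> Hs \<and> e i1 \<subseteq> f j \<and> f j \<subseteq> e i0" using line_Hs[OF f] by blast
    qed
    moreover have "M + 2 \<ge> 0" using \<open>i1 - i0 - 1 \<le> M\<close> lt by linarith
    ultimately show ?thesis by (simp split: if_splits)
  qed
  moreover have "j0 - j1 \<le> M + 2"
  proof -
    have "int (card {j1 + 1..j0}) \<le> M + 2"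
    proof (rule count)
      show "inj_on (\<lambda>j. \<Omega> - f j) {j1 + 1..j0}"
        using sub line_eq_iff[OF f] by (intro inj_onI) (metis double_diff order_refl)
      fix j assume j: "j \<in> {j1 + 1..j0}"
      have "e i1 \<subseteq> \<Omega> - f j" using j j1 level_iff[OF f] sub by fastforce
      moreover have "\<Omega> - f j \<subseteq> e i0"
      proof
        fix x assume x: "x \<in> \<Omega> - f j"
        then have "x \<in> \<Omega>" "level f x \<noteq> j0" using level_iff[OF f, of x j] j by auto
        then show "x \<in> e i0" using j0 by blast
      qed
      ultimately show "\<Omega> - f j \<in> Hs \<and> e i1 \<subseteq> \<Omega> - f j \<and> \<Omega> - f j \<subseteq> e i0"
        using line_Hs[OF f] Hs_compl by blast
    qed
    moreover have "M + 2 \<ge> 0" using \<open>i1 - i0 - 1 \<le> M\<close> lt by linarith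
    ultimately show ?thesis by (simp split: if_splits)
  qed
  ultimately have "\<bar>level e x - i0\<bar> \<le> M + 2" if "x \<in> \<Omega>" "\<bar>level f x - j0\<bar> > M + 2" for x
    using inside[OF that(1)] that(2) \<open>i1 - i0 - 1 \<le> M\<close> lt by linarith
  then show ?thesis by (rule that)
qed

text \<open>With both orientations present, two half-trees of \<open>f\<close> would be comparable
  both as they are and after complementing one of them, so one would be empty or everything.\<close>

lemma meets_coherent:
  assumes e: "line e" and f: "line f" and "e i \<in> range f" "\<Omega> - e k \<in> range f"
  shows False
proof -
  have sub: "e i \<subseteq> \<Omega>" "f i \<subseteq> \<Omega>" "f i \<noteq> {}" "f i \<noteq> \<Omega>" for i using line_Hs e f Hs_sub Hs_ne by blast+
  obtain j l where *: "e i = f j" "\<Omega> - e k = f l" using assms by auto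
  then have k: "e k = \<Omega> - f l" using sub by blast
  have "f j \<subseteq> f l \<or> f l \<subseteq> f j" using line_le_iff[OF f] by (meson linear)
  moreover have "f j \<subseteq> \<Omega> - f l \<or> \<Omega> - f l \<subseteq> f j"
    using line_le_iff[OF e, of i k] line_le_iff[OF e, of k i] * k by (metis linear)
  ultimately show False using sub[of j] sub[of l] by blast
qed

lemma line_step:
  assumes e: "line e" and f: "line f" and "e i = f k" "e (i + 1) \<in> range f"
  shows "e (i + 1) = f (k + 1)"
proof -
  obtain l where l: "e (i + 1) = f l" using assms by auto
  then have "k < l" using line_less[OF e, of i "i + 1"] line_le_iff[OF f, of k l] assms by fastforce
  then have "f l \<subseteq> f (k + 1)" "f (k + 1) \<subseteq> f k" using line_le_iff[OF f] by auto
  then obtain m where m: "f (k + 1) = e m" using line_convex[OF e line_Hs[OF f]] assms l by (metis imageE)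
  then have "m \<le> i + 1" "i \<le> m"
    using \<open>f l \<subseteq> f (k + 1)\<close> \<open>f (k + 1) \<subseteq> f k\<close> l assms(3) line_le_iff[OF e] by metis+
  moreover have "m \<noteq> i" using m assms(3) line_eq_iff[OF f, of k "k + 1"] by auto
  ultimately have "m = i + 1" by linarith
  then show ?thesis using m by simp
qed

lemma window_match:
  assumes e: "line e" and f: "line f" and w: "\<And>i. a \<le> i \<Longrightarrow> i \<le> b \<Longrightarrow> e i \<in> range f" and "a \<le> b"
  obtains c where "\<And>i. a \<le> i \<Longrightarrow> i \<le> b \<Longrightarrow> e i = f (i + c)"
proof -
  obtain k where k: "e a = f k" using w[of a] assms by auto
  have "i \<le> b \<Longrightarrow> e i = f (i + (k - a))" if "a \<le> i" for i
    using that
  proof (induction i rule: int_ge_induct)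
    case (step i)
    then show ?case using line_step[OF e f, of i "i + (k - a)"] w[of "i + 1"] by (simp add: algebra_simps)
  qed (use k in simp)
  then show ?thesis using that by blast
qed

lemma line_match:
  assumes e: "line e" and f: "line f" and w: "\<And>i. e i \<in> range f"
  obtains c where "\<And>i. e i = f (i + c)"
proof -
  obtain k where k: "e 0 = f k" using w[of 0] by auto
  have "e i = f (i + k)" for i
  proof -
    obtain c where c: "\<And>j. min i 0 \<le> j \<Longrightarrow> j \<le> max i 0 \<Longrightarrow> e j = f (j + c)"
    proof (rule window_match[OF e f w])
      show "min i 0 \<le> max i 0" by simp
    qed blast
    have "c = k" using c[of 0] k line_eq_iff[OF f] by simp
    then show ?thesis using c[of i] by simp
  qed
  then show ?thesis using that by blast
qed

text \<open>Finite intervals provide immediate neighbours, and an element missed by iterating these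
  from \<open>Y\<close> would bound an infinite interval.\<close>

lemma enumerate_chain:
  fixes C :: "'x set set"
  assumes Y: "Y \<in> C" and chain: "\<And>K L. K \<in> C \<Longrightarrow> L \<in> C \<Longrightarrow> K \<subseteq> L \<or> L \<subseteq> K"
    and lower: "\<And>K. K \<in> C \<Longrightarrow> \<exists>L\<in>C. L \<subset> K" and upper: "\<And>K. K \<in> C \<Longrightarrow> \<exists>L\<in>C. K \<subset> L"
    and fin: "\<And>K L. K \<in> C \<Longrightarrow> L \<in> C \<Longrightarrow> finite {M \<in> C. K \<subseteq> M \<and> M \<subseteq> L}"
  obtains e :: "int \<Rightarrow> 'x set" where "range e = C" "\<And>i. e (i + 1) \<subset> e i" "e 0 = Y"
proof -
  have "\<exists>L\<in>C. L \<subset> K \<and> (\<forall>M\<in>C. M \<subset> K \<longrightarrow> M \<subseteq> L)" if K: "K \<in> C" for K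
  proof -
    obtain L0 where L0: "L0 \<in> C" "L0 \<subset> K" using lower[OF K] by blast
    let ?A = "{M \<in> C. L0 \<subseteq> M \<and> M \<subset> K}"
    have "finite ?A" by (rule finite_subset[OF _ fin[OF L0(1) K]]) auto
    then obtain L where L: "L \<in> ?A" "\<forall>M\<in>?A. L \<subseteq> M \<longrightarrow> L = M"
      using finite_has_maximal[of ?A] L0 by blast
    have "M \<subseteq> L" if M: "M \<in> C" "M \<subset> K" for M
    proof (rule ccontr)
      assume "\<not> M \<subseteq> L"
      then have "L \<subset> M" using chain[of M L] M L(1) by blast
      moreover have "M \<in> ?A" using M \<open>L \<subset> M\<close> L(1) by blast
      ultimately show False using L(2) by blast
    qed
    then show ?thesis using L(1) by blast
  qed
  then obtain S where S: "\<And>K. K \<in> C \<Longrightarrow> S K \<in> C \<and> S K \<subset> K \<and> (\<forall>M\<in>C. M \<subset> K \<longrightarrow> M \<subseteq> S K)"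
    by metis
  have "\<exists>L\<in>C. K \<subset> L \<and> (\<forall>M\<in>C. K \<subset> M \<longrightarrow> L \<subseteq> M)" if K: "K \<in> C" for K
  proof -
    obtain L0 where L0: "L0 \<in> C" "K \<subset> L0" using upper[OF K] by blast
    let ?A = "{M \<in> C. K \<subset> M \<and> M \<subseteq> L0}"
    have "finite ?A" by (rule finite_subset[OF _ fin[OF K L0(1)]]) auto
    then obtain L where L: "L \<in> ?A" "\<forall>M\<in>?A. M \<subseteq> L \<longrightarrow> L = M"
      using finite_has_minimal[of ?A] L0 by blast
    have "L \<subseteq> M" if M: "M \<in> C" "K \<subset> M" for M
    proof (rule ccontr)
      assume "\<not> L \<subseteq> M"
      then have "M \<subset> L" using chain[of M L] M L(1) by blast
      moreover have "M \<in> ?A" using M \<open>M \<subset> L\<close> L(1) by blast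
      ultimately show False using L(2) by blast
    qed
    then show ?thesis using L(1) by blast
  qed
  then obtain P where P: "\<And>K. K \<in> C \<Longrightarrow> P K \<in> C \<and> K \<subset> P K \<and> (\<forall>M\<in>C. K \<subset> M \<longrightarrow> P K \<subseteq> M)"
    by metis
  define e where "e i = (if i \<ge> 0 then (S ^^ nat i) Y else (P ^^ nat (- i)) Y)" for i :: int
  have SC: "(S ^^ n) Y \<in> C" and PC: "(P ^^ n) Y \<in> C" for n
    using Y S P by (induction n) auto
  have eC: "e i \<in> C" for i using SC PC by (simp add: e_def)
  have e_rec: "(i \<ge> 0 \<longrightarrow> e (i + 1) = S (e i)) \<and> (i < 0 \<longrightarrow> e i = P (e (i + 1)))" for i
  proof (cases "i \<ge> 0")
    case True
    then have "nat (i + 1) = Suc (nat i)" by simp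
    then show ?thesis using True by (simp add: e_def)
  next
    case False
    then have "nat (- i) = Suc (nat (- (i + 1)))" by simp
    then show ?thesis using False by (auto simp: e_def)
  qed
  have dec: "e (i + 1) \<subset> e i" for i 
  proof (cases "i \<ge> 0")
    case True
    then show ?thesis using e_rec[of i] S[OF eC[of i]] by metis
  next
    case False
    then show ?thesis using e_rec[of i] P[OF eC[of "i + 1"]] by (metis not_le)
  qed
  have gap: "M \<subseteq> e (i + 1)" if M: "M \<in> C" "M \<subset> e i" for M i
  proof (cases "i \<ge> 0")
    case True
    then show ?thesis using e_rec[of i] S[OF eC, of i] M by auto
  next
    case False
    show ?thesis
    proof (rule ccontr)
      assume "\<not> M \<subseteq> e (i + 1)"
      then have "e (i + 1) \<subset> M" using chain[OF M(1) eC[of "i + 1"]] by blast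
      then have "e i \<subseteq> M" using P[OF eC, of "i + 1"] e_rec[of i] False M by auto
      then show False using M by blast
    qed
  qed
  have inj: "inj e"
  proof -
    have "e (i + int n + 1) \<subset> e i" for i n
    proof (induction n)
      case (Suc n)
      then show ?case using dec[of "i + int n + 1"] by (simp add: add.commute add.left_commute psubset_trans)
    qed (use dec in simp)
    note * = this
    have "e i \<noteq> e j" if "i < j" for i j
    proof -
      have "i + int (nat (j - i - 1)) + 1 = j" using that by simp
      with *[of i "nat (j - i - 1)"] show ?thesis by auto
    qed
    then show ?thesis by (intro injI) (metis linorder_neqE)
  qed
  have "K \<in> range e" if K: "K \<in> C" for K
  proof (rule ccontr)
    assume no: "K \<notin> range e"
    have inj': "inj (\<lambda>n. e (int n))" "inj (\<lambda>n. e (- int n))"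
      using inj unfolding inj_def by (metis of_nat_eq_iff, metis neg_equal_iff_equal of_nat_eq_iff)
    consider "K \<subseteq> Y" | "Y \<subseteq> K" using chain[OF K Y] by blast
    then show False
    proof cases
      case 1
      have "K \<subseteq> e (int n) \<and> e (int n) \<subseteq> Y" for n
      proof (induction n)
        case 0
        show ?case using 1 by (simp add: e_def)
      next
        case (Suc n)
        have "K \<subset> e (int n)" using Suc no by blast
        then have "K \<subseteq> e (int n + 1)" using gap[OF K] by blast
        moreover have "e (int n + 1) \<subseteq> Y" using dec[of "int n"] Suc by blast
        moreover have "int (Suc n) = int n + 1" by simp
        ultimately show ?case by metis
      qed
      then have "range (\<lambda>n. e (int n)) \<subseteq> {M \<in> C. K \<subseteq> M \<and> M \<subseteq> Y}" using eC by auto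
      then have "finite (range (\<lambda>n. e (int n)))" using fin[OF K Y] by (rule finite_subset)
      then show False using inj'(1) by (simp add: finite_image_iff)
    next
      case 2
      have "e (- int n) \<subseteq> K \<and> Y \<subseteq> e (- int n)" for n
      proof (induction n)
        case 0
        show ?case using 2 by (simp add: e_def)
      next
        case (Suc n)
        have eq: "- int (Suc n) + 1 = - int n" by simp
        have "\<not> K \<subset> e (- int (Suc n))"
          using gap[OF K, of "- int (Suc n)"] Suc no unfolding eq by blast
        then have "e (- int (Suc n)) \<subseteq> K" using chain[OF K eC] no by blast
        then show ?case using dec[of "- int (Suc n)"] Suc unfolding eq by blast
      qed
      then have "range (\<lambda>n. e (- int n)) \<subseteq> {M \<in> C. Y \<subseteq> M \<and> M \<subseteq> K}" using eC by auto
      then have "finite (range (\<lambda>n. e (- int n)))" using fin[OF Y K] by (rule finite_subset)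
      then show False using inj'(2) by (simp add: finite_image_iff)
    qed
  qed
  then have "range e = C" using eC by blast
  moreover have "e 0 = Y" by (simp add: e_def)
  ultimately show ?thesis using that dec by blast
qed

end

section \<open>Groups acting on nested families\<close>

text \<open>\<open>G_krylov\<close> is the only trace of the linear representation and replaces
  acylindricity: elements fixing \<open>n\<close> consecutive translates of a half-tree may be
  numerous, but they fix all its forward translates.\<close>

locale tree_action = tree_family \<Omega> Hs for \<Omega> :: "'x set" and Hs +
  fixes G :: "('x \<Rightarrow> 'x) set" and n :: nat
  assumes G_bij: "g \<in> G \<Longrightarrow> bij g"
    and G_comp: "g \<in> G \<Longrightarrow> h \<in> G \<Longrightarrow> g \<circ> h \<in> G"
    and G_inv: "g \<in> G \<Longrightarrow> finv g \<in> G"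
    and G_space: "g \<in> G \<Longrightarrow> g ` \<Omega> = \<Omega>"
    and G_Hs: "g \<in> G \<Longrightarrow> K \<in> Hs \<Longrightarrow> g ` K \<in> Hs"
    and G_krylov: "f \<in> G \<Longrightarrow> h \<in> G \<Longrightarrow> K \<in> Hs \<Longrightarrow>
      (\<And>i. i < n \<Longrightarrow> f ` (h ^^ i) ` K = (h ^^ i) ` K) \<Longrightarrow> f ` (h ^^ i) ` K = (h ^^ i) ` K"
begin

lemma G_inv_apply: "g \<in> G \<Longrightarrow> finv g (g x) = x" "g \<in> G \<Longrightarrow> g (finv g x) = x"
  using G_bij by (auto simp: bij_is_inj surj_f_inv_f bij_is_surj)

lemma G_inv_image: "g \<in> G \<Longrightarrow> finv g ` g ` K = K" "g \<in> G \<Longrightarrow> g ` finv g ` K = K"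
  by (auto simp: image_comp o_def G_inv_apply)

lemma G_image_iff: "g \<in> G \<Longrightarrow> g ` K \<subseteq> g ` L \<longleftrightarrow> K \<subseteq> L" "g \<in> G \<Longrightarrow> g ` K = g ` L \<longleftrightarrow> K = L"
  using G_bij by (simp_all add: bij_is_inj inj_image_subset_iff inj_image_eq_iff)

lemma G_compl: "g \<in> G \<Longrightarrow> g ` (\<Omega> - K) = \<Omega> - g ` K"
  using G_bij G_space by (metis bij_is_inj image_set_diff)

lemma G_point: "g \<in> G \<Longrightarrow> x \<in> \<Omega> \<Longrightarrow> g x \<in> \<Omega>"
  using G_space by blast

lemma line_image:
  assumes e: "line e" and g: "g \<in> G" shows "line (\<lambda>i. g ` e i)"
proof -
  have "g ` e (i + 1) \<subset> g ` e i" for i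
    using line_less[OF e, of i "i + 1"] G_image_iff[OF g] by (simp add: psubset_eq)
  moreover have "K \<in> range (\<lambda>i. g ` e i)" if K: "K \<in> Hs" "g ` e j \<subseteq> K" "K \<subseteq> g ` e i" for K i j
  proof -
    have "e j \<subseteq> finv g ` K" "finv g ` K \<subseteq> e i"
      using K(2,3) G_inv_image(2)[OF g, of K] G_image_iff(1)[OF g] by metis+
    then obtain l where "finv g ` K = e l" using line_convex[OF e G_Hs[OF G_inv[OF g] K(1)]] by blast
    then have "K = g ` e l" using G_inv_image(2)[OF g] by metis
    then show ?thesis by blast
  qed
  ultimately show ?thesis unfolding line_def using G_Hs[OF g] line_Hs[OF e] by blast
qed

lemma level_image:
  assumes e: "line e" and g: "g \<in> G" and x: "x \<in> \<Omega>"
  shows "level (\<lambda>i. g ` e i) (g x) = level e x"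
proof (rule level_eqI[OF line_image[OF e g] G_point[OF g x]])
  show "g x \<in> g ` e i \<longleftrightarrow> i \<le> level e x" for i
    using G_bij[OF g] level_iff[OF e x] by (simp add: bij_is_inj inj_image_mem_iff)
qed

section \<open>Axes, their overlaps and their translates\<close>

definition axis :: "('x \<Rightarrow> 'x) \<Rightarrow> int \<Rightarrow> (int \<Rightarrow> 'x set) \<Rightarrow> bool" where
  "axis h t e \<longleftrightarrow> line e \<and> h \<in> G \<and> (\<forall>i. h ` e i = e (i + t))"

lemma axis_inv: "axis h t e \<Longrightarrow> axis (finv h) (- t) e"
  unfolding axis_def by (metis G_inv G_inv_image(1) diff_add_cancel uminus_add_conv_diff add.commute)

lemma axis_conj:
  assumes "axis h t e" "g \<in> G" shows "axis (g \<circ> h \<circ> finv g) t (\<lambda>i. g ` e i)"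
proof -
  have "(g \<circ> h \<circ> finv g) ` g ` e i = g ` e (i + t)" for i
    using assms G_inv_image(1)[OF assms(2), of "e i"] unfolding axis_def by (metis image_comp)
  then show ?thesis using assms line_image G_comp G_inv by (simp add: axis_def)
qed

lemma axis_rev: "axis h t e \<Longrightarrow> axis (finv h) t (\<lambda>i. \<Omega> - e (- i))"
proof -
  assume a: "axis h t e"
  then have "axis (finv h) (- t) e" by (rule axis_inv)
  then show ?thesis using line_rev by (auto simp: axis_def G_compl)
qed

text \<open>Where the axes agree, \<open>finv h \<circ> h'\<close> fixes half-trees. It then fixes
  all forward translates of the first one, so \<open>h\<close> and \<open>h'\<close> keep moving
  along the axis together.\<close>

lemma axis_overlap_aux:
  assumes e: "axis h t e" and f: "axis h' t f"
    and w: "\<And>s. s \<le> n \<Longrightarrow> e (a + int s * t) = f (b + int s * t)"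
  shows "e (a + int s * t) = f (b + int s * t)"
proof -
  have h: "h \<in> G" "h' \<in> G" and sh: "\<And>i. h ` e i = e (i + t)" "\<And>i. h' ` f i = f (i + t)"
    using e f by (auto simp: axis_def)
  have pw: "(h ^^ s) ` e a = e (a + int s * t)" for s
  proof (induction s)
    case (Suc s)
    have "(h ^^ Suc s) ` e a = h ` (h ^^ s) ` e a" by (simp add: image_comp)
    then show ?case using Suc sh by (simp add: algebra_simps)
  qed simp
  let ?f = "finv h \<circ> h'"
  have fG: "?f \<in> G" using h G_comp G_inv by blast
  have "?f ` (h ^^ s) ` e a = (h ^^ s) ` e a" if "s < n" for s
  proof -
    \<comment> \<open>Both \<open>s\<close> and \<open>Suc s\<close> must lie in the window, so
      agreement for \<open>s \<le> n\<close> gives fixed half-trees for \<open>s < n\<close>, as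
      many as \<open>G_krylov\<close> wants.\<close>
    have "h' ` e (a + int s * t) = e (a + int (Suc s) * t)"
      using w[of s] w[of "Suc s"] sh(2)[of "b + int s * t"] that by (simp add: algebra_simps)
    also have "\<dots> = h ` e (a + int s * t)" using sh(1) by (simp add: algebra_simps)
    finally have "finv h ` h' ` e (a + int s * t) = e (a + int s * t)" by (simp add: G_inv_image h)
    then show ?thesis unfolding pw by (metis image_comp)
  qed
  then have "?f ` (h ^^ s) ` e a = (h ^^ s) ` e a" for s
    using G_krylov[OF fG h(1) line_Hs] e unfolding axis_def by blast
  then have sync: "h' ` e (a + int s * t) = h ` e (a + int s * t)" for s
    using G_inv_image(2)[OF h(1)] unfolding pw by (metis image_comp)
  show ?thesis
  proof (induction s)
    case 0
    show ?case using w[of 0] by simp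
  next
    case (Suc s)
    have "e (a + int (Suc s) * t) = h ` e (a + int s * t)" using sh(1) by (simp add: algebra_simps)
    also have "\<dots> = h' ` f (b + int s * t)" using sync[of s] Suc by metis
    also have "\<dots> = f (b + int (Suc s) * t)" using sh(2) by (simp add: algebra_simps)
    finally show ?case .
  qed
qed

text \<open>Agreement spreads forward from the left end of the window and, through the inverses,
  backward from its right end. This only reaches steps of length \<open>t\<close>; convexity fills
  in the rest.\<close>

lemma axis_overlap:
  assumes e: "axis h t e" and f: "axis h' t f" and t: "t > 0"
    and w: "\<And>i. a \<le> i \<Longrightarrow> i \<le> a + int n * t \<Longrightarrow> e i \<in> range f"
  shows "e i \<in> range f"
proof -
  have le: "line e" "line f" using e f by (auto simp: axis_def)
  obtain c where c: "\<And>i. a \<le> i \<Longrightarrow> i \<le> a + int n * t \<Longrightarrow> e i = f (i + c)"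
    using window_match[OF le w] t by (metis add_increasing2 le_cases mult_nonneg_nonneg of_nat_0_le_iff order_less_imp_le order_refl)
  have st: "0 \<le> int s * t" "s \<le> n \<Longrightarrow> int s * t \<le> int n * t" for s using t by (auto intro: mult_right_mono)
  have up: "e (a + int s * t) = f (a + c + int s * t)" for s
    by (rule axis_overlap_aux[OF e f]) (use c st in \<open>simp add: algebra_simps\<close>)
  have "e (a + int n * t + int s * (- t)) = f (a + int n * t + c + int s * (- t))" for s
  proof (rule axis_overlap_aux[OF axis_inv[OF e] axis_inv[OF f]])
    fix s assume "s \<le> n"
    then show "e (a + int n * t + int s * - t) = f (a + int n * t + c + int s * - t)"
      using c[of "a + int n * t - int s * t"] st[of s] by (simp add: algebra_simps)
  qed
  then have dn: "e (a + int n * t - int s * t) \<in> range f" for s by simp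
  define s where "s = nat (\<bar>i\<bar> + \<bar>a\<bar> + \<bar>int n * t\<bar>)"
  have "int s \<le> int s * t" using t by (simp add: mult_le_cancel_left1)
  then have "i \<le> a + int s * t" "a + int n * t - int s * t \<le> i" by (auto simp: s_def)
  then have "e (a + int s * t) \<subseteq> e i" "e i \<subseteq> e (a + int n * t - int s * t)"
    using line_le_iff[OF le(1)] by auto
  moreover obtain j where "e (a + int n * t - int s * t) = f j" using dn by blast
  ultimately show ?thesis using line_convex[OF le(2) line_Hs[OF le(1)]] up[of s] by metis
qed

definition same_axis :: "(int \<Rightarrow> 'x set) \<Rightarrow> (int \<Rightarrow> 'x set) \<Rightarrow> bool" where
  "same_axis e f \<longleftrightarrow> (\<forall>i. e i \<in> range f) \<or> (\<forall>i. \<Omega> - e i \<in> range f)"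

text \<open>The translate is the axis of a conjugate of \<open>h\<close> with the same
  \<open>t\<close>, so a full window of overlap would force the lines to coincide up to orientation,
  and \<open>line_bands\<close> applies. The level of \<open>g x\<close> on the translate is the
  level of \<open>x\<close> on \<open>e\<close>, so \<open>q'\<close> restricts \<open>x\<close>
  itself.\<close>

lemma axis_dichotomy:
  assumes e: "axis h t e" and t: "t > 0" and g: "g \<in> G" and ns: "\<not> same_axis e (\<lambda>i. g ` e i)"
  obtains q q' where
    "\<And>x. x \<in> \<Omega> \<Longrightarrow> \<bar>level e x - q'\<bar> > int n * t + 2 \<Longrightarrow> \<bar>level e (g x) - q\<bar> \<le> int n * t + 2"
proof -
  define f where "f i = g ` e i" for i
  have f: "axis (g \<circ> h \<circ> finv g) t f" using axis_conj[OF e g] by (simp add: f_def[abs_def])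
  have le: "line e" "line f" using e f by (auto simp: axis_def)
  have "\<exists>i\<in>{a..a + int n * t}. \<not> meets e f i" for a
  proof (rule ccontr)
    assume "\<not> ?thesis"
    then have m: "a \<le> i \<Longrightarrow> i \<le> a + int n * t \<Longrightarrow> e i \<in> range f \<or> \<Omega> - e i \<in> range f" for i
      by (auto simp: meets_def)
    have rr: "\<Omega> - (\<Omega> - e i) = e i" for i using Hs_sub[OF line_Hs[OF le(1), of i]] by blast
    have "a \<le> a + int n * t" using t by simp
    with m[of a] consider "e a \<in> range f" | "\<Omega> - e a \<in> range f" by auto
    then have "(\<forall>i. e i \<in> range f) \<or> (\<forall>i. \<Omega> - e i \<in> range f)"
    proof cases
      case 1
      then have "a \<le> i \<Longrightarrow> i \<le> a + int n * t \<Longrightarrow> e i \<in> range f" for i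
        using m[of i] meets_coherent[OF le] by blast
      then show ?thesis using axis_overlap[OF e f t] by blast
    next
      case 2
      have rf: "\<Omega> - (\<Omega> - f i) = f i" for i using Hs_sub[OF line_Hs[OF le(2), of i]] by blast
      have win: "e i \<in> range (\<lambda>i. \<Omega> - f (- i))" if ai: "a \<le> i" "i \<le> a + int n * t" for i
      proof -
        obtain j where "\<Omega> - e i = f (- (- j))" using m[OF ai] meets_coherent[OF le, of i a] 2 by auto
        then have "e i = \<Omega> - f (- (- j))" using rr[of i] by simp
        then show ?thesis by (rule range_eqI)
      qed
      have "\<Omega> - e i \<in> range f" for i
      proof -
        have "e i \<in> range (\<lambda>i. \<Omega> - f (- i))" using axis_overlap[OF e axis_rev[OF f] t win] by blast
        then obtain j where "e i = \<Omega> - f (- j)" by blast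
        then have "\<Omega> - e i = f (- j)" using rf by simp
        then show ?thesis by (rule range_eqI)
      qed
      then show ?thesis by blast
    qed
    then show False using ns by (simp add: same_axis_def f_def[abs_def])
  qed
  then obtain q q' where q: "\<And>x. x \<in> \<Omega> \<Longrightarrow> \<bar>level f x - q'\<bar> > int n * t + 2 \<Longrightarrow> \<bar>level e x - q\<bar> \<le> int n * t + 2"
    using line_bands[OF le] by blast
  show ?thesis
  proof (rule that)
    fix x assume x: "x \<in> \<Omega>" "\<bar>level e x - q'\<bar> > int n * t + 2"
    then show "\<bar>level e (g x) - q\<bar> \<le> int n * t + 2"
      using q[of "g x"] level_image[OF le(1) g x(1)] G_point[OF g] by (simp add: f_def[abs_def])
  qed
qed

text \<open>The axis consists of all half-trees between a forward and a backward translate of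
  \<open>Y\<close>. There may be many besides the translates, which is why \<open>t\<close> can be
  large.\<close>

lemma axis_exists:
  assumes h: "h \<in> G" and Y: "Y \<in> Hs" "h ` Y \<subset> Y"
  obtains e t where "axis h t e" "t > 0" "e 0 = Y"
proof -
  define up where "up m = (h ^^ m) ` Y" for m
  define dn where "dn m = (finv h ^^ m) ` Y" for m
  have up_Suc: "up (Suc m) = h ` up m" and dn_Suc: "dn (Suc m) = finv h ` dn m" for m
    by (simp_all add: up_def dn_def image_comp)
  have h_dn: "h ` dn (Suc m) = dn m" and hi_up: "finv h ` up (Suc m) = up m" for m
    using G_inv_image[OF h] by (simp_all add: dn_Suc up_Suc)
  have upH: "up m \<in> Hs" and dnH: "dn m \<in> Hs" for m
  proof -
    show "up m \<in> Hs" by (induction m) (use Y up_Suc G_Hs[OF h] in \<open>auto simp: up_def\<close>)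
    show "dn m \<in> Hs" by (induction m) (use Y dn_Suc G_Hs[OF G_inv[OF h]] in \<open>auto simp: dn_def\<close>)
  qed
  have psub: "g \<in> G \<Longrightarrow> K \<subset> L \<Longrightarrow> g ` K \<subset> g ` L" for g K L
    using G_image_iff by (simp add: psubset_eq)
  have up_dec: "up (Suc m) \<subset> up m" for m
  proof (induction m)
    case (Suc m)
    then show ?case using psub[OF h Suc] up_Suc by metis
  qed (use Y in \<open>simp add: up_def\<close>)
  have dn_inc: "dn m \<subset> dn (Suc m)" for m
  proof (induction m)
    case 0
    have "finv h ` h ` Y \<subset> finv h ` Y" using psub[OF G_inv[OF h] Y(2)] .
    then show ?case using G_inv_image[OF h] by (simp add: dn_def)
  next
    case (Suc m)
    then show ?case using psub[OF G_inv[OF h] Suc] dn_Suc by metis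
  qed
  have up_mono: "m \<le> k \<Longrightarrow> up k \<subseteq> up m" for m k
    by (rule lift_Suc_antimono_le[of up]) (use up_dec in auto)
  have dn_mono: "m \<le> k \<Longrightarrow> dn m \<subseteq> dn k" for m k
    by (rule lift_Suc_mono_le[of dn]) (use dn_inc in auto)
  have ud: "up m \<subseteq> Y" "Y \<subseteq> dn m" for m
    using up_mono[of 0 m] dn_mono[of 0 m] by (auto simp: up_def dn_def)
  define C where "C = {K \<in> Hs. \<exists>m. up m \<subseteq> K \<and> K \<subseteq> dn m}"
  have common: "\<exists>m. up m \<subseteq> K \<and> up m \<subseteq> L \<and> K \<subseteq> dn m \<and> L \<subseteq> dn m" if KL: "K \<in> C" "L \<in> C" for K L
  proof -
    obtain a b where "up a \<subseteq> K" "K \<subseteq> dn a" "up b \<subseteq> L" "L \<subseteq> dn b" using KL by (auto simp: C_def)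
    then show ?thesis
      using up_mono[of a "max a b"] up_mono[of b "max a b"] dn_mono[of a "max a b"] dn_mono[of b "max a b"]
      by (intro exI[of _ "max a b"]) auto
  qed
  have convex: "K \<in> C" if KL: "K1 \<in> C" "K2 \<in> C" "K \<in> Hs" "K1 \<subseteq> K" "K \<subseteq> K2" for K K1 K2
    using common[OF KL(1,2)] KL(3-) unfolding C_def by blast
  have YC: "Y \<in> C" using Y ud by (auto simp: C_def)
  have upC: "up m \<in> C" and dnC: "dn m \<in> C" for m
    using upH dnH ud unfolding C_def by blast+
  have hC: "h ` K \<in> C" "finv h ` K \<in> C" if K: "K \<in> C" for K
  proof -
    obtain m where m: "up m \<subseteq> K" "K \<subseteq> dn m" using K by (auto simp: C_def)
    have "up (Suc m) \<subseteq> h ` K" "h ` K \<subseteq> dn (Suc m)"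
      using image_mono[OF m(1), of h] up_Suc image_mono[OF m(2), of h] image_mono[OF less_imp_le[OF dn_inc[of m]], of h] h_dn[of m] dn_inc[of m]
      by auto
    then show "h ` K \<in> C" using G_Hs[OF h] K by (auto simp: C_def)
    have "up (Suc m) \<subseteq> finv h ` K" "finv h ` K \<subseteq> dn (Suc m)"
      using image_mono[OF m(1), of "finv h"] dn_Suc image_mono[OF m(2), of "finv h"] 
        image_mono[OF less_imp_le[OF up_dec[of m]], of "finv h"] hi_up[of m] up_dec[of m]
      by auto
    then show "finv h ` K \<in> C" using G_Hs[OF G_inv[OF h]] K by (auto simp: C_def)
  qed
  obtain e :: "int \<Rightarrow> 'x set" where e: "range e = C" "\<And>i. e (i + 1) \<subset> e i" "e 0 = Y"
  proof (rule enumerate_chain[of Y C])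
    show "Y \<in> C" by (rule YC)
    fix K assume K: "K \<in> C"
    then obtain m where m: "up m \<subseteq> K" "K \<subseteq> dn m" by (auto simp: C_def)
    show "\<exists>L\<in>C. L \<subset> K" using upC[of "Suc m"] up_dec[of m] m by blast
    show "\<exists>L\<in>C. K \<subset> L" using dnC[of "Suc m"] dn_inc[of m] m by blast
    fix L assume L: "L \<in> C"
    obtain r where r: "up r \<subseteq> K" "up r \<subseteq> L" "K \<subseteq> dn r" "L \<subseteq> dn r" using common[OF K L] by blast
    show "K \<subseteq> L \<or> L \<subseteq> K"
      using nested[of K L] K L r Hs_ne(1)[OF upH, of r] Hs_ne(2)[OF dnH, of r] Hs_sub[OF dnH, of r]
      unfolding C_def by blast
    obtain x where x: "x \<in> K" using K Hs_ne unfolding C_def by blast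
    obtain y where y: "y \<in> \<Omega>" "y \<notin> L" using L Hs_ne Hs_sub unfolding C_def by blast
    have "{M \<in> C. K \<subseteq> M \<and> M \<subseteq> L} \<subseteq> {M \<in> Hs. x \<in> M \<and> y \<notin> M}" using x y by (auto simp: C_def)
    moreover have "x \<in> \<Omega>" using x K Hs_sub by (auto simp: C_def)
    ultimately show "finite {M \<in> C. K \<subseteq> M \<and> M \<subseteq> L}" using fin_sep y finite_subset by blast
  qed blast
  have le: "line e" unfolding line_def
  proof (intro conjI allI ballI impI)
    show "range e \<subseteq> Hs" using e(1) by (auto simp: C_def)
    fix K i j assume "K \<in> Hs" "e j \<subseteq> K" "K \<subseteq> e i"
    then show "K \<in> range e" using convex[of "e j" "e i" K] e(1) by blast
  qed (use e in blast)
  have "h ` e i \<in> range e" for i unfolding e(1) using hC(1)[of "e i"] e(1) by blast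
  then obtain t where t: "\<And>i. h ` e i = e (i + t)"
    by (rule line_match[OF line_image[OF le h] le]) blast
  have "h ` e 0 \<subset> e 0" using Y e(3) by simp
  then have "e t \<subset> e 0" using t[of 0] by simp
  then have "t > 0" using line_le_iff[OF le, of t 0] line_le_iff[OF le, of 0 t] by auto
  then show ?thesis using that le h t e(3) by (auto simp: axis_def)
qed

text \<open>The translate \<open>f\<close> of \<open>e\<close> is another axis of \<open>h\<close>.
  If \<open>e i\<close> were off it, one side of \<open>e i\<close> would have constant level on
  \<open>f\<close>; but \<open>h\<close> or its inverse maps that side into itself and shifts levels
  by \<open>t\<close>.\<close>

lemma commuting_preserves_axis:
  assumes e: "axis h t e" and t: "t > 0" and g: "g \<in> G" "g \<circ> h = h \<circ> g"
  shows "e i \<in> range (\<lambda>i. g ` e i)"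
proof (rule ccontr)
  assume no: "\<not> ?thesis"
  define f where "f i = g ` e i" for i
  have h: "h \<in> G" and le: "line e" and sh: "\<And>i. h ` e i = e (i + t)" using e by (auto simp: axis_def)
  have lf: "line f" using line_image[OF le g(1)] by (simp add: f_def[abs_def])
  have hf: "h ` f i = f (i + t)" for i
    using sh[of i] g(2) by (metis f_def image_comp)
  have lev: "level f (h x) = level f x + t" if "x \<in> \<Omega>" for x
  proof (rule level_eqI[OF lf G_point[OF h that]])
    fix i
    have "h x \<in> f i \<longleftrightarrow> h x \<in> h ` f (i - t)" using hf[of "i - t"] by simp
    also have "\<dots> \<longleftrightarrow> x \<in> f (i - t)" using G_bij[OF h] by (simp add: bij_is_inj inj_image_mem_iff)
    finally show "h x \<in> f i \<longleftrightarrow> i \<le> level f x + t" using level_iff[OF lf that] by auto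
  qed
  have sub: "e j \<subseteq> \<Omega>" for j using line_Hs[OF le] Hs_sub by blast
  have e_next: "h ` e i \<subseteq> e i" using sh[of i] line_le_iff[OF le] t by simp
  show False
  proof (cases "\<Omega> - e i \<in> range f")
    \<comment> \<open>With opposite orientation \<open>h\<close> would shrink \<open>e i\<close> and
      its complement at once.\<close>
    case True
    then obtain j where j: "\<Omega> - e i = f j" by auto
    then have "h ` (\<Omega> - e i) = f (j + t)" using hf by simp
    then have "\<Omega> - e (i + t) = f (j + t)" using G_compl[OF h] sh by simp
    moreover have "f (j + t) \<subset> f j" "e (i + t) \<subset> e i" using line_less[OF lf] line_less[OF le] t by auto
    ultimately show False using j by blast
  next
    case False
    then consider j where "\<forall>x\<in>e i. level f x = j" | j where "\<forall>x\<in>\<Omega> - e i. level f x = j"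
      using off_line[OF lf line_Hs[OF le, of i]] no by (auto simp: f_def[abs_def])
    then show False
    proof cases
      case 1
      obtain x where x: "x \<in> e i" using Hs_ne line_Hs[OF le] by blast
      then have "h x \<in> e i" "x \<in> \<Omega>" using e_next sub by auto
      then show False using 1 x lev[of x] t by auto
    next
      case 2
      obtain x where x: "x \<in> \<Omega> - e i" using Hs_ne line_Hs[OF le] Hs_sub by blast
      have "h (finv h x) \<in> \<Omega> - e i" using x G_inv_apply[OF h] by simp
      then have "finv h x \<in> \<Omega> - e i"
        using e_next G_point[OF G_inv[OF h], of x] x by auto
      then show False using 2 x lev[of "finv h x"] t G_inv_apply[OF h] by auto
    qed
  qed
qed

lemma axis_centralizer_hom:
  assumes e: "axis h t e" and t: "t > 0"
  obtains \<sigma> :: "('x \<Rightarrow> 'x) \<Rightarrow> int" where "\<sigma> h = t"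
    "\<And>g k. g \<in> G \<Longrightarrow> g \<circ> h = h \<circ> g \<Longrightarrow> k \<in> G \<Longrightarrow> k \<circ> h = h \<circ> k \<Longrightarrow> \<sigma> (g \<circ> k) = \<sigma> g + \<sigma> k"
proof -
  have le: "line e" and h: "h \<in> G" "\<And>i. h ` e i = e (i + t)" using e by (auto simp: axis_def)
  have ex: "\<exists>c. \<forall>i. g ` e i = e (i + c)" if g: "g \<in> G" "g \<circ> h = h \<circ> g" for g
  proof -
    obtain c where c: "\<And>i. e i = g ` e (i + c)"
      using line_match[OF le line_image[OF le g(1)] commuting_preserves_axis[OF e t g]] by blast
    have "g ` e i = e (i - c)" for i using c[of "i - c"] by simp
    then show ?thesis by (intro exI[of _ "- c"]) simp
  qed
  define \<sigma> where "\<sigma> g = (THE c. g ` e 0 = e c)" for g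
  have \<sigma>: "\<sigma> g = c" if "\<And>i. g ` e i = e (i + c)" for g c
    unfolding \<sigma>_def using that[of 0] line_eq_iff[OF le] by (intro the_equality) auto
  show ?thesis
  proof (rule that[of \<sigma>])
    show "\<sigma> h = t" using \<sigma> h(2) by blast
    fix g k assume gk: "g \<in> G" "g \<circ> h = h \<circ> g" "k \<in> G" "k \<circ> h = h \<circ> k"
    obtain c d where cd: "\<And>i. g ` e i = e (i + c)" "\<And>i. k ` e i = e (i + d)"
      using ex[OF gk(1,2)] ex[OF gk(3,4)] by blast
    have "(g \<circ> k) ` e i = e (i + (c + d))" for i
      using cd(1)[of "i + d"] cd(2)[of i] by (metis image_comp add.assoc add.commute)
    then show "\<sigma> (g \<circ> k) = \<sigma> g + \<sigma> k" using \<sigma> cd by metis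
  qed
qed

end

section \<open>Ping-pong\<close>

fun word_set :: "('x \<Rightarrow> 'x) set \<Rightarrow> nat \<Rightarrow> ('x \<Rightarrow> 'x) set" where
  "word_set U 0 = {id}"
| "word_set U (Suc n) = {x \<circ> u | x u. x \<in> word_set U n \<and> u \<in> U}"

lemma word_set_Suc_left: "word_set U (Suc n) = {u \<circ> x | x u. x \<in> word_set U n \<and> u \<in> U}"
proof (induction n)
  case (Suc n)
  have "word_set U (Suc (Suc n)) = {x \<circ> u | x u. x \<in> word_set U (Suc n) \<and> u \<in> U}" by simp
  also have "\<dots> = {v \<circ> y \<circ> u | y v u. y \<in> word_set U n \<and> v \<in> U \<and> u \<in> U}" unfolding Suc by blast
  also have "\<dots> = {v \<circ> (y \<circ> u) | y v u. y \<in> word_set U n \<and> v \<in> U \<and> u \<in> U}" by (simp add: o_assoc)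
  also have "\<dots> = {v \<circ> x | x v. x \<in> word_set U (Suc n) \<and> v \<in> U}" by auto
  finally show ?case .
qed auto

lemma word_set_add: "x \<in> word_set U m \<Longrightarrow> y \<in> word_set U n \<Longrightarrow> x \<circ> y \<in> word_set U (m + n)"
proof (induction n arbitrary: y)
  case (Suc n)
  then obtain y' u where y: "y = y' \<circ> u" "y' \<in> word_set U n" "u \<in> U" by auto
  then have "x \<circ> y = (x \<circ> y') \<circ> u" by (simp only: o_assoc)
  moreover have "x \<circ> y' \<in> word_set U (m + n)" using Suc y by blast
  ultimately have "x \<circ> y \<in> word_set U (Suc (m + n))" unfolding word_set.simps using y by blast
  then show ?case by (simp only: add_Suc_right)
qed auto

lemma word_set_single: "u \<in> U \<Longrightarrow> u \<in> word_set U 1"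
  by simp

lemma word_set_pow: "u \<in> word_set U m \<Longrightarrow> (u ^^ k) \<in> word_set U (k * m)"
  by (induction k) (auto intro: word_set_add)

lemma finite_word_set: "finite U \<Longrightarrow> finite (word_set U n)"
proof (induction n)
  case (Suc n)
  have "word_set U (Suc n) = (\<lambda>(x, u). x \<circ> u) ` (word_set U n \<times> U)" by auto
  then show ?case using Suc by (metis finite_SigmaI finite_imageI)
qed auto

lemma word_set_mult: "T \<subseteq> word_set U m \<Longrightarrow> word_set T j \<subseteq> word_set U (m * j)"
proof (induction j)
  case (Suc j)
  then show ?case using word_set_add[of _ U "m * j" _ m] by (auto simp: add.commute)
qed simp

text \<open>The outermost letter of a product is read off from where it sends \<open>p\<close>, then
  stripped by injectivity.\<close>

lemma free_semigroup_card:
  assumes "finite T" "p \<in> R" and inj: "\<And>s. s \<in> T \<Longrightarrow> inj s"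
    and maps: "\<And>s x. s \<in> T \<Longrightarrow> x \<in> R \<Longrightarrow> s x \<in> R"
    and disj: "\<And>s s' x x'. s \<in> T \<Longrightarrow> s' \<in> T \<Longrightarrow> x \<in> R \<Longrightarrow> x' \<in> R \<Longrightarrow> s x = s' x' \<Longrightarrow> s = s'"
  shows "card (word_set T j) = card T ^ j"
proof (induction j)
  case (Suc j)
  have pR: "x p \<in> R" if "x \<in> word_set T j" for x j
    using that
  proof (induction j arbitrary: x)
    case (Suc j)
    then show ?case using maps unfolding word_set_Suc_left by auto
  qed (use assms in auto)
  have eq: "word_set T (Suc j) = (\<lambda>(u, x). u \<circ> x) ` (T \<times> word_set T j)"
    unfolding word_set_Suc_left by auto
  have "inj_on (\<lambda>(u, x). u \<circ> x) (T \<times> word_set T j)"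
  proof (rule inj_onI, clarify)
    fix u x u' x' assume *: "u \<in> T" "x \<in> word_set T j" "u' \<in> T" "x' \<in> word_set T j" "u \<circ> x = u' \<circ> x'"
    then have "u (x p) = u' (x' p)" by (metis comp_apply)
    then have "u = u'" using disj pR * by blast
    moreover have "x = x'"
      using * inj[of u] \<open>u = u'\<close> by (metis fun.inj_map_strong inj_compose injD fun_eq_iff comp_apply)
    ultimately show "u = u' \<and> x = x'" by blast
  qed
  then have "card (word_set T (Suc j)) = card (T \<times> word_set T j)"
    unfolding eq by (rule card_image)
  then show ?case using Suc by (simp add: card_cartesian_product)
qed simp

text \<open>The element \<open>w\<close> of \<open>U\<close> or \<open>U \<circ> U\<close> whose translate of the axis projects furthest in the direction of
  translation is used to send everything beyond all other translates; the factors \<open>h ^^ N\<close>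
  move points off the bad spots.\<close>

lemma ping_pong:
  fixes \<pi> :: "'x \<Rightarrow> int"
  assumes fin: "finite U'" and ne: "U' \<noteq> {}" and \<Omega>: "p \<in> \<Omega>"
    and G: "\<And>g. g \<in> G \<Longrightarrow> bij g" "\<And>g x. g \<in> G \<Longrightarrow> x \<in> \<Omega> \<Longrightarrow> g x \<in> \<Omega>"
    and h: "h \<in> G" "\<And>x. x \<in> \<Omega> \<Longrightarrow> \<pi> (h x) = \<pi> x + t" "t > 0"
    and D: "D \<ge> 0" "4 * D < int N * t"
    and U: "U' \<subseteq> U" "U \<subseteq> G" "\<And>u. u \<in> U \<Longrightarrow> finv u \<in> U"
    and P1: "\<And>u. u \<in> U' \<Longrightarrow> \<exists>q q'. \<forall>x\<in>\<Omega>. \<bar>\<pi> x - q'\<bar> > D \<longrightarrow> \<bar>\<pi> (u x) - q\<bar> \<le> D"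
    and P2: "\<And>u v. u \<in> U' \<Longrightarrow> v \<in> U' \<Longrightarrow> u \<noteq> v \<Longrightarrow>
      \<exists>q q'. \<forall>x\<in>\<Omega>. \<bar>\<pi> x - q'\<bar> > D \<longrightarrow> \<bar>\<pi> ((finv u \<circ> v) x) - q\<bar> \<le> D"
  shows "\<exists>T m w k. T \<subseteq> (\<lambda>u. u \<circ> (h ^^ N \<circ> w \<circ> h ^^ k)) ` U' \<and> w \<in> word_set U m \<and> m \<in> {1, 2} \<and>
    k \<in> {0, N} \<and> 2 * card T \<ge> card U' \<and> (\<forall>j. card (word_set T j) = card T ^ j)"
proof -
  have inv: "finv g (g x) = x" "g (finv g x) = x" "finv (finv g) = g" if "g \<in> G" for g x
    using G(1)[OF that] by (auto simp: bij_is_inj surj_f_inv_f bij_is_surj inv_inv_eq)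
  \<comment> \<open>The quotients decide whether two elements \<open>u\<close> and \<open>v\<close>
    can have overlapping images, see \<open>disj\<close> below.\<close>
  define W where "W = U' \<union> {finv u \<circ> v | u v. u \<in> U' \<and> v \<in> U' \<and> u \<noteq> v}"
  have "finite ((\<lambda>(u, v). finv u \<circ> v) ` (U' \<times> U'))" using fin by blast
  moreover have "W \<subseteq> U' \<union> (\<lambda>(u, v). finv u \<circ> v) ` (U' \<times> U')" by (auto simp: W_def)
  ultimately have finW: "finite W" using fin finite_subset by blast
  have "\<forall>g\<in>W. \<exists>q q'. \<forall>x\<in>\<Omega>. \<bar>\<pi> x - q'\<bar> > D \<longrightarrow> \<bar>\<pi> (g x) - q\<bar> \<le> D"
    using P1 P2 by (auto simp: W_def)
  then obtain q q' where q: "\<And>g x. g \<in> W \<Longrightarrow> x \<in> \<Omega> \<Longrightarrow> \<bar>\<pi> x - q' g\<bar> > D \<Longrightarrow> \<bar>\<pi> (g x) - q g\<bar> \<le> D"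
    by metis
  \<comment> \<open>The largest of all attracting positions \<open>q\<close> and exceptional
    positions \<open>q'\<close>; beyond \<open>Q + D\<close> every element of \<open>W\<close> is
    under control.\<close>
  define Q where "Q = Max (q ` W \<union> q' ` W)"
  have finQ: "finite (q ` W \<union> q' ` W)" "q ` W \<union> q' ` W \<noteq> {}" using finW ne by (auto simp: W_def)
  have Q: "q g \<le> Q" "q' g \<le> Q" if "g \<in> W" for g
    unfolding Q_def using finQ that by (auto intro!: Max_ge)
  have WG: "\<exists>m\<in>{1, 2}. g \<in> word_set U m \<and> finv g \<in> word_set U m" "\<And>x. x \<in> \<Omega> \<Longrightarrow> g (finv g x) = x \<and> finv g x \<in> \<Omega>"
    if g: "g \<in> W" for g
  proof -
    have U2: "u \<circ> v \<in> word_set U 2" if "u \<in> U" "v \<in> U" for u v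
      using word_set_add[OF word_set_single[OF that(1)] word_set_single[OF that(2)]] by (simp add: numeral_2_eq_2)
    consider "g \<in> U'" | u v where "u \<in> U'" "v \<in> U'" "g = finv u \<circ> v" using g by (auto simp: W_def)
    then have "(\<exists>m\<in>{1, 2}. g \<in> word_set U m \<and> finv g \<in> word_set U m) \<and> (\<forall>x\<in>\<Omega>. g (finv g x) = x \<and> finv g x \<in> \<Omega>)"
    proof cases
      case 1
      then have "g \<in> U" "finv g \<in> U" using U by auto
      then show ?thesis using word_set_single[of g U] word_set_single[of "finv g" U] inv(2)[of g] G(2) U(2) by blast
    next
      case 2
      then have u: "u \<in> U" "v \<in> U" "finv u \<in> U" "finv v \<in> U" "u \<in> G" "v \<in> G" using U by blast+
      have fg: "finv g = finv v \<circ> u"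
        unfolding 2(3) using u G(1) U by (metis bij_imp_bij_inv inv_inv_eq o_inv_distrib)
      then have "g \<in> word_set U 2" "finv g \<in> word_set U 2" using U2 u 2(3) by auto
      moreover have "g (finv g x) = x \<and> finv g x \<in> \<Omega>" if "x \<in> \<Omega>" for x
        using fg 2(3) u inv that G(2) U(2) by (metis comp_apply subsetD)
      ultimately show ?thesis by blast
    qed
    then show "\<exists>m\<in>{1, 2}. g \<in> word_set U m \<and> finv g \<in> word_set U m" "\<And>x. x \<in> \<Omega> \<Longrightarrow> g (finv g x) = x \<and> finv g x \<in> \<Omega>"
      by auto
  qed
  have "Q \<in> q ` W \<union> q' ` W" unfolding Q_def using Max_in[OF finQ] .
  then obtain g where g: "g \<in> W" "Q = q g \<or> Q = q' g" by blast
  obtain m where m: "m \<in> {1, 2}" "g \<in> word_set U m" "finv g \<in> word_set U m" using WG(1)[OF g(1)] by blast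
  \<comment> \<open>If \<open>Q\<close> is the exceptional position of \<open>g\<close>, it is
    attracting for \<open>finv g\<close>: a point that \<open>finv g\<close> does not send near
    \<open>Q\<close> must be near \<open>q g\<close>.\<close>
  obtain w qw where w: "w \<in> word_set U m" "\<And>x. x \<in> \<Omega> \<Longrightarrow> \<bar>\<pi> x - qw\<bar> > D \<Longrightarrow> \<bar>\<pi> (w x) - Q\<bar> \<le> D"
  proof (cases "Q = q g")
    case True
    then show ?thesis using that[of g "q' g"] q[OF g(1)] m by blast
  next
    case False
    then have Qg: "Q = q' g" using g by blast
    have "\<bar>\<pi> (finv g x) - Q\<bar> \<le> D" if x: "x \<in> \<Omega>" "\<bar>\<pi> x - q g\<bar> > D" for x
      using q[OF g(1), of "finv g x"] WG(2)[OF g(1) x(1)] x Qg by force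
    then show ?thesis using that[of "finv g" "q g"] m by blast
  qed
  have wG: "w \<in> G'" if "G' = {g. bij g \<and> (\<forall>x\<in>\<Omega>. g x \<in> \<Omega>)}" for G'
  proof -
    have "word_set U i \<subseteq> G'" for i
    proof (induction i)
      case (Suc i)
      then show ?case using U G that by (fastforce intro: bij_comp)
    qed (use that in auto)
    then show ?thesis using w by blast
  qed
  then have w': "bij w" "\<And>x. x \<in> \<Omega> \<Longrightarrow> w x \<in> \<Omega>" by auto
  have hp: "(h ^^ i) x \<in> \<Omega> \<and> \<pi> ((h ^^ i) x) = \<pi> x + int i * t" if "x \<in> \<Omega>" for i x
    by (induction i) (use that h G in \<open>auto simp: algebra_simps\<close>)
  have hb: "bij (h ^^ i)" for i using G(1)[OF h(1)] by (induction i) (auto intro: bij_comp)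
  \<comment> \<open>Points within \<open>D\<close> of \<open>q u\<close>, after
    \<open>h ^^ k\<close>, must miss the band of radius \<open>D\<close> around \<open>qw\<close>,
    hence \<open>2 * D\<close>. As \<open>int N * t > 4 * D\<close>, each \<open>u\<close> qualifies
    for \<open>k = 0\<close> or \<open>k = N\<close>, and one of the two keeps half of
    \<open>U'\<close>.\<close>
  define A where "A k = {u \<in> U'. \<bar>q u + int k * t - qw\<bar> > 2 * D}" for k
  have sub: "U' \<subseteq> A 0 \<union> A N" using D by (auto simp: A_def)
  have "card U' \<le> card (A 0) + card (A N)"
  proof -
    have "finite (A 0 \<union> A N)" using fin by (simp add: A_def)
    then have "card U' \<le> card (A 0 \<union> A N)" using sub by (intro card_mono)
    then show ?thesis using card_Un_le[of "A 0" "A N"] by linarith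
  qed
  then have "2 * card (A 0) \<ge> card U' \<or> 2 * card (A N) \<ge> card U'" by linarith
  then obtain k where k: "k \<in> {0, N}" "2 * card (A k) \<ge> card U'" by blast
  define \<tau> where "\<tau> = h ^^ N \<circ> w \<circ> h ^^ k"
  define R where "R = {x \<in> \<Omega>. \<exists>u\<in>A k. \<bar>\<pi> x - q u\<bar> \<le> D}"
  define B where "B = {x \<in> \<Omega>. \<pi> x > Q + D}"
  have AW: "u \<in> W" "u \<in> G" "u \<in> U'" if "u \<in> A k" for u using that U by (auto simp: A_def W_def)
  have RB: "\<tau> x \<in> B" if x: "x \<in> R" for x
  proof -
    obtain u where u: "u \<in> A k" "\<bar>\<pi> x - q u\<bar> \<le> D" "x \<in> \<Omega>" using x by (auto simp: R_def)
    have "\<bar>\<pi> ((h ^^ k) x) - qw\<bar> > D" using hp[OF u(3), of k] u by (auto simp: A_def)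
    then have "\<bar>\<pi> (w ((h ^^ k) x)) - Q\<bar> \<le> D" using w(2) hp u by blast
    then have "\<pi> (\<tau> x) > Q + D" "\<tau> x \<in> \<Omega>"
      using hp[of "w ((h ^^ k) x)" N] w'(2) hp[OF u(3), of k] D by (auto simp: \<tau>_def)
    then show ?thesis by (simp add: B_def)
  qed
  have Bq: "\<bar>\<pi> (g x) - q g\<bar> \<le> D" if "g \<in> W" "x \<in> B" for g x
    using that Q(2)[OF that(1)] q[OF that(1), of x] by (auto simp: B_def)
  have BR: "u x \<in> R" if "u \<in> A k" "x \<in> B" for u x
    using Bq[OF AW(1)[OF that(1)] that(2)] that AW G(2) by (auto simp: R_def B_def)
  \<comment> \<open>If \<open>u x = v y\<close>, then \<open>finv u \<circ> v\<close> sends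
    \<open>y\<close> to \<open>x\<close>. But it sends \<open>B\<close> to within \<open>D\<close>
    of a position that is at most \<open>Q\<close>, hence outside \<open>B\<close>.\<close>
  have disj: "u = v" if uv: "u \<in> A k" "v \<in> A k" "x \<in> B" "y \<in> B" "u x = v y" for u v x y
  proof (rule ccontr)
    assume "u \<noteq> v"
    then have gW: "finv u \<circ> v \<in> W" using AW uv by (auto simp: W_def)
    have "(finv u \<circ> v) y = x" using uv inv(1)[OF AW(2)[OF uv(1)]] by (metis comp_apply)
    then have "\<bar>\<pi> x - q (finv u \<circ> v)\<bar> \<le> D" using Bq[OF gW uv(4)] by simp
    then show False using Q(1)[OF gW] uv(3) by (auto simp: B_def)
  qed
  define T where "T = (\<lambda>u. u \<circ> \<tau>) ` A k"
  have "bij \<tau>" unfolding \<tau>_def by (intro bij_comp hb w')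
  have injT: "inj_on (\<lambda>u. u \<circ> \<tau>) (A k)"
  proof (rule inj_onI)
    fix u v assume "u \<circ> \<tau> = v \<circ> \<tau>"
    then have "u (\<tau> (finv \<tau> x)) = v (\<tau> (finv \<tau> x))" for x by (metis comp_apply)
    then show "u = v" using \<open>bij \<tau>\<close> by (simp add: bij_is_surj surj_f_inv_f fun_eq_iff)
  qed
  have cT: "card T = card (A k)" unfolding T_def by (rule card_image[OF injT])
  have "card U' > 0" using fin ne by (simp add: card_gt_0_iff)
  then have "A k \<noteq> {}" using k by auto
  then obtain u where u: "u \<in> A k" by blast
  define i where "i = nat (\<bar>Q\<bar> + D + \<bar>\<pi> p\<bar> + 1)"
  have "int i \<le> int i * t" using h(3) by (simp add: mult_le_cancel_left1)
  moreover have "int i = \<bar>Q\<bar> + D + \<bar>\<pi> p\<bar> + 1" using D by (simp add: i_def)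
  ultimately have "\<pi> ((h ^^ i) p) > Q + D" using hp[OF \<Omega>, of i] by linarith
  then have "(h ^^ i) p \<in> B" using hp[OF \<Omega>, of i] by (simp add: B_def)
  then have "u ((h ^^ i) p) \<in> R" using BR u by blast
  then have "card (word_set T j) = card T ^ j" for j
  proof (rule free_semigroup_card[rotated])
    show "finite T" unfolding T_def A_def using fin by auto
    show "inj s" if sT: "s \<in> T" for s
    proof -
      obtain u where u: "u \<in> A k" "s = u \<circ> \<tau>" using sT unfolding T_def by blast
      then have "bij s" using bij_comp[OF \<open>bij \<tau>\<close> G(1)[OF AW(2)[OF u(1)]]] by simp
      then show ?thesis by (rule bij_is_inj)
    qed
    show "s x \<in> R" if "s \<in> T" "x \<in> R" for s x
      using that RB BR by (auto simp: T_def)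
    show "s = s'" if sT: "s \<in> T" "s' \<in> T" and xR: "x \<in> R" "x' \<in> R" "s x = s' x'" for s s' x x'
    proof -
      obtain u v where "u \<in> A k" "s = u \<circ> \<tau>" "v \<in> A k" "s' = v \<circ> \<tau>"
        using sT unfolding T_def by blast
      moreover from this have "u (\<tau> x) = v (\<tau> x')" using xR(3) by (simp only: comp_apply)
      ultimately show ?thesis using disj[OF _ _ RB[OF xR(1)] RB[OF xR(2)]] by metis
    qed
  qed
  moreover have "T \<subseteq> (\<lambda>u. u \<circ> (h ^^ N \<circ> w \<circ> h ^^ k)) ` U'" by (auto simp: T_def \<tau>_def A_def)
  ultimately show ?thesis using w(1) m(1) k cT by metis
qed

section \<open>Halfspaces of the right-angled Artin group\<close>

context raag_graph
begin

definition halfspaces :: "'v \<Rightarrow> 'v vec set set" where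
  "halfspaces v = {g ` H a | g a. g \<in> ops \<and> a \<in> D \<and> fst a = v}"

lemma halfspacesI: "g \<in> ops \<Longrightarrow> a \<in> D \<Longrightarrow> fst a = v \<Longrightarrow> g ` H a \<in> halfspaces v"
  unfolding halfspaces_def by blast

lemma ops_mem_image: "g \<in> ops \<Longrightarrow> x \<in> g ` S \<longleftrightarrow> finv g x \<in> S"
  using ops_invs(1,2)[of g] by (auto intro: image_eqI[of x g "finv g x"])

lemma ops_inv_image: "g \<in> ops \<Longrightarrow> finv g ` g ` S = S" "g \<in> ops \<Longrightarrow> g ` finv g ` S = S"
  using ops_invs by (simp_all add: image_comp)

lemma H_sub: "H a \<subseteq> orb" by (auto simp: H_def)

lemma halfspace_compl:
  assumes "g \<in> ops" "a \<in> D"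
  shows "orb - g ` H a = (g \<circ> act1 a) ` H (letter_inv a)"
proof -
  have "orb - g ` H a = g ` (orb - H a)"
    using image_set_diff[OF bij_is_inj[OF ops_bij[OF assms(1)]], of orb "H a"] ops_image_orb[OF assms(1)] by simp
  then show ?thesis using H_compl[OF assms(2)] by (simp add: image_comp)
qed

text \<open>\<open>exchange\<close> translated by \<open>g\<close>: an edge enters at most one
  halfspace, and the edges entering a given one are link translates of each other.\<close>

lemma crossing:
  assumes g: "g \<in> ops" "a \<in> D" and z: "z \<in> ops" "b \<in> D"
    and cr: "z p0 \<notin> g ` H a" "z (act1 b p0) \<in> g ` H a"
  shows "b = a" "\<exists>w. w \<in> lists D \<and> z = g \<circ> act w \<and> in_link a w" "g ` H a = z ` H b"
proof -
  obtain w where w: "good w" "act w = finv g \<circ> z" using ops_good[of "finv g \<circ> z"] g z by auto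
  have wD: "w \<in> lists D" using w good_lists by blast
  have "act w p0 \<notin> H a" "act w (act1 b p0) \<in> H a" using cr w(2) ops_mem_image[OF g(1)] by simp_all
  then have "act w p0 a > 0" "act w (act1 b p0) a < 0"
    using notin_H g wD by (auto simp: H_def)
  with exchange[OF w(1) z(2) g(2)] have ab: "a = b" "in_link a w" by auto
  have zg: "z = g \<circ> act w" using w(2) ops_invs(4)[OF g(1)] by (simp add: o_assoc)
  show "b = a" using ab by simp
  show "\<exists>w. w \<in> lists D \<and> z = g \<circ> act w \<and> in_link a w" using zg wD ab by blast
  have "z ` H b = g ` act w ` H a" by (simp only: zg ab image_comp)
  then show "g ` H a = z ` H b" using in_link_H[OF ab(2) wD] by simp
qed

lemma halfspace_const:
  assumes K: "K \<in> halfspaces v" and z: "z \<in> ops"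
    and w: "w \<in> lists D" "\<forall>b\<in>set w. fst b \<noteq> v"
  shows "z p0 \<in> K \<longleftrightarrow> z (act w p0) \<in> K"
  using z w
proof (induction w arbitrary: z)
  case (Cons b w)
  obtain g a where K: "K = g ` H a" "g \<in> ops" "a \<in> D" "fst a = v" using K by (auto simp: halfspaces_def)
  have b: "b \<in> D" "fst b \<noteq> v" and zb: "z \<circ> act1 b \<in> ops" using Cons.prems by auto
  have "\<not> (z p0 \<notin> K \<and> z (act1 b p0) \<in> K)"
    using crossing(1)[OF K(2,3) Cons.prems(1) b(1)] b K by blast
  moreover have "\<not> ((z \<circ> act1 b) p0 \<notin> K \<and> (z \<circ> act1 b) (act1 (letter_inv b) p0) \<in> K)"
    using crossing(1)[OF K(2,3) zb, of "letter_inv b"] b K by (metis letter_inv_D letter_inv_simps(1))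
  ultimately have "z p0 \<in> K \<longleftrightarrow> (z \<circ> act1 b) p0 \<in> K" by (auto simp: act1_inv)
  also have "\<dots> \<longleftrightarrow> (z \<circ> act1 b) (act w p0) \<in> K"
    using Cons.IH[OF zb] Cons.prems by simp
  finally show ?case by simp
qed simp

text \<open>Follow a word starting at \<open>k p0\<close>. A path that leaves the halfspace returns
  across the same wall, at \<open>k (act1 c (act w p0))\<close> with \<open>w\<close> in the link of
  \<open>c\<close>. Such \<open>w\<close> has no letter of type \<open>v\<close>, so by
  \<open>halfspace_const\<close> this point and \<open>k (act1 c p0)\<close> are on the same side of
  \<open>K\<close>.\<close>

lemma halfspace_connected:
  assumes K: "K \<in> halfspaces v" and L: "k \<in> ops" "c \<in> D" "fst c = v"
    and no: "\<And>z b. z \<in> ops \<Longrightarrow> b \<in> D \<Longrightarrow> z p0 \<in> k ` H c \<Longrightarrow> z (act1 b p0) \<in> k ` H c \<Longrightarrow>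
      (z p0 \<in> K \<longleftrightarrow> z (act1 b p0) \<in> K)"
  shows "k ` H c \<subseteq> K \<or> k ` H c \<inter> K = {}"
proof -
  have "k (act w p0) \<in> K \<longleftrightarrow> k (act1 c p0) \<in> K"
    if "w \<in> lists D" "k (act w p0) \<in> k ` H c" for w
    using that
  proof (induction w rule: rev_induct)
    case Nil
    then show ?case using ops_mem_image[OF L(1)] ops_invs[OF L(1)] by simp
  next
    case (snoc b u)
    let ?z = "k \<circ> act u"
    have u: "u \<in> lists D" "b \<in> D" "?z \<in> ops" using snoc L by auto
    have zb: "k (act (u @ [b]) p0) = ?z (act1 b p0)" by (simp add: act_append)
    show ?case
    proof (cases "?z p0 \<in> k ` H c")
      case True
      then show ?thesis using no[OF u(3,2)] snoc.IH u snoc.prems(2) unfolding zb by auto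
    next
      case False
      then have cr: "?z p0 \<notin> k ` H c" "?z (act1 b p0) \<in> k ` H c" using snoc.prems(2) zb by auto
      obtain w where w: "w \<in> lists D" "?z = k \<circ> act w" "in_link c w" "b = c"
        using crossing[OF L(1,2) u(3,2) cr] by blast
      have "?z (act1 b p0) = (k \<circ> act1 c) (act w p0)"
        using in_link_comm[OF w(3)] w(4) by (simp add: w(2))
      moreover have "\<forall>b\<in>set w. fst b \<noteq> v" using w(3) E_irrefl L(3) by (auto simp: in_link_def)
      then have "(k \<circ> act1 c) p0 \<in> K \<longleftrightarrow> (k \<circ> act1 c) (act w p0) \<in> K"
        using halfspace_const[OF K, of "k \<circ> act1 c" w] w L by auto
      ultimately show ?thesis unfolding zb by simp
    qed
  qed
  note * = this
  have "x \<in> K \<longleftrightarrow> k (act1 c p0) \<in> K" if x: "x \<in> k ` H c" for x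
  proof -
    have "finv k x \<in> orb" using x ops_mem_image[OF L(1)] H_sub by blast
    then obtain w where w: "w \<in> lists D" "finv k x = act w p0" by (auto simp: orb_def ops_def)
    then have "x = k (act w p0)" using ops_invs(2)[OF L(1)] by metis
    then show ?thesis using *[OF w(1)] x by simp
  qed
  then show ?thesis by blast
qed

text \<open>The edges across the wall of \<open>K\<close> are link translates of one edge, and link
  words cross no wall of type \<open>v\<close>. So all of them lie outside \<open>L\<close> with
  that edge, and no edge inside \<open>L\<close> crosses \<open>K\<close>.\<close>

lemma halfspaces_nested_aux:
  assumes K: "K = g ` H a" "g \<in> ops" "a \<in> D" "fst a = v" and L: "L \<in> halfspaces v"
    and out: "g p0 \<notin> L" "g (act1 a p0) \<notin> L"
  shows "L \<subseteq> K \<or> L \<inter> K = {}"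
proof -
  obtain k c where kc: "L = k ` H c" "k \<in> ops" "c \<in> D" "fst c = v" using L by (auto simp: halfspaces_def)
  have KH: "K \<in> halfspaces v" using K halfspacesI by simp
  have edge: "z p0 \<notin> L \<and> z (act1 b p0) \<notin> L"
    if z: "z \<in> ops" "b \<in> D" "z p0 \<notin> K" "z (act1 b p0) \<in> K" for z b
  proof -
    obtain w where w: "w \<in> lists D" "z = g \<circ> act w" "in_link a w" "b = a"
      using crossing[OF K(2,3) z(1,2)] z(3,4) K(1) by blast
    have nv: "\<forall>b\<in>set w. fst b \<noteq> v" using w(3) E_irrefl K(4) by (auto simp: in_link_def)
    have "z p0 \<notin> L" using halfspace_const[OF L K(2) w(1) nv] out(1) w(2) by simp
    moreover have "z (act1 b p0) = (g \<circ> act1 a) (act w p0)"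
      using in_link_comm[OF w(3)] w(4) by (simp add: w(2))
    then have "z (act1 b p0) \<notin> L"
      using halfspace_const[OF L _ w(1) nv, of "g \<circ> act1 a"] out(2) K by simp
    ultimately show ?thesis by blast
  qed
  have "k ` H c \<subseteq> K \<or> k ` H c \<inter> K = {}"
  proof (rule halfspace_connected[OF KH kc(2-4)])
    fix z b assume z: "z \<in> ops" "b \<in> D" "z p0 \<in> k ` H c" "z (act1 b p0) \<in> k ` H c"
    have "z p0 \<notin> K \<Longrightarrow> z (act1 b p0) \<notin> K" using edge[OF z(1,2)] z kc(1) by blast
    moreover have "z (act1 b p0) \<notin> K \<Longrightarrow> z p0 \<notin> K"
      using edge[of "z \<circ> act1 b" "letter_inv b"] z kc(1) by (auto simp: act1_inv)
    ultimately show "z p0 \<in> K \<longleftrightarrow> z (act1 b p0) \<in> K" by blast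
  qed
  then show ?thesis using kc(1) by simp
qed

lemma halfspaces_nested:
  assumes "K \<in> halfspaces v" "L \<in> halfspaces v"
  shows "K \<subseteq> L \<or> L \<subseteq> K \<or> K \<inter> L = {} \<or> K \<union> L = orb"
proof -
  obtain g a where K: "K = g ` H a" "g \<in> ops" "a \<in> D" "fst a = v" using assms(1) by (auto simp: halfspaces_def)
  obtain k c where L: "L = k ` H c" "k \<in> ops" "c \<in> D" "fst c = v" using assms(2) by (auto simp: halfspaces_def)
  have sub: "K \<subseteq> orb" "L \<subseteq> orb" using K L H_sub ops_image_orb by blast+
  have LC: "orb - L \<in> halfspaces v"
    unfolding L(1) halfspace_compl[OF L(2,3)] using L by (intro halfspacesI) auto
  have orb: "g p0 \<in> orb" "g (act1 a p0) \<in> orb" using K by auto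
  \<comment> \<open>The edge across the wall of \<open>K\<close> lies on one side of
    \<open>L\<close>, or it crosses the wall of \<open>L\<close> too, and then \<open>L\<close> is
    \<open>K\<close> or its complement.\<close>
  consider "g p0 \<notin> L" "g (act1 a p0) \<notin> L" | "g p0 \<in> L" "g (act1 a p0) \<in> L"
    | "g p0 \<notin> L" "g (act1 a p0) \<in> L" | "g p0 \<in> L" "g (act1 a p0) \<notin> L" by blast
  then show ?thesis
  proof cases
    case 1
    then show ?thesis using halfspaces_nested_aux[OF K assms(2)] by blast
  next
    case 2
    then show ?thesis using halfspaces_nested_aux[OF K LC] sub by blast
  next
    case 3
    then have "L = g ` H a" using crossing(3)[OF L(2,3) K(2,3)] L(1) by simp
    then show ?thesis using K by simp
  next
    case 4
    have "L = (g \<circ> act1 a) ` H (letter_inv a)"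
      using crossing(3)[OF L(2,3), of "g \<circ> act1 a" "letter_inv a"] 4 L(1) K(2,3)
      by (simp add: act1_inv)
    then have "L = orb - K" using halfspace_compl K by simp
    then show ?thesis by blast
  qed
qed

lemma halfspaces_finite_sep:
  assumes "x \<in> orb" "y \<in> orb"
  shows "finite {K \<in> halfspaces v. x \<in> K \<and> y \<notin> K}"
proof -
  have *: "finite {K \<in> halfspaces v. z (act w p0) \<in> K \<and> z p0 \<notin> K}" if "w \<in> lists D" "z \<in> ops" for w z
    using that
  proof (induction w arbitrary: z rule: list.induct)
    case (Cons b w)
    have b: "b \<in> D" and zb: "z \<circ> act1 b \<in> ops" using Cons.prems by auto
    have "{K \<in> halfspaces v. z (act (b # w) p0) \<in> K \<and> z p0 \<notin> K} \<subseteq>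
      insert (z ` H b) {K \<in> halfspaces v. (z \<circ> act1 b) (act w p0) \<in> K \<and> (z \<circ> act1 b) p0 \<notin> K}"
    proof
      fix K assume "K \<in> {K \<in> halfspaces v. z (act (b # w) p0) \<in> K \<and> z p0 \<notin> K}"
      then have K: "K \<in> halfspaces v" "(z \<circ> act1 b) (act w p0) \<in> K" "z p0 \<notin> K" by auto
      obtain g a where "K = g ` H a" "g \<in> ops" "a \<in> D" using K(1) by (auto simp: halfspaces_def)
      then have "z (act1 b p0) \<in> K \<Longrightarrow> K = z ` H b" using crossing(3)[of g a z b] Cons.prems(2) b K(3) by blast
      then show "K \<in> insert (z ` H b) {K \<in> halfspaces v. (z \<circ> act1 b) (act w p0) \<in> K \<and> (z \<circ> act1 b) p0 \<notin> K}"
        using K by auto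
    qed
    then show ?case using Cons.IH[OF _ zb] Cons.prems finite_subset by (metis (no_types, lifting) finite.insertI listsE)
  qed simp
  obtain z z' where z: "z \<in> ops" "y = z p0" "z' \<in> ops" "x = z' p0" using assms by (auto simp: orb_def)
  have "finv z \<circ> z' \<in> ops" using z by simp
  then obtain w where w: "w \<in> lists D" "finv z \<circ> z' = act w" by (auto simp: ops_def)
  then have "x = z (act w p0)" using z ops_invs(2)[OF z(1)] by (metis comp_apply)
  then show ?thesis using *[OF w(1) z(1)] z by simp
qed

sublocale tree: tree_action orb "halfspaces v" ops "card D" for v
proof unfold_locales
  fix K assume "K \<in> halfspaces v"
  then obtain g a where K: "K = g ` H a" "g \<in> ops" "a \<in> D" "fst a = v" by (auto simp: halfspaces_def)
  show "K \<subseteq> orb" using K H_sub ops_image_orb by blast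
  show "K \<noteq> {}" using K act1_p0_H by blast
  have "g p0 \<notin> K" using K ops_mem_image ops_invs by simp
  then show "K \<noteq> orb" using K(2) ops_p0_orb by blast
  show "orb - K \<in> halfspaces v"
    unfolding K(1) halfspace_compl[OF K(2,3)] using K by (intro halfspacesI) auto
  show "f ` K \<in> halfspaces v" if "f \<in> ops" for f
    using that K halfspacesI[of "f \<circ> g" a v] by (simp add: image_comp)
  fix f h i
  assume "f \<in> ops" "h \<in> ops" "\<And>i. i < card D \<Longrightarrow> f ` (h ^^ i) ` K = (h ^^ i) ` K"
  then show "f ` (h ^^ i) ` K = (h ^^ i) ` K" using krylov_stab K by metis
qed (use halfspaces_nested halfspaces_finite_sep ops_image_orb ops_bij in auto)

section \<open>Cyclically reduced words and the halfspaces they skewer\<close>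

lemma shorten:
  assumes "w \<in> lists D" "a \<in> D" "act w p0 a < 0"
  obtains w' where "w' \<in> lists D" "act w = act (a # w')" "length w' < length w"
proof -
  obtain u where u: "good u" "raag_eq V E w u" "length u \<le> length w" using good_exists[OF assms(1)] .
  then have "act u p0 a < 0" using act_cong assms(3) by metis
  then obtain w' where w': "good (a # w')" "raag_eq V E u (a # w')" "Suc (length w') = length u"
    using good_split[OF u(1) assms(2)] by blast
  then show ?thesis using that[of w'] u act_cong good_lists by force
qed

definition conj_min :: "('v \<times> bool) list \<Rightarrow> bool" where
  "conj_min w \<longleftrightarrow> w \<in> lists D \<and>
    (\<forall>w'\<in>lists D. \<forall>k\<in>ops. act w' = k \<circ> act w \<circ> finv k \<longrightarrow> length w \<le> length w')"

lemma conj_min_exists: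
  assumes "g \<in> ops"
  obtains k w where "k \<in> ops" "conj_min w" "g = k \<circ> act w \<circ> finv k"
proof -
  define P where "P w \<longleftrightarrow> w \<in> lists D \<and> (\<exists>k\<in>ops. g = k \<circ> act w \<circ> finv k)" for w
  obtain w0 where "w0 \<in> lists D" "g = act w0" using assms by (auto simp: ops_def)
  then have "P w0" unfolding P_def by (intro conjI bexI[of _ id]) (auto simp: inv_id)
  then obtain w where w: "P w" "\<And>u. P u \<Longrightarrow> length w \<le> length u"
    using ex_has_least_nat[of P w0 length] by blast
  then obtain k where k: "k \<in> ops" and g: "g = k \<circ> act w \<circ> finv k" by (auto simp: P_def)
  have "length w \<le> length w'" if w': "w' \<in> lists D" "r \<in> ops" "act w' = r \<circ> act w \<circ> finv r" for w' r
  proof -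
    have "g = (k \<circ> finv r) \<circ> act w' \<circ> finv (k \<circ> finv r)"
      by (rule ext) (use k w' ops_invs[OF w'(2)] in \<open>simp add: ops_inv_comp w'(3) g\<close>)
    moreover have "k \<circ> finv r \<in> ops" using k w' by simp
    ultimately show ?thesis using w(2) w'(1) unfolding P_def by blast
  qed
  then have "conj_min w" using w(1) by (simp add: conj_min_def P_def)
  then show ?thesis using that k g by blast
qed

lemma conj_min_rotate:
  assumes "conj_min (u @ v)" shows "conj_min (v @ u)"
proof -
  have uv: "u \<in> lists D" "v \<in> lists D" using assms by (auto simp: conj_min_def)
  have "length (u @ v) \<le> length w'" if w': "w' \<in> lists D" "k \<in> ops" "act w' = k \<circ> act (v @ u) \<circ> finv k" for w' k
  proof -
    have "finv (act u) \<in> ops" "k \<circ> finv (act u) \<in> ops" using uv w' by auto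
    moreover have "act w' = (k \<circ> finv (act u)) \<circ> act (u @ v) \<circ> finv (k \<circ> finv (act u))"
      by (rule ext) (use w' uv ops_invs[of "act u"] in \<open>simp add: ops_inv_comp act_append\<close>)
    ultimately show ?thesis using assms w' unfolding conj_min_def by blast
  qed
  then show ?thesis using uv by (auto simp: conj_min_def add.commute)
qed

text \<open>Minimality forbids cancellation at the front and, up to commutation, a last letter
  inverse to \<open>a\<close>. So the edge from \<open>p0\<close> to \<open>act1 a p0\<close> is
  carried into \<open>H a\<close> while \<open>p0\<close> is in neither halfspace, and of the nested
  positions only strict inclusion survives.\<close>

lemma conj_min_skewers:
  assumes min: "conj_min (a # w1)"
  shows "act (a # w1) ` H a \<subset> H a"
proof -
  let ?w = "a # w1"
  have D: "a \<in> D" "w1 \<in> lists D" "?w \<in> lists D" using min by (auto simp: conj_min_def)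
  have w: "act ?w \<in> ops" using D(3) by (rule act_ops)
  have idH: "id ` H a = H a" by simp
  have "act ?w p0 \<in> H a"
  proof (rule ccontr)
    assume "act ?w p0 \<notin> H a"
    then have "act ?w p0 \<in> act1 a ` H (letter_inv a)"
      using H_compl[OF D(1)] ops_p0_orb[OF w] by blast
    then obtain y where y: "act1 a (act w1 p0) = act1 a y" "y \<in> H (letter_inv a)" by auto
    then have "act w1 p0 \<in> H (letter_inv a)" using act1_inv_left by metis
    then obtain w2 where w2: "w2 \<in> lists D" "act w1 = act (letter_inv a # w2)" "length w2 < length w1"
      using shorten[OF D(2), of "letter_inv a"] D(1) by (auto simp: H_def)
    have "act w2 = id \<circ> act ?w \<circ> finv id"
      by (rule ext) (simp add: w2(2) act1_inv inv_id)
    then have "length ?w \<le> length w2" using min w2(1) ops_id unfolding conj_min_def by blast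
    then show False using w2(3) by simp
  qed
  note wp = this
  have wap: "act ?w (act1 a p0) \<in> H a"
  proof (rule ccontr)
    assume "act ?w (act1 a p0) \<notin> H a"
    then have "letter_inv a = a"
      using crossing(1)[of id a "act ?w \<circ> act1 a" "letter_inv a"] D w wp by (simp add: act1_inv)
    then show False by simp
  qed
  \<comment> \<open>Otherwise \<open>w1\<close> ends with the inverse of \<open>a\<close>, and
    conjugating by this letter would shorten the word.\<close>
  have pw: "p0 \<notin> act ?w ` H a"
  proof
    assume "p0 \<in> act ?w ` H a"
    then have "finv (act ?w) p0 \<in> H a" using ops_mem_image[OF w] by blast
    then have 1: "act (word_inv w1) (act1 (letter_inv a) p0) \<in> H a" by (simp add: inv_act act_append del: act.simps(2)) simp
    have "act (word_inv w1) p0 \<in> H a"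
    proof (rule ccontr)
      assume "act (word_inv w1) p0 \<notin> H a"
      then have "letter_inv a = a"
        using crossing(1)[of id a "act (word_inv w1)" "letter_inv a"] 1 D by simp
      then show False by simp
    qed
    then obtain w2 where w2: "w2 \<in> lists D" "act (word_inv w1) = act (a # w2)" "length w2 < length w1"
      using shorten[of "word_inv w1" a] D by (auto simp: H_def)
    have "act w1 = finv (act (word_inv w1))" using D by (simp add: inv_act)
    also have "\<dots> = act (word_inv (a # w2))" unfolding w2(2) by (rule inv_act)
    finally have "act w1 = act (word_inv w2) \<circ> act1 (letter_inv a)" by (simp add: act_append)
    moreover have "finv (act1 (letter_inv a)) = act1 a" using inv_act[of "[letter_inv a]"] by simp
    ultimately have "act (word_inv w2) x = (act1 (letter_inv a) \<circ> act ?w \<circ> finv (act1 (letter_inv a))) x" for x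
      by (simp add: act1_inv act1_inv_left)
    then have "act (word_inv w2) = act1 (letter_inv a) \<circ> act ?w \<circ> finv (act1 (letter_inv a))" by (rule ext)
    then have "length ?w \<le> length (word_inv w2)"
      using min w2(1) D(1) unfolding conj_min_def by (metis act1_ops letter_inv_D word_inv_D)
    then show False using w2(3) by simp
  qed
  have "H a \<in> halfspaces (fst a)" using halfspacesI[of id a] D by simp
  moreover have "act ?w ` H a \<in> halfspaces (fst a)" using halfspacesI[OF w] D by simp
  ultimately have "act ?w ` H a \<subseteq> H a \<or> H a \<subseteq> act ?w ` H a \<or> act ?w ` H a \<inter> H a = {} \<or> act ?w ` H a \<union> H a = orb"
    using halfspaces_nested by blast
  moreover have "act ?w p0 \<notin> act ?w ` H a" using ops_mem_image[OF w] ops_invs[OF w] by simp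
  moreover have "act ?w (act1 a p0) \<in> act ?w ` H a" using act1_p0_H[OF D(1)] by blast
  moreover have "p0 \<notin> H a" "p0 \<in> orb" by auto
  ultimately show ?thesis using wp wap pw by blast
qed

text \<open>Rotation brings each letter of \<open>w\<close> to the front, so every wall crossed
  along one period is skewered.\<close>

lemma conj_skewers:
  assumes k: "k \<in> ops" and w: "conj_min w" and g: "g = k \<circ> act w \<circ> finv k" and i: "i < length w"
  shows "g ` (k \<circ> act (take i w)) ` H (w ! i) \<subset> (k \<circ> act (take i w)) ` H (w ! i)"
proof -
  let ?u = "take i w" and ?v = "drop i w"
  have split: "w = ?u @ ?v" "?v @ ?u = w ! i # (drop (Suc i) w @ ?u)"
    using i by (simp_all add: Cons_nth_drop_Suc)
  have uD: "?u \<in> lists D" using w unfolding conj_min_def by (metis append_in_lists_conv split(1))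
  have m: "act (?v @ ?u) ` H (w ! i) \<subset> H (w ! i)"
    using conj_min_rotate[of ?u ?v] w conj_min_skewers unfolding split(2) by simp
  have "g \<circ> (k \<circ> act ?u) = (k \<circ> act ?u) \<circ> act (?v @ ?u)"
  proof (rule ext)
    fix x
    have "act w y = act ?u (act ?v y)" for y using act_append[of ?u ?v] by simp
    then show "(g \<circ> (k \<circ> act ?u)) x = ((k \<circ> act ?u) \<circ> act (?v @ ?u)) x"
      using ops_invs[OF k] by (simp add: g act_append)
  qed
  then have "g ` (k \<circ> act ?u) ` H (w ! i) = (k \<circ> act ?u) ` act (?v @ ?u) ` H (w ! i)"
    by (metis image_comp)
  moreover have "inj (k \<circ> act ?u)" using k uD ops_bij[of "k \<circ> act ?u"] by (simp add: bij_is_inj)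
  ultimately show ?thesis using m by (metis inj_image_subset_iff psubset_eq inj_image_eq_iff)
qed

lemma conj_min_nonempty: "g \<noteq> id \<Longrightarrow> k \<in> ops \<Longrightarrow> g = k \<circ> act w \<circ> finv k \<Longrightarrow> w \<noteq> []"
  using ops_invs(4) by auto

lemma raag_eq_filter:
  "raag_eq V E w w' \<Longrightarrow> raag_eq V E (filter (\<lambda>b. fst b \<in> S) w) (filter (\<lambda>b. fst b \<in> S) w')"
proof (induction rule: raag_eq.induct)
  case (cancel v xs b ys)
  then show ?case using raag_eq.cancel[of v V E "filter (\<lambda>b. fst b \<in> S) xs" b] by (auto intro: raag_eq.refl)
next
  case (commute v u xs b c ys)
  then show ?case using raag_eq.commute[of v u E V "filter (\<lambda>b. fst b \<in> S) xs" b c] by (auto intro: raag_eq.refl)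
qed (auto intro: raag_eq.intros)

lemma filter_word_inv: "filter (\<lambda>b. fst b \<in> S) (word_inv w) = word_inv (filter (\<lambda>b. fst b \<in> S) w)"
  by (induction w) auto

lemma in_link_commute_word:
  "\<forall>b\<in>set u. in_link b w \<Longrightarrow> act w (act u x) = act u (act w x)"
  by (induction u) (auto simp: in_link_comm)

text \<open>An element of the form \<open>h\<inverse> x h x\<inverse>\<close> that fixes all walls crossed by a cyclically reduced
  word for \<open>h\<close> lies in the parabolic subgroup of generators commuting with and distinct from
  all letters of \<open>h\<close>; the retraction to that subgroup kills \<open>h\<close>, hence the element itself.\<close>

lemma rigid:
  assumes k: "k \<in> ops" and w: "w \<in> lists D" and g: "g = k \<circ> act w \<circ> finv k" and x: "x \<in> ops"
    and f: "f = finv g \<circ> (x \<circ> g \<circ> finv x)"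
    and stab: "\<And>i. i < length w \<Longrightarrow> f ` (k \<circ> act (take i w)) ` H (w ! i) = (k \<circ> act (take i w)) ` H (w ! i)"
  shows "f = id"
proof -
  have gG: "g \<in> ops" using k w by (simp add: g)
  have fG: "f \<in> ops" using gG x by (simp add: f)
  define f' where "f' = finv k \<circ> f \<circ> k"
  have f'G: "f' \<in> ops" using k fG by (simp add: f'_def)
  obtain fw where fw: "good fw" "act fw = f'" using ops_good[OF f'G] .
  have fwD: "fw \<in> lists D" using fw good_lists by blast
  have wi: "w ! i \<in> D" "take i w \<in> lists D" if "i < length w" for i
    using w nth_mem[OF that] by (auto dest: in_set_takeD)
  have stab': "f' ` act (take i w) ` H (w ! i) = act (take i w) ` H (w ! i)" if i: "i < length w" for i
  proof -
    have "f' ` act (take i w) ` H (w ! i) = finv k ` f ` (k \<circ> act (take i w)) ` H (w ! i)"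
      by (simp add: f'_def image_comp o_assoc)
    also have "\<dots> = finv k ` k ` act (take i w) ` H (w ! i)" using stab[OF i] by (simp add: image_comp)
    finally show ?thesis using ops_inv_image[OF k] by simp
  qed
  \<comment> \<open>A word in the link of the earlier letters commutes with the prefix
    \<open>take i w\<close>, which reduces the hypothesis to stabilizing
    \<open>H (w ! i)\<close>.\<close>
  have "i \<le> length w \<Longrightarrow> \<forall>j<i. in_link (w ! j) fw" for i
  proof (induction i)
    case (Suc i)
    let ?u = "take i w"
    have i: "i < length w" using Suc by simp
    have IH: "\<forall>j<i. in_link (w ! j) fw" using Suc by simp
    have "in_link b fw" if b: "b \<in> set ?u" for b
    proof -
      obtain j where "j < i" "b = w ! j" using b i by (auto simp: in_set_conv_nth)
      then show ?thesis using IH by simp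
    qed
    then have "f' \<circ> act ?u = act ?u \<circ> f'" using in_link_commute_word[of ?u fw] fw(2) by (simp add: o_def)
    then have "act ?u ` f' ` H (w ! i) = act ?u ` H (w ! i)" using stab'[OF i] by (metis image_comp)
    then have "f' ` H (w ! i) = H (w ! i)"
      using ops_inv_image[of "act ?u"] wi(2)[OF i] by (metis act_ops)
    then have "in_link (w ! i) fw" using H_stab_link[OF fw(1) wi(1)[OF i]] fw(2) by simp
    then show ?case using IH less_Suc_eq by metis
  qed simp
  then have link: "in_link b fw" if "b \<in> set w" for b using that by (metis in_set_conv_nth order_refl)
  have "finv k \<circ> x \<circ> k \<in> ops" using k x by simp
  then obtain xw where xw: "xw \<in> lists D" "finv k \<circ> x \<circ> k = act xw" by (auto simp: ops_def)
  have "f' y = act (word_inv w @ xw @ w @ word_inv xw) y" for y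
  proof -
    have "act (word_inv xw) y = finv k (finv x (k y))"
    proof -
      have "act (word_inv xw) = finv (finv k \<circ> x \<circ> k)" unfolding xw(2) by (rule inv_act[symmetric])
      then show ?thesis using k x by (simp add: ops_inv_comp ops_invs o_assoc)
    qed
    moreover have "act xw y = finv k (x (k y))" for y using xw(2) by (metis comp_apply)
    moreover have "act (word_inv w) y = finv (act w) y" for y by (simp add: inv_act)
    moreover have "finv g y = k (finv (act w) (finv k y))" for y
      using k w by (simp add: g ops_inv_comp ops_invs)
    ultimately show ?thesis using ops_invs[OF k] by (simp add: f'_def f act_append g)
  qed
  then have "raag_eq V E fw (word_inv w @ xw @ w @ word_inv xw)"
    using fwD w xw fw(2) by (intro act_faithful) auto
  \<comment> \<open>Deleting letters outside the support of \<open>fw\<close> respects the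
    relations. No letter of \<open>w\<close> has its vertex in that support, so only
    \<open>xw\<close> times its inverse is left.\<close>
  from raag_eq_filter[OF this, of "fst ` set fw"]
  have eq: "raag_eq V E (filter (\<lambda>b. fst b \<in> fst ` set fw) fw)
     (filter (\<lambda>b. fst b \<in> fst ` set fw) (word_inv w @ xw @ w @ word_inv xw))" .
  have "filter (\<lambda>b. fst b \<in> fst ` set fw) fw = fw" by (auto simp: filter_id_conv)
  moreover have "filter (\<lambda>b. fst b \<in> fst ` set fw) w = []"
    using link E_irrefl by (auto simp: filter_empty_conv in_link_def) (metis fst_conv)
  ultimately have "raag_eq V E fw (filter (\<lambda>b. fst b \<in> fst ` set fw) xw @ word_inv (filter (\<lambda>b. fst b \<in> fst ` set fw) xw))"
    using eq by (simp add: filter_word_inv)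
  moreover have "filter (\<lambda>b. fst b \<in> fst ` set fw) xw \<in> lists D" using xw(1) by auto
  ultimately have "act fw = act []" using raag_eq_inv' raag_eq.trans act_cong by metis
  then have "finv k \<circ> f \<circ> k = id" using fw(2) by (simp add: f'_def)
  then have "f (k (finv k y)) = k (finv k y)" for y using ops_invs[OF k] by (metis comp_apply id_apply)
  then show ?thesis using ops_invs[OF k] by (auto simp: fun_eq_iff)
qed

lemma centralizer_hom:
  assumes z: "z \<in> ops" "z \<noteq> id"
  obtains \<sigma> :: "('v vec \<Rightarrow> 'v vec) \<Rightarrow> int" where "\<sigma> z \<noteq> 0"
    "\<And>g k. g \<in> ops \<Longrightarrow> g \<circ> z = z \<circ> g \<Longrightarrow> k \<in> ops \<Longrightarrow> k \<circ> z = z \<circ> k \<Longrightarrow> \<sigma> (g \<circ> k) = \<sigma> g + \<sigma> k"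
proof -
  obtain k w where kw: "k \<in> ops" "conj_min w" "z = k \<circ> act w \<circ> finv k" using conj_min_exists[OF z(1)] .
  have "0 < length w" using conj_min_nonempty[OF z(2) kw(1,3)] by simp
  note sk = conj_skewers[OF kw this]
  have "w ! 0 \<in> D" using kw(2) nth_mem[OF \<open>0 < length w\<close>] by (auto simp: conj_min_def)
  then have Y: "(k \<circ> act (take 0 w)) ` H (w ! 0) \<in> halfspaces (fst (w ! 0))"
    using kw(1) by (intro halfspacesI) simp_all
  obtain e t where e: "tree.axis (fst (w ! 0)) z t e" "t > 0"
    by (rule tree.axis_exists[OF z(1) Y sk])
  show ?thesis
  proof (rule tree.axis_centralizer_hom[OF e])
    fix \<sigma> :: "('v vec \<Rightarrow> 'v vec) \<Rightarrow> int"
    assume "\<sigma> z = t" and add: "\<And>g k. g \<in> ops \<Longrightarrow> g \<circ> z = z \<circ> g \<Longrightarrow> k \<in> ops \<Longrightarrow>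
      k \<circ> z = z \<circ> k \<Longrightarrow> \<sigma> (g \<circ> k) = \<sigma> g + \<sigma> k"
    then have "\<sigma> z \<noteq> 0" using e(2) by simp
    then show ?thesis using add by (rule that)
  qed
qed

end

section \<open>Counting\<close>

text \<open>\<open>U\<close> injects into a product of at most \<open>m\<close> images. The
  alternative \<open>card U \<le> 1\<close> covers an empty \<open>B\<close>.\<close>

lemma pigeonhole_joint:
  assumes B: "finite B" "card B \<le> m" and U: "finite U"
    and joint: "\<And>u v. u \<in> U \<Longrightarrow> v \<in> U \<Longrightarrow> (\<And>b. b \<in> B \<Longrightarrow> F b u = F b v) \<Longrightarrow> u = v"
  shows "card U \<le> 1 \<or> (\<exists>b\<in>B. card U \<le> card (F b ` U) ^ m)"
proof (cases "B = {} \<or> U = {}")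
  case True
  then have "\<forall>u\<in>U. \<forall>v\<in>U. u = v" using joint by auto
  then show ?thesis using card_le_Suc0_iff_eq[OF U] by simp
next
  case False
  define c where "c = Max ((\<lambda>b. card (F b ` U)) ` B)"
  have "c \<in> (\<lambda>b. card (F b ` U)) ` B" unfolding c_def using B False by (intro Max_in) auto
  then obtain b where b: "b \<in> B" "c = card (F b ` U)" by blast
  have le: "card (F b ` U) \<le> c" if "b \<in> B" for b unfolding c_def using B that by (intro Max_ge) auto
  have "c > 0" using b U False by (simp add: card_gt_0_iff)
  have "inj_on (\<lambda>u. \<lambda>b\<in>B. F b u) U"
  proof (rule inj_onI)
    fix u v assume uv: "u \<in> U" "v \<in> U" "(\<lambda>b\<in>B. F b u) = (\<lambda>b\<in>B. F b v)"
    have "F b u = F b v" if "b \<in> B" for b using fun_cong[OF uv(3), of b] that by simp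
    then show "u = v" using joint uv by blast
  qed
  then have "card U = card ((\<lambda>u. \<lambda>b\<in>B. F b u) ` U)" by (simp add: card_image)
  also have "\<dots> \<le> card (\<Pi>\<^sub>E b\<in>B. F b ` U)" using B U by (intro card_mono finite_PiE) auto
  also have "\<dots> = (\<Prod>b\<in>B. card (F b ` U))" using B by (simp add: card_PiE)
  also have "\<dots> \<le> (\<Prod>b\<in>B. c)" using le by (intro prod_mono) auto
  also have "\<dots> \<le> c ^ m" using B \<open>c > 0\<close> by (simp add: power_increasing)
  finally show ?thesis using b by auto
qed

lemma inj_representatives:
  assumes "S \<subseteq> f ` A" obtains R where "R \<subseteq> A" "inj_on f R" "S = f ` R"
  using iffD1[OF subset_image_inj assms] by (elim exE conjE)

lemma card_le_two_fibers:
  assumes "finite U" "\<And>y. card {u \<in> U. \<kappa> u = y} \<le> 2"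
  shows "card U \<le> 2 * card (\<kappa> ` U)"
proof -
  have "card U = card (\<Union>y\<in>\<kappa> ` U. {u \<in> U. \<kappa> u = y})" by (rule arg_cong[of _ _ card]) auto
  also have "\<dots> \<le> (\<Sum>y\<in>\<kappa> ` U. card {u \<in> U. \<kappa> u = y})" using assms(1) by (intro card_UN_le) simp
  also have "\<dots> \<le> (\<Sum>y\<in>\<kappa> ` U. 2)" using assms(2) by (intro sum_mono)
  finally show ?thesis by (simp add: mult.commute)
qed

context tree_action
begin

text \<open>The axis without its orientation.\<close>

definition axis_class :: "(int \<Rightarrow> 'x set) \<Rightarrow> 'x set set set" where
  "axis_class e = {range e, (\<lambda>K. \<Omega> - K) ` range e}"

lemma range_eq_of_match:
  assumes "line e" "line f" "\<And>i. e i \<in> range f" shows "range e = range f"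
proof -
  obtain c where c: "\<And>i. e i = f (i + c)" using line_match[OF assms] by blast
  have "f i = e (i - c)" for i using c by simp
  then show ?thesis using assms(3) by (metis image_subsetI rangeI subset_antisym)
qed

lemma same_axis_class:
  assumes e: "line e" and f: "line f" and "same_axis e f"
  shows "axis_class e = axis_class f"
  using assms(3) unfolding same_axis_def
proof
  assume "\<forall>i. e i \<in> range f"
  then show ?thesis using range_eq_of_match[OF e f] by (simp add: axis_class_def)
next
  assume "\<forall>i. \<Omega> - e i \<in> range f"
  then have "range (\<lambda>i. \<Omega> - e (- i)) = range f" using range_eq_of_match[OF line_rev[OF e] f] by blast
  moreover have "range (\<lambda>i. \<Omega> - e (- i)) = (\<lambda>K. \<Omega> - K) ` range e"
    by (auto simp: image_iff) (metis minus_minus)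
  ultimately have *: "(\<lambda>K. \<Omega> - K) ` range e = range f" by simp
  have "(\<lambda>K. \<Omega> - K) ` range f = (\<lambda>K. \<Omega> - (\<Omega> - K)) ` range e" by (simp only: *[symmetric] image_image)
  also have "\<dots> = (\<lambda>K. K) ` range e"
    by (rule image_cong) (use Hs_sub line_Hs[OF e] in auto)
  finally show ?thesis using * by (simp add: axis_class_def insert_commute)
qed

lemma same_axis_transport:
  assumes "u \<in> G" "same_axis e (\<lambda>i. (finv u \<circ> v) ` e i)"
  shows "same_axis (\<lambda>i. u ` e i) (\<lambda>i. v ` e i)"
proof -
  have v: "u ` (finv u \<circ> v) ` K = v ` K" for K using G_inv_image(2)[OF assms(1)] by (metis image_comp)
  have "u ` K \<in> range (\<lambda>i. v ` e i)" if "K \<in> range (\<lambda>i. (finv u \<circ> v) ` e i)" for K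
    using that v by auto
  then show ?thesis
    using assms(2) unfolding same_axis_def G_compl[OF assms(1), symmetric] by blast
qed

lemma axis_class_fiber:
  assumes "finite U" "inj_on (\<lambda>u. range (\<lambda>i. u ` e i)) U"
  shows "card {u \<in> U. axis_class (\<lambda>i. u ` e i) = y} \<le> 2"
proof (cases "{u \<in> U. axis_class (\<lambda>i. u ` e i) = y} = {}")
  case False
  let ?A = "{u \<in> U. axis_class (\<lambda>i. u ` e i) = y}" and ?F = "\<lambda>u. range (\<lambda>i. u ` e i)"
  have y: "finite y" "card y \<le> 2" using False by (auto simp: axis_class_def card_insert_le_m1)
  have "?F ` ?A \<subseteq> y" by (auto simp: axis_class_def)
  moreover have "inj_on ?F ?A" using assms(2) by (rule inj_on_subset) blast
  ultimately have "card ?A \<le> card y" using y(1) by (intro card_inj_on_le)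
  then show ?thesis using y(2) by simp
next
  case True
  then show ?thesis by (simp only: card.empty zero_le)
qed

end

context raag_graph
begin

text \<open>Commuting with \<open>g\<close> is a linear condition on the matrix of \<open>u\<close>,
  so it passes from a spanning subfamily to all of \<open>U\<close>.\<close>

lemma centralizer_basis:
  assumes U: "U \<subseteq> ops"
  obtains B where "B \<subseteq> U" "finite B" "card B \<le> card D * card D"
    "\<And>g u. g \<in> ops \<Longrightarrow> (\<And>b. b \<in> B \<Longrightarrow> g \<circ> b = b \<circ> g) \<Longrightarrow> u \<in> U \<Longrightarrow> g \<circ> u = u \<circ> g"
proof -
  \<comment> \<open>The matrix of \<open>u\<close>, stored through its values; it is set to zero
    outside \<open>D\<close> so that the matrix units \<open>M d1 d2\<close> span.\<close>
  define \<Phi> :: "('v vec \<Rightarrow> 'v vec) \<Rightarrow> 'v vec \<times> 'v \<times> bool \<Rightarrow> real"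
    where "\<Phi> u = (\<lambda>(x, d). if d \<in> D then u x d else 0)" for u
  define M :: "'v \<times> bool \<Rightarrow> 'v \<times> bool \<Rightarrow> 'v vec \<times> 'v \<times> bool \<Rightarrow> real"
    where "M d1 d2 = (\<lambda>(x, d). if d = d1 then x d2 else 0)" for d1 d2
  define T where "T = (\<lambda>(d1, d2). M d1 d2) ` (D \<times> D)"
  have T: "finite T" "card T \<le> card D * card D"
    unfolding T_def using finD card_image_le[of "D \<times> D"] by (auto simp: card_cartesian_product)
  have span: "\<Phi> u \<in> fun_space.span T" if u: "u \<in> U" for u
  proof -
    have "u \<in> ops" using u U by blast
    then obtain c where c: "\<And>d x. d \<in> D \<Longrightarrow> u x d = (\<Sum>e\<in>D. c d e * x e)"
      using ops_linear[of u] by metis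
    have "\<Phi> u = (\<Sum>d1\<in>D. \<Sum>d2\<in>D. (\<lambda>p. c d1 d2 * M d1 d2 p))"
    proof (rule ext, clarify)
      fix x :: "'v vec" and d1 :: 'v and d2 :: bool
      let ?d = "(d1, d2)"
      have "(\<Sum>d1\<in>D. \<Sum>d2\<in>D. (\<lambda>p. c d1 d2 * M d1 d2 p)) (x, ?d)
          = (\<Sum>d1\<in>D. if ?d = d1 then (\<Sum>d2\<in>D. c d1 d2 * x d2) else 0)"
        unfolding sum_real_fun_apply by (rule sum.cong) (auto simp: M_def)
      also have "\<dots> = \<Phi> u (x, ?d)" using finD c[of ?d x] by (auto simp: \<Phi>_def)
      finally show "\<Phi> u (x, ?d) = (\<Sum>d1\<in>D. \<Sum>d2\<in>D. (\<lambda>p. c d1 d2 * M d1 d2 p)) (x, ?d)" by simp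
    qed
    also have "\<dots> \<in> fun_space.span T"
      by (intro fun_space.span_sum fun_space.span_scale fun_space.span_base) (auto simp: T_def)
    finally show ?thesis .
  qed
  obtain B where B: "B \<subseteq> U" "finite B" "card B \<le> card T" "\<And>u. u \<in> U \<Longrightarrow> \<Phi> u \<in> fun_space.span (\<Phi> ` B)"
  proof (rule finite_spanning_subfamily[OF T(1), of U \<Phi>])
    show "\<Phi> u \<in> fun_space.span T" if "u \<in> U" for u using span that .
  qed blast
  show ?thesis
  proof (rule that[OF B(1,2)])
    show "card B \<le> card D * card D" using B(3) T(2) by simp
    fix g u assume g: "g \<in> ops" "\<And>b. b \<in> B \<Longrightarrow> g \<circ> b = b \<circ> g" and u: "u \<in> U"
    obtain c where c: "\<And>d x. d \<in> D \<Longrightarrow> g x d = (\<Sum>e\<in>D. c d e * x e)"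
      using ops_linear[OF g(1)] by metis
    \<comment> \<open>Commutation is tested at \<open>p0\<close> only, which is enough by
      \<open>ops_eqI\<close>.\<close>
    let ?P = "{m. \<forall>d\<in>D. m (g p0, d) = (\<Sum>e\<in>D. c d e * m (p0, e))}"
    have P: "\<Phi> u \<in> ?P \<longleftrightarrow> (\<forall>d\<in>D. u (g p0) d = g (u p0) d)" for u
      using c by (auto simp: \<Phi>_def)
    have "fun_space.subspace ?P"
      by (auto simp: fun_space.subspace_def algebra_simps sum.distrib sum_distrib_left)
    moreover have "\<Phi> ` B \<subseteq> ?P"
    proof (rule image_subsetI)
      fix b assume "b \<in> B"
      then have "g (b p0) = b (g p0)" using g(2) by (metis comp_apply)
      then show "\<Phi> b \<in> ?P" using P[of b] by simp
    qed
    ultimately have "\<Phi> u \<in> ?P" using B(4)[OF u] fun_space.span_minimal by blast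
    then show "g \<circ> u = u \<circ> g" using P[of u] g(1) u U by (intro ops_eqI) auto
  qed
qed

lemma conj_eq_commute:
  assumes "u \<in> ops" "v \<in> ops" "u \<circ> b \<circ> finv u = v \<circ> b \<circ> finv v"
  shows "(finv u \<circ> v) \<circ> b = b \<circ> (finv u \<circ> v)"
proof (rule ext)
  fix x
  have "u (b (finv u (v x))) = v (b (finv v (v x)))" using assms(3) by (metis comp_apply)
  then have "finv u (u (b (finv u (v x)))) = finv u (v (b x))" using ops_invs[OF assms(2)] by simp
  then show "((finv u \<circ> v) \<circ> b) x = (b \<circ> (finv u \<circ> v)) x" using ops_invs[OF assms(1)] by simp
qed

text \<open>If \<open>u\<close> and \<open>v\<close> conjugate every element of a centralizer basis
  alike, \<open>finv u \<circ> v\<close> centralizes \<open>U\<close>, which \<open>cent\<close>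
  permits only for \<open>u = v\<close>.\<close>

lemma conj_many:
  assumes U: "finite U" "U \<subseteq> ops"
    and cent: "\<And>u v. u \<in> U \<Longrightarrow> v \<in> U \<Longrightarrow> u \<noteq> v \<Longrightarrow> \<exists>x\<in>U. (finv u \<circ> v) \<circ> x \<noteq> x \<circ> (finv u \<circ> v)"
  shows "card U \<le> 1 \<or> (\<exists>h\<in>U. card U \<le> card ((\<lambda>u. u \<circ> h \<circ> finv u) ` U) ^ (card D * card D))"
proof -
  obtain B where B: "B \<subseteq> U" "finite B" "card B \<le> card D * card D"
    "\<And>g u. g \<in> ops \<Longrightarrow> (\<And>b. b \<in> B \<Longrightarrow> g \<circ> b = b \<circ> g) \<Longrightarrow> u \<in> U \<Longrightarrow> g \<circ> u = u \<circ> g"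
    using centralizer_basis[OF U(2)] by blast
  have "card U \<le> 1 \<or> (\<exists>h\<in>B. card U \<le> card ((\<lambda>u. u \<circ> h \<circ> finv u) ` U) ^ (card D * card D))"
  proof (rule pigeonhole_joint[OF B(2,3) U(1)])
    fix u v assume uv: "u \<in> U" "v \<in> U" "\<And>b. b \<in> B \<Longrightarrow> u \<circ> b \<circ> finv u = v \<circ> b \<circ> finv v"
    then have ops: "u \<in> ops" "v \<in> ops" using U by auto
    have "(finv u \<circ> v) \<circ> x = x \<circ> (finv u \<circ> v)" if "x \<in> U" for x
      using B(4)[of "finv u \<circ> v" x] conj_eq_commute[OF ops uv(3)] ops that by simp
    then show "u = v" using cent uv by blast
  qed
  then show ?thesis using B(1) by blast
qed

text \<open>At most \<open>card D\<close> skewered walls have roots spanning those of all walls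
  along \<open>w\<close>. If \<open>u\<close> and \<open>v\<close> carry their axes to the same
  lines, \<open>finv u \<circ> v\<close> and \<open>h\<close> both shift each axis, so their
  commutator fixes these walls, then all of them, and is trivial by \<open>rigid\<close>.\<close>

lemma axes_separate:
  assumes h: "h \<in> ops" "h \<noteq> id" and C: "finite C" "C \<subseteq> ops" "inj_on (\<lambda>u. u \<circ> h \<circ> finv u) C"
  shows "card C \<le> 1 \<or> (\<exists>v e t. tree.axis v h t e \<and> t > 0 \<and>
    card C \<le> card ((\<lambda>u. range (\<lambda>i. u ` e i)) ` C) ^ card D)"
proof -
  obtain k w where kw: "k \<in> ops" "conj_min w" "h = k \<circ> act w \<circ> finv k" using conj_min_exists[OF h(1)] .
  have wD: "w \<in> lists D" using kw(2) by (simp add: conj_min_def)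
  define K where "K i = (k \<circ> act (take i w)) ` H (w ! i)" for i
  have wi: "w ! i \<in> D" "k \<circ> act (take i w) \<in> ops" if "i < length w" for i
  proof -
    show "w ! i \<in> D" using wD nth_mem[OF that] by auto
    have "take i w \<in> lists D" using wD by (auto dest: in_set_takeD)
    then show "k \<circ> act (take i w) \<in> ops" using kw(1) by simp
  qed
  define \<Phi> where "\<Phi> i = wall_fun (k \<circ> act (take i w)) (w ! i)" for i
  obtain B where B: "B \<subseteq> {..<length w}" "finite B" "card B \<le> card coord_funs"
    "\<And>i. i \<in> {..<length w} \<Longrightarrow> \<Phi> i \<in> fun_space.span (\<Phi> ` B)"
  proof (rule finite_spanning_subfamily[OF coord_funs(1), of "{..<length w}" \<Phi>])
    show "\<Phi> i \<in> fun_space.span coord_funs" if "i \<in> {..<length w}" for i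
      using wall_fun_span wi that by (simp add: \<Phi>_def)
  qed blast
  have "\<exists>e t. tree.axis (fst (w ! i)) h t e \<and> t > 0 \<and> e 0 = K i" if "i \<in> B" for i
  proof -
    have i: "i < length w" using that B by auto
    have "K i \<in> halfspaces (fst (w ! i))" unfolding K_def using wi[OF i] by (intro halfspacesI) auto
    moreover have "h ` K i \<subset> K i" unfolding K_def by (rule conj_skewers[OF kw i])
    ultimately obtain e t where "tree.axis (fst (w ! i)) h t e" "t > 0" "e 0 = K i"
      by (rule tree.axis_exists[OF h(1)])
    then show ?thesis by blast
  qed
  then have "\<forall>i\<in>B. \<exists>et. tree.axis (fst (w ! i)) h (snd et) (fst et) \<and> snd et > 0 \<and> fst et 0 = K i"
    by simp
  from bchoice[OF this] obtain et where et: "\<forall>i\<in>B.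
      tree.axis (fst (w ! i)) h (snd (et i)) (fst (et i)) \<and> snd (et i) > 0 \<and> fst (et i) 0 = K i"
    by blast
  define e t where "e = (\<lambda>i. fst (et i))" and "t = (\<lambda>i. snd (et i))"
  have et: "\<And>i. i \<in> B \<Longrightarrow> tree.axis (fst (w ! i)) h (t i) (e i) \<and> t i > 0 \<and> e i 0 = K i"
    using et by (simp add: e_def t_def)
  have "card C \<le> 1 \<or> (\<exists>i\<in>B. card C \<le> card ((\<lambda>u. range (\<lambda>j. u ` e i j)) ` C) ^ card D)"
  proof (rule pigeonhole_joint[OF B(2) _ C(1)])
    show "card B \<le> card D" using B(3) coord_funs(2) by simp
    fix u v assume uv: "u \<in> C" "v \<in> C" "\<And>i. i \<in> B \<Longrightarrow> range (\<lambda>j. u ` e i j) = range (\<lambda>j. v ` e i j)"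
    then have ops: "u \<in> ops" "v \<in> ops" using C by auto
    define x where "x = finv u \<circ> v"
    have x: "x \<in> ops" using ops by (simp add: x_def)
    define f where "f = finv h \<circ> (x \<circ> h \<circ> finv x)"
    have fG: "f \<in> ops" using x h by (simp add: f_def)
    have fB: "f ` K i = K i" if i: "i \<in> B" for i
    proof -
      have a: "tree.line (fst (w ! i)) (e i)" "\<And>j. h ` e i j = e i (j + t i)" "e i 0 = K i"
        using et[OF i] by (auto simp: tree.axis_def)
      have "x ` e i j \<in> range (e i)" for j
      proof -
        have "v ` e i j \<in> range (\<lambda>j. u ` e i j)" unfolding uv(3)[OF i] by (rule rangeI)
        then obtain j' where "v ` e i j = u ` e i j'" by (rule imageE)
        then have "x ` e i j = e i j'"
          unfolding x_def using ops_inv_image(1)[OF ops(1)] by (metis image_comp)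
        then show ?thesis by blast
      qed
      then obtain c where c: "\<And>j. x ` e i j = e i (j + c)"
        using tree.line_match[OF tree.line_image[OF a(1) x] a(1)] by blast
      have xi: "finv x ` e i j = e i (j - c)" for j
        using c[of "j - c"] ops_inv_image(1)[OF x, of "e i (j - c)"] by simp
      have hi: "finv h ` e i j = e i (j - t i)" for j
        using a(2)[of "j - t i"] ops_inv_image(1)[OF h(1), of "e i (j - t i)"] by simp
      have "f ` e i 0 = finv h ` x ` h ` finv x ` e i 0" by (simp add: f_def image_comp o_assoc)
      also have "\<dots> = e i 0" by (simp add: xi hi c a(2))
      finally show ?thesis using a(3) by simp
    qed
    have stab: "f ` K i = K i \<longleftrightarrow> \<Phi> i \<in> {\<psi>. \<forall>x. \<psi> (f x) = \<psi> x}" if "i < length w" for i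
      unfolding K_def \<Phi>_def using halfspace_stab[OF fG wi(2,1)] that by simp
    have "fun_space.span (\<Phi> ` B) \<subseteq> {\<psi>. \<forall>x. \<psi> (f x) = \<psi> x}"
    proof (intro fun_space.span_minimal invariant_subspace image_subsetI)
      fix i assume "i \<in> B"
      then show "\<Phi> i \<in> {\<psi>. \<forall>x. \<psi> (f x) = \<psi> x}" using fB stab[of i] B(1) by blast
    qed
    then have "f ` K i = K i" if "i < length w" for i using stab[OF that] B(4)[of i] that by auto
    then have "f = id" using rigid[OF kw(1) wD kw(3) x f_def] by (simp add: K_def)
    then have "finv h (x (h (finv x y))) = y" for y by (metis f_def comp_apply id_apply)
    then have hx: "x (h (finv x y)) = h y" for y using ops_invs(2)[OF h(1)] by metis
    have "v (h (finv v y)) = u (h (finv u y))" for y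
      using hx[of "finv u y"] ops by (simp add: x_def ops_inv_comp ops_invs) (metis ops_invs(2))
    then have "u \<circ> h \<circ> finv u = v \<circ> h \<circ> finv v" by (simp add: fun_eq_iff)
    then show "u = v" using C(3) uv by (simp add: inj_on_def)
  qed
  then show ?thesis using et by blast
qed

text \<open>Chosen so that \<open>4 * (int (card D) * t + 2) < int power_bound * t\<close> for every
  \<open>t \<ge> 1\<close>.\<close>

definition power_bound :: nat where "power_bound = 4 * card D + 9"

text \<open>\<open>C\<close> picks one element per conjugate of \<open>h\<close>, \<open>C2\<close>
  one per oriented translate of the axis, \<open>C3\<close> one per unoriented translate other than
  the axis itself. The passages to \<open>C\<close> and \<open>C2\<close> take roots of order
  \<open>card D * card D\<close> and \<open>card D\<close>, whence \<open>L\<close>; the others lose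
  bounded factors.\<close>

lemma free_semigroup:
  assumes U: "finite U" "U \<subseteq> ops" "\<And>u. u \<in> U \<Longrightarrow> finv u \<in> U"
    and cent: "\<And>u v. u \<in> U \<Longrightarrow> v \<in> U \<Longrightarrow> u \<noteq> v \<Longrightarrow> \<exists>x\<in>U. (finv u \<circ> v) \<circ> x \<noteq> x \<circ> (finv u \<circ> v)"
    and L: "L = card D * (card D * card D)"
  shows "card U \<le> 8 ^ L \<or> (\<exists>s M. 2 \<le> s \<and> card U \<le> s ^ (4 * L) \<and> 1 \<le> M \<and> M \<le> 2 * power_bound + 3 \<and>
    (\<forall>j. s ^ j \<le> card (word_set U (M * j))))"
proof -
  have one: "(1::nat) \<le> 8 ^ L" by simp
  from conj_many[OF U(1,2) cent] consider "card U \<le> 1"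
    | h where "h \<in> U" "card U \<le> card ((\<lambda>u. u \<circ> h \<circ> finv u) ` U) ^ (card D * card D)" by blast
  then show ?thesis
  proof cases
    case 1
    then show ?thesis using one by linarith
  next
    case 2
    define c where "c = card ((\<lambda>u. u \<circ> h \<circ> finv u) ` U)"
    obtain C where C: "C \<subseteq> U" "inj_on (\<lambda>u. u \<circ> h \<circ> finv u) C" "(\<lambda>u. u \<circ> h \<circ> finv u) ` U = (\<lambda>u. u \<circ> h \<circ> finv u) ` C"
      by (rule inj_representatives[OF order_refl])
    have cC: "card C = c" unfolding c_def C(3) using C(2) by (simp add: card_image)
    have fC: "finite C" "C \<subseteq> ops" using C U finite_subset by auto
    have hops: "h \<in> ops" using 2 U by blast
    show ?thesis
    proof (cases "c \<le> 1")
      case True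
      then have "c ^ (card D * card D) \<le> 1" using power_mono[of c 1 "card D * card D"] by simp
      then show ?thesis using 2(2) one unfolding c_def by linarith
    next
      case False
      have hid: "h \<noteq> id"
      proof
        assume "h = id"
        then have "(\<lambda>u. u \<circ> h \<circ> finv u) ` U \<subseteq> {id}" using U ops_invs(4) by auto
        then have "c \<le> card {id :: 'v vec \<Rightarrow> 'v vec}" unfolding c_def by (intro card_mono) auto
        then show False using False by simp
      qed
      obtain v e t where e: "tree.axis v h t e" and t: "t > 0"
        and cF: "card C \<le> card ((\<lambda>u. range (\<lambda>i. u ` e i)) ` C) ^ card D"
        using axes_separate[OF hops hid fC C(2)] cC False by auto
      have le: "tree.line v e" and sh: "\<And>i. h ` e i = e (i + t)" using e by (auto simp: tree.axis_def)
      let ?F = "\<lambda>u. range (\<lambda>i. u ` e i)" and ?\<kappa> = "\<lambda>u. tree.axis_class (\<lambda>i. u ` e i)"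
      obtain C2 where C2: "C2 \<subseteq> C" "inj_on ?F C2" "?F ` C = ?F ` C2"
        by (rule inj_representatives[OF order_refl])
      have fC2: "finite C2" using C2(1) fC(1) finite_subset by blast
      have cardF: "card (?F ` C) = card C2" unfolding C2(3) using C2(2) by (simp add: card_image)
      have two: "card C2 \<le> 2 * card (?\<kappa> ` C2)"
        using tree.axis_class_fiber[OF fC2 C2(2)] by (intro card_le_two_fibers[OF fC2])
      obtain C3 where C3: "C3 \<subseteq> C2" "inj_on ?\<kappa> C3" "?\<kappa> ` C2 - {tree.axis_class e} = ?\<kappa> ` C3"
        by (rule inj_representatives[OF Diff_subset])
      have "card (?\<kappa> ` C2) - 1 \<le> card (?\<kappa> ` C3)"
        unfolding C3(3)[symmetric] using card_Diff1_le fC2 by (metis card_Diff_singleton_if diff_le_self le_refl)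
      then have card3: "card (?\<kappa> ` C2) - 1 \<le> card C3" using C3(2) by (simp add: card_image)
      have L_eq: "(a ^ card D) ^ (card D * card D) = a ^ L" for a :: nat by (simp add: L power_mult)
      have "card U \<le> (card C2 ^ card D) ^ (card D * card D)"
        using 2(2) cC cF cardF power_mono[of c "card C2 ^ card D" "card D * card D"] by (simp add: c_def)
      then have UC2: "card U \<le> card C2 ^ L" using L_eq by simp
      \<comment> \<open>At most four classes give \<open>card C2 \<le> 8\<close>, the source of
        \<open>8 ^ L\<close>. Five or more leave four elements in \<open>C3\<close> and two in
        \<open>T\<close>.\<close>
      show ?thesis
      proof (cases "card (?\<kappa> ` C2) \<le> 4")
        case True
        then have "card C2 \<le> 8" using two by linarith
        then have "card C2 ^ L \<le> 8 ^ L" by (intro power_mono) auto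
        then show ?thesis using UC2 by linarith
      next
        case False
        have C3ne: "C3 \<noteq> {}" "finite C3" using False card3 C3(1) fC2 finite_subset by auto
        have C3U: "C3 \<subseteq> U" "C3 \<subseteq> ops" using C3(1) C2(1) C(1) U(2) by auto
        have line_u: "tree.line v (\<lambda>i. u ` e i)" if "u \<in> ops" for u using tree.line_image[OF le that] .
        define N where "N = power_bound"
        have "\<exists>T m w k. T \<subseteq> (\<lambda>u. u \<circ> (h ^^ N \<circ> w \<circ> h ^^ k)) ` C3 \<and> w \<in> word_set U m \<and> m \<in> {1, 2} \<and>
          k \<in> {0, N} \<and> 2 * card T \<ge> card C3 \<and> (\<forall>j. card (word_set T j) = card T ^ j)"
        proof (rule ping_pong[where \<pi> = "tree.level e" and \<Omega> = orb and G = ops and p = p0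
              and t = t and D = "int (card D) * t + 2"])
          show "tree.level e (h x) = tree.level e x + t" if x: "x \<in> orb" for x
          proof (rule tree.level_eqI[OF le ops_orb[OF hops x]])
            fix i
            have "h x \<in> e i \<longleftrightarrow> h x \<in> h ` e (i - t)" using sh[of "i - t"] by simp
            also have "\<dots> \<longleftrightarrow> x \<in> e (i - t)"
              using ops_bij[OF hops] by (simp add: bij_is_inj inj_image_mem_iff)
            finally show "h x \<in> e i \<longleftrightarrow> i \<le> tree.level e x + t" using tree.level_iff[OF le x] by auto
          qed
          show "4 * (int (card D) * t + 2) < int N * t"
            using t by (simp add: N_def power_bound_def algebra_simps)
          show "\<exists>q q'. \<forall>x\<in>orb. \<bar>tree.level e x - q'\<bar> > int (card D) * t + 2 \<longrightarrow>
              \<bar>tree.level e (u x) - q\<bar> \<le> int (card D) * t + 2" if u: "u \<in> C3" for u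
          proof -
            have uo: "u \<in> ops" using u C3U by blast
            have "?\<kappa> u \<in> ?\<kappa> ` C2 - {tree.axis_class e}" unfolding C3(3) using u by (rule imageI)
            then have "?\<kappa> u \<noteq> tree.axis_class e" by blast
            then have ns: "\<not> tree.same_axis e (\<lambda>i. u ` e i)"
              by (rule contrapos_nn) (rule tree.same_axis_class[OF le line_u[OF uo], THEN HOL.sym])
            show ?thesis by (rule tree.axis_dichotomy[OF e t uo ns]) blast
          qed
          show "\<exists>q q'. \<forall>x\<in>orb. \<bar>tree.level e x - q'\<bar> > int (card D) * t + 2 \<longrightarrow>
              \<bar>tree.level e ((finv u \<circ> v) x) - q\<bar> \<le> int (card D) * t + 2"
            if uv: "u \<in> C3" "v \<in> C3" "u \<noteq> v" for u v
          proof -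
            have ops: "u \<in> ops" "v \<in> ops" using uv C3U by auto
            have "?\<kappa> u \<noteq> ?\<kappa> v" using uv C3(2) by (meson inj_on_def)
            then have "\<not> tree.same_axis (\<lambda>i. u ` e i) (\<lambda>i. v ` e i)"
              by (rule contrapos_nn) (rule tree.same_axis_class[OF line_u[OF ops(1)] line_u[OF ops(2)]])
            then have ns: "\<not> tree.same_axis e (\<lambda>i. (finv u \<circ> v) ` e i)"
              by (rule contrapos_nn) (rule tree.same_axis_transport[OF ops(1)])
            have "finv u \<circ> v \<in> ops" using ops by simp
            then show ?thesis by (rule tree.axis_dichotomy[OF e t _ ns]) blast
          qed
        qed (use C3ne C3U hops t U ops_bij in auto)
        then obtain T m w k where T: "T \<subseteq> (\<lambda>u. u \<circ> (h ^^ N \<circ> w \<circ> h ^^ k)) ` C3" "w \<in> word_set U m" "m \<in> {1, 2}"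
          "k \<in> {0, N}" "2 * card T \<ge> card C3" "\<And>j. card (word_set T j) = card T ^ j" by blast
        define M where "M = 1 + (N + m + k)"
        have pw: "h ^^ i \<in> word_set U i" for i
          using word_set_pow[OF word_set_single[OF 2(1)], of i] by simp
        have "T \<subseteq> word_set U M"
        proof
          fix s assume "s \<in> T"
          then obtain u where u: "u \<in> U" "s = u \<circ> (h ^^ N \<circ> w \<circ> h ^^ k)" using T(1) C3U by blast
          show "s \<in> word_set U M"
            unfolding u(2) M_def by (intro word_set_add word_set_single u(1) pw T(2))
        qed
        then have growth: "card T ^ j \<le> card (word_set U (M * j))" for j
          unfolding T(6)[symmetric] using word_set_mult[of T U M j] finite_word_set[OF U(1)] by (intro card_mono) 
        moreover have s2: "2 \<le> card T" using T(5) card3 False by linarith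
        moreover have "card U \<le> card T ^ (4 * L)"
        proof -
          \<comment> \<open>\<open>card C2 \<le> 2 * (2 * card T + 1)\<close>, and
            \<open>8 \<le> card T ^ 3\<close>.\<close>
          have "card C2 \<le> 8 * card T" using two card3 T(5) s2 by linarith
          also have "\<dots> \<le> card T ^ 3 * card T" using power_mono[OF s2, of 3] by (intro mult_right_mono) simp_all
          also have "\<dots> = card T ^ 4" by (simp add: numeral_eq_Suc)
          finally have "card C2 ^ L \<le> (card T ^ 4) ^ L" by (intro power_mono) auto
          then show ?thesis using UC2 by (simp add: power_mult)
        qed
        moreover have "1 \<le> M" "M \<le> 2 * power_bound + 3" using T(3,4) by (auto simp: M_def N_def)
        ultimately show ?thesis by blast
      qed
    qed
  qed
qed

lemma word_set_mono:
  assumes U: "finite U" "U \<subseteq> ops" "U \<noteq> {}" and "i \<le> j"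
  shows "card (word_set U i) \<le> card (word_set U j)"
proof -
  obtain u where u: "u \<in> U" using U(3) by blast
  have "surj u" using u U ops_bij by (auto simp: bij_is_surj)
  then have "inj_on (\<lambda>x :: 'v vec \<Rightarrow> 'v vec. x \<circ> u) A" for A
    by (intro inj_onI ext) (metis comp_apply surjD)
  moreover have "(\<lambda>x. x \<circ> u) ` word_set U i \<subseteq> word_set U (Suc i)" for i using u by auto
  ultimately have "card (word_set U i) \<le> card (word_set U (Suc i))" for i
    using finite_word_set[OF U(1)] by (rule card_inj_on_le)
  then show ?thesis using lift_Suc_mono_le[of "\<lambda>i. card (word_set U i)"] \<open>i \<le> j\<close> by blast
qed

lemma ops_growth:
  "\<exists>\<alpha> \<beta> :: real. \<alpha> > 0 \<and> \<beta> > 0 \<and> (\<forall>U. finite U \<longrightarrow> U \<subseteq> ops \<longrightarrow> (\<forall>u\<in>U. finv u \<in> U) \<longrightarrow>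
    (\<forall>u\<in>U. \<forall>v\<in>U. u \<noteq> v \<longrightarrow> (\<exists>x\<in>U. (finv u \<circ> v) \<circ> x \<noteq> x \<circ> (finv u \<circ> v))) \<longrightarrow>
    (\<forall>j. real (card (word_set U j)) \<ge> (\<alpha> * real (card U)) powr (\<beta> * real j)))"
proof -
  define L where "L = card D * (card D * card D)"
  \<comment> \<open>\<open>\<alpha>\<close> trivializes the claim for
    \<open>card U \<le> 8 ^ L\<close>. In \<open>\<beta>\<close> the factor 2 pays for rounding
    \<open>j\<close> down to a multiple of \<open>M\<close>, and \<open>4 * L + 1\<close> avoids
    division by zero for the empty graph.\<close>
  define \<alpha> where "\<alpha> = 1 / (8::real) ^ L"
  define M0 where "M0 = 2 * power_bound + 3"
  define \<beta> where "\<beta> = 1 / (2 * real M0 * real (4 * L + 1))"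
  have M0: "real M0 > 0" by (simp add: M0_def)
  have pos: "\<alpha> > 0" "\<beta> > 0" "\<alpha> \<le> 1" by (auto simp: \<alpha>_def \<beta>_def M0_def)
  have main: "(\<alpha> * real (card U)) powr (\<beta> * real j) \<le> real (card (word_set U j))"
    if U: "finite U" "U \<subseteq> ops" "\<forall>u\<in>U. finv u \<in> U"
      "\<forall>u\<in>U. \<forall>v\<in>U. u \<noteq> v \<longrightarrow> (\<exists>x\<in>U. (finv u \<circ> v) \<circ> x \<noteq> x \<circ> (finv u \<circ> v))" for U j
  proof (cases "U = {}")
    case True
    \<comment> \<open>By convention \<open>0 powr y = 0\<close>, even for
      \<open>y = 0\<close>.\<close>
    then show ?thesis by simp
  next
    case False
    let ?b = "\<alpha> * real (card U)"
    have mono: "i \<le> k \<Longrightarrow> card (word_set U i) \<le> card (word_set U k)" for i k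
      using word_set_mono[OF U(1,2) False] .
    have ge1: "1 \<le> card (word_set U j)" for j using mono[of 0 j] by simp
    show ?thesis
    proof (cases "?b \<le> 1")
      case True
      then have "?b powr (\<beta> * real j) \<le> 1" using pos by (intro powr_le1) auto
      then show ?thesis using ge1[of j] by linarith
    next
      case b1: False
      have "\<not> card U \<le> 8 ^ L"
      proof
        assume "card U \<le> 8 ^ L"
        then have "real (card U) \<le> real (8 ^ L)" using of_nat_le_iff by blast
        then show False using b1 by (simp add: \<alpha>_def)
      qed
      then obtain s M where sM: "2 \<le> s" "card U \<le> s ^ (4 * L)" "1 \<le> M" "M \<le> M0"
        "\<And>j. s ^ j \<le> card (word_set U (M * j))"
        using free_semigroup[OF U(1,2), of L] U(3,4) L_def unfolding M0_def by blast
      have bU: "?b \<le> real (card U)" using pos by (simp add: mult_left_le_one_le)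
      define q where "q = j div M"
      show ?thesis
      proof (cases "q = 0")
        case True
        \<comment> \<open>Not even one block of length \<open>M\<close> fits, but
          \<open>\<beta> * real j \<le> 1\<close>, so for \<open>j > 0\<close> the bound
          \<open>card U\<close> suffices.\<close>
        then have "j < M" using sM(3) by (simp add: q_def div_eq_0_iff)
        show ?thesis
        proof (cases "j = 0")
          case True
          then show ?thesis using b1 by simp
        next
          case j0: False
          have "\<beta> * real j \<le> \<beta> * real M0"
            using \<open>j < M\<close> sM(4) pos by (intro mult_left_mono) auto
          also have "\<dots> = 1 / (2 * real (4 * L + 1))" using M0 by (simp add: \<beta>_def)
          also have "\<dots> \<le> 1" by simp
          finally have "?b powr (\<beta> * real j) \<le> ?b powr 1" using b1 by (intro powr_mono) auto
          then have "?b powr (\<beta> * real j) \<le> real (card U)" using bU b1 by simp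
          also have "word_set U 1 = U" by auto
          then have "card U \<le> card (word_set U j)" using mono[of 1 j] j0 by simp
          then have "real (card U) \<le> real (card (word_set U j))" by simp
          finally show ?thesis .
        qed
      next
        case False
        have "j < M * (q + 1)" unfolding q_def using sM(3) by (metis Suc_eq_plus1 dividend_less_times_div less_le_trans mult.commute mult_Suc_right zero_less_one)
        also have "\<dots> \<le> M0 * (2 * q)" using sM(4) False by (intro mult_mono) auto
        finally have "real j \<le> real (M0 * (2 * q))" by (simp only: of_nat_le_iff less_imp_le)
        then have j: "real j \<le> 2 * real M0 * real q" by simp
        have "\<beta> * real j \<le> \<beta> * (2 * real M0 * real q)" using j pos by (intro mult_left_mono) auto
        also have "\<dots> = real q / real (4 * L + 1)" using M0 by (simp add: \<beta>_def)
        finally have bj: "\<beta> * real j \<le> real q / real (4 * L + 1)" .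
        have "?b powr (\<beta> * real j) \<le> ?b powr (real q / real (4 * L + 1))" using b1 bj by (intro powr_mono) auto
        also have "?b \<le> real (s ^ (4 * L + 1))"
        proof -
          have "s ^ (4 * L) \<le> s ^ (4 * L + 1)" using sM(1) by (intro power_increasing) auto
          then have "card U \<le> s ^ (4 * L + 1)" using sM(2) by linarith
          then have "real (card U) \<le> real (s ^ (4 * L + 1))" using of_nat_le_iff by blast
          then show ?thesis using bU by linarith
        qed
        then have "?b powr (real q / real (4 * L + 1)) \<le> real (s ^ (4 * L + 1)) powr (real q / real (4 * L + 1))"
          using b1 by (intro powr_mono2) auto
        also have "\<dots> = (real s powr real (4 * L + 1)) powr (real q / real (4 * L + 1))"
          using sM(1) powr_realpow[of "real s" "4 * L + 1"] by simp
        also have "\<dots> = real s powr real q" unfolding powr_powr by simp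
        also have "\<dots> = real (s ^ q)" using sM(1) powr_realpow[of "real s" q] by simp
        also have "\<dots> \<le> real (card (word_set U (M * q)))" using sM(5)[of q] of_nat_le_iff by blast
        also have "\<dots> \<le> real (card (word_set U j))"
          using mono[of "M * q" j] by (simp add: q_def)
        finally show ?thesis .
      qed
    qed
  qed
  show ?thesis
    by (intro exI[of _ \<alpha>] exI[of _ \<beta>] conjI allI impI pos main)
qed

end

section \<open>Transfer to the group of words\<close>

text \<open>The quotient map kills only powers of \<open>z\<close>, and \<open>f\<close> is
  injective on these, so the pair of both maps is injective.\<close>

lemma central_hom_embeds:
  fixes G (structure) and f :: "'a \<Rightarrow> int"
  assumes G: "group G" and K: "subgroup K G" and z: "z \<in> K" "f z \<noteq> 0"
    and central: "\<And>x. x \<in> K \<Longrightarrow> x \<otimes> z = z \<otimes> x"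
    and f: "\<And>x y. x \<in> K \<Longrightarrow> y \<in> K \<Longrightarrow> f (x \<otimes> y) = f x + f y"
  shows "embeds_in_product_with_Z G K"
proof -
  define GK where "GK = G\<lparr>carrier := K\<rparr>"
  interpret GK: group GK unfolding GK_def using subgroup.subgroup_is_group[OF K G] .
  have GK: "carrier GK = K" "x \<otimes>\<^bsub>GK\<^esub> y = x \<otimes> y" for x y by (simp_all add: GK_def)
  have hom: "f \<in> hom GK integer_group" using f by (auto simp: hom_def GK)
  interpret f: group_hom GK integer_group f
    by (simp add: group_hom_def group_hom_axioms_def hom GK.group_axioms)
  have zK: "z \<in> carrier GK" using z by (simp add: GK)
  define N where "N = generate GK {z}"
  have N_pow: "N = {z [^]\<^bsub>GK\<^esub> (k :: int) | k. k \<in> UNIV}"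
    unfolding N_def using zK by (rule GK.generate_pow)
  have N_sub: "subgroup N GK" unfolding N_def using zK by (intro GK.generate_is_subgroup) simp
  have comm: "x \<otimes>\<^bsub>GK\<^esub> m = m \<otimes>\<^bsub>GK\<^esub> x" if x: "x \<in> carrier GK" and m: "m \<in> N" for x m
  proof -
    let ?C = "{m \<in> carrier GK. x \<otimes>\<^bsub>GK\<^esub> m = m \<otimes>\<^bsub>GK\<^esub> x}"
    have "subgroup ?C GK"
    proof (rule GK.subgroupI)
      show "?C \<noteq> {}" using x zK central by (auto simp: GK)
      fix a b assume ab: "a \<in> ?C" "b \<in> ?C"
      then have "a \<otimes>\<^bsub>GK\<^esub> (x \<otimes>\<^bsub>GK\<^esub> inv\<^bsub>GK\<^esub> a) = x"
        using x GK.m_assoc[of a x "inv\<^bsub>GK\<^esub> a"] GK.m_assoc[of x a "inv\<^bsub>GK\<^esub> a"] by auto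
      then show "inv\<^bsub>GK\<^esub> a \<in> ?C"
        using ab x GK.inv_solve_left[of "x \<otimes>\<^bsub>GK\<^esub> inv\<^bsub>GK\<^esub> a" a x] by simp
      have "x \<otimes>\<^bsub>GK\<^esub> (a \<otimes>\<^bsub>GK\<^esub> b) = (a \<otimes>\<^bsub>GK\<^esub> x) \<otimes>\<^bsub>GK\<^esub> b"
        using ab x GK.m_assoc[of x a b] by simp
      also have "\<dots> = a \<otimes>\<^bsub>GK\<^esub> (b \<otimes>\<^bsub>GK\<^esub> x)" using ab x GK.m_assoc[of a x b] by simp
      also have "\<dots> = (a \<otimes>\<^bsub>GK\<^esub> b) \<otimes>\<^bsub>GK\<^esub> x" using ab x GK.m_assoc[of a b x] by simp
      finally have "x \<otimes>\<^bsub>GK\<^esub> (a \<otimes>\<^bsub>GK\<^esub> b) = (a \<otimes>\<^bsub>GK\<^esub> b) \<otimes>\<^bsub>GK\<^esub> x" .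
      then show "a \<otimes>\<^bsub>GK\<^esub> b \<in> ?C" using ab by simp
    qed blast
    moreover have "{z} \<subseteq> ?C" using zK x central by (simp add: GK)
    ultimately have "N \<subseteq> ?C" unfolding N_def by (intro GK.generate_subgroup_incl)
    then show ?thesis using m by blast
  qed
  have "N \<lhd> GK"
  proof (rule GK.normalI[OF N_sub], rule ballI)
    show "N #>\<^bsub>GK\<^esub> x = x <#\<^bsub>GK\<^esub> N" if "x \<in> carrier GK" for x
      using comm[OF that] by (auto simp: r_coset_def l_coset_def)
  qed
  then interpret N: normal N GK .
  let ?Q = "GK Mod N"
  interpret Q: group ?Q by (rule N.factorgroup_is_group)
  \<comment> \<open>Cosets have type \<open>'a set\<close>, whereas \<open>H\<close> must have
    elements of type \<open>'a set set\<close>; singletons bridge the gap.\<close>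
  define wrap :: "'a set \<Rightarrow> 'a set set" where "wrap A = {A}" for A
  have inj: "inj_on wrap S" for S by (auto simp: inj_on_def wrap_def)
  define Q where "Q = image_group wrap ?Q"
  have Qg: "group Q" unfolding Q_def by (rule Q.inj_imp_image_group_is_group[OF inj])
  have wrap_hom: "wrap \<in> hom ?Q Q"
    using inj_imp_image_group_iso[OF inj, of ?Q] by (simp add: Q_def iso_def)
  define q where "q = wrap \<circ> (\<lambda>a. N #>\<^bsub>GK\<^esub> a)"
  have q_hom: "q \<in> hom GK Q" unfolding q_def by (rule hom_compose[OF N.r_coset_hom_Mod wrap_hom])
  interpret q: group_hom GK Q q
    by (simp add: group_hom_def group_hom_axioms_def q_hom Qg GK.group_axioms)
  have q_one: "q a = q \<one>\<^bsub>GK\<^esub> \<longleftrightarrow> a \<in> N" if "a \<in> carrier GK" for a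
    using that GK.coset_join1[OF _ that N_sub] GK.coset_join2[OF that N_sub]
      GK.coset_join2[OF GK.one_closed N_sub N.one_closed] by (auto simp: q_def wrap_def)
  define \<phi> where "\<phi> x = (q x, f x)" for x
  have \<phi>_hom: "\<phi> \<in> hom GK (Q \<times>\<times> integer_group)"
    using q_hom hom by (auto simp: hom_def \<phi>_def DirProd_def Pi_iff)
  interpret \<phi>: group_hom GK "Q \<times>\<times> integer_group" \<phi>
    by (simp add: group_hom_def group_hom_axioms_def \<phi>_hom GK.group_axioms DirProd_group Qg)
  have "a = \<one>\<^bsub>GK\<^esub>" if a: "a \<in> carrier GK" "\<phi> a = \<one>\<^bsub>Q \<times>\<times> integer_group\<^esub>" for a
  proof -
    have "q a = q \<one>\<^bsub>GK\<^esub>" "f a = 0" using a(2) q.hom_one by (simp_all add: \<phi>_def)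
    then obtain k :: int where k: "a = z [^]\<^bsub>GK\<^esub> k" using q_one[OF a(1)] N_pow by blast
    then have "k * f z = 0" using f.hom_int_pow[OF zK, of k] \<open>f a = 0\<close> by simp
    then show ?thesis using z(2) k by simp
  qed
  then have "kernel GK (Q \<times>\<times> integer_group) \<phi> = {\<one>\<^bsub>GK\<^esub>}"
    unfolding kernel_def using \<phi>.hom_one GK.one_closed by blast
  then have "inj_on \<phi> K" using \<phi>.inj_iff_trivial_ker by (simp add: GK(1))
  moreover have "\<not> inj_on (fst \<circ> \<phi>) K"
  proof
    assume inj: "inj_on (fst \<circ> \<phi>) K"
    have "z \<in> N" unfolding N_def by (rule generate.incl) simp
    then have "(fst \<circ> \<phi>) z = (fst \<circ> \<phi>) \<one>\<^bsub>GK\<^esub>" using q_one[OF zK] by (simp add: \<phi>_def)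
    then have "z = \<one>\<^bsub>GK\<^esub>" using inj zK GK.one_closed unfolding GK(1) by (simp add: inj_on_def)
    then show False using f.hom_one z(2) by simp
  qed
  ultimately show ?thesis
    unfolding embeds_in_product_with_Z_def using Qg \<phi>_hom by (auto simp: GK_def)
qed

context raag_graph
begin

abbreviation RG where "RG \<equiv> raag V E"

lemma raag_class_eq: "raag_eq V E u w \<Longrightarrow> raag_class V E u = raag_class V E w"
  unfolding raag_class_def using raag_eq.sym raag_eq.trans by blast

lemma raag_class_some: "raag_eq V E w (SOME a. a \<in> raag_class V E w)"
  using someI[of "\<lambda>a. a \<in> raag_class V E w" w] raag_eq.refl[of V E w] by (simp add: raag_class_def)

lemma raag_carrier: "carrier RG = raag_class V E ` lists D"
  by (simp add: raag_def D_def)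

lemma raag_mult: "raag_class V E u \<otimes>\<^bsub>RG\<^esub> raag_class V E w = raag_class V E (u @ w)"
proof -
  let ?a = "SOME a. a \<in> raag_class V E u" and ?b = "SOME b. b \<in> raag_class V E w"
  have "raag_eq V E (u @ w) (?a @ w)" using raag_eq_context[OF raag_class_some[of u], of "[]" w] by simp
  moreover have "raag_eq V E (?a @ w) (?a @ ?b)"
    using raag_eq_context[OF raag_class_some[of w], of ?a "[]"] by simp
  ultimately show ?thesis unfolding raag_def using raag_class_eq raag_eq.trans by fastforce
qed

definition op_of :: "('v \<times> bool) list set \<Rightarrow> 'v vec \<Rightarrow> 'v vec" where
  "op_of A = act (SOME a. a \<in> A)"

lemma op_of_class [simp]: "op_of (raag_class V E w) = act w"
  unfolding op_of_def using act_cong[OF raag_class_some] by simp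

lemma op_of_image: "op_of ` carrier RG = ops"
  by (simp add: raag_carrier ops_def image_image)

lemma op_of_mult: "x \<in> carrier RG \<Longrightarrow> y \<in> carrier RG \<Longrightarrow> op_of (x \<otimes>\<^bsub>RG\<^esub> y) = op_of x \<circ> op_of y"
  by (auto simp: raag_carrier raag_mult act_append)

lemma raag_one: "\<one>\<^bsub>RG\<^esub> = raag_class V E []"
  by (simp add: raag_def)

lemma op_of_inj: "inj_on op_of (carrier RG)"
proof (rule inj_onI)
  fix x y assume "x \<in> carrier RG" "y \<in> carrier RG" and eq: "op_of x = op_of y"
  then obtain u w where "x = raag_class V E u" "y = raag_class V E w" "u \<in> lists D" "w \<in> lists D"
    by (auto simp: raag_carrier)
  then show "x = y" using eq act_faithful[of u w] raag_class_eq by simp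
qed

lemma raag_group: "group RG"
proof (rule groupI)
  show "x \<otimes>\<^bsub>RG\<^esub> y \<in> carrier RG" if "x \<in> carrier RG" "y \<in> carrier RG" for x y
    using that by (auto simp: raag_carrier raag_mult intro!: imageI)
  show "\<one>\<^bsub>RG\<^esub> \<in> carrier RG" by (auto simp: raag_carrier raag_one)
  show "x \<otimes>\<^bsub>RG\<^esub> y \<otimes>\<^bsub>RG\<^esub> z = x \<otimes>\<^bsub>RG\<^esub> (y \<otimes>\<^bsub>RG\<^esub> z)"
    if "x \<in> carrier RG" "y \<in> carrier RG" "z \<in> carrier RG" for x y z
    using that by (auto simp: raag_carrier raag_mult intro!: imageI)
  show "\<one>\<^bsub>RG\<^esub> \<otimes>\<^bsub>RG\<^esub> x = x" if "x \<in> carrier RG" for x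
    using that by (auto simp: raag_carrier raag_one raag_mult)
  fix x assume "x \<in> carrier RG"
  then obtain w where w: "w \<in> lists D" "x = raag_class V E w" by (auto simp: raag_carrier)
  then have "raag_class V E (word_inv w) \<otimes>\<^bsub>RG\<^esub> x = \<one>\<^bsub>RG\<^esub>"
    using raag_class_eq[OF raag_eq_inv[OF w(1)]] by (simp add: raag_mult raag_one)
  then show "\<exists>y\<in>carrier RG. y \<otimes>\<^bsub>RG\<^esub> x = \<one>\<^bsub>RG\<^esub>" using w
    by (intro bexI[of _ "raag_class V E (word_inv w)"]) (auto simp: raag_carrier intro!: imageI)
qed

lemma op_of_one: "op_of \<one>\<^bsub>RG\<^esub> = id"
  by (simp add: raag_one)

lemma op_of_inv:
  assumes "x \<in> carrier RG" shows "op_of (inv\<^bsub>RG\<^esub> x) = finv (op_of x)"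
proof -
  interpret group RG by (rule raag_group)
  have "op_of (inv\<^bsub>RG\<^esub> x) \<circ> op_of x = id" "op_of x \<circ> op_of (inv\<^bsub>RG\<^esub> x) = id"
    using assms op_of_mult[symmetric] op_of_one by simp_all
  then show ?thesis by (intro inv_unique_comp[symmetric])
qed

lemma set_power_carrier: "U \<subseteq> carrier RG \<Longrightarrow> set_power RG U n \<subseteq> carrier RG"
proof (induction n)
  case (Suc n)
  interpret group RG by (rule raag_group)
  show ?case using Suc by auto
next
  case 0
  interpret group RG by (rule raag_group)
  show ?case by simp
qed

lemma op_of_set_power:
  assumes U: "U \<subseteq> carrier RG"
  shows "op_of ` set_power RG U n = word_set (op_of ` U) n"
proof (induction n)
  case (Suc n)
  have mult: "op_of (x \<otimes>\<^bsub>RG\<^esub> u) = op_of x \<circ> op_of u" if "x \<in> set_power RG U n" "u \<in> U" for x u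
    using that set_power_carrier[OF U] U by (intro op_of_mult) auto
  have "op_of ` set_power RG U (Suc n) = {op_of (x \<otimes>\<^bsub>RG\<^esub> u) | x u. x \<in> set_power RG U n \<and> u \<in> U}"
    unfolding set_power.simps by blast
  also have "\<dots> = {op_of x \<circ> op_of u | x u. x \<in> set_power RG U n \<and> u \<in> U}"
    using mult by (intro Collect_cong ex_cong1) (metis (no_types))
  also have "\<dots> = {x \<circ> u | x u. x \<in> op_of ` set_power RG U n \<and> u \<in> op_of ` U}" by blast
  finally show ?case unfolding Suc by simp
qed (simp add: op_of_one id_def)

lemma commuting_generate:
  assumes U: "U \<subseteq> carrier RG" and z: "z \<in> carrier RG" and comm: "\<And>u. u \<in> U \<Longrightarrow> op_of u \<circ> op_of z = op_of z \<circ> op_of u"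
    and x: "x \<in> generate RG U"
  shows "op_of x \<circ> op_of z = op_of z \<circ> op_of x"
  using x
proof (induction rule: generate.induct)
  case one
  then show ?case by (simp add: op_of_one)
next
  case (incl h)
  then show ?case using comm by simp
next
  case (inv h)
  have h: "h \<in> carrier RG" "op_of h \<in> ops" using inv U op_of_image by auto
  have "finv (op_of h) \<circ> (op_of h \<circ> op_of z) \<circ> finv (op_of h) = finv (op_of h) \<circ> (op_of z \<circ> op_of h) \<circ> finv (op_of h)"
    using comm[OF inv] by simp
  then have "op_of z \<circ> finv (op_of h) = finv (op_of h) \<circ> op_of z"
    using ops_invs(3,4)[OF h(2)] by (metis comp_assoc comp_id id_comp)
  then show ?case using op_of_inv[OF h(1)] by simp
next
  case (eng h1 h2)
  interpret group RG by (rule raag_group)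
  have "h1 \<in> carrier RG" "h2 \<in> carrier RG" using generate_in_carrier[OF U] eng by auto
  then have "op_of (h1 \<otimes>\<^bsub>RG\<^esub> h2) = op_of h1 \<circ> op_of h2" by (rule op_of_mult)
  then show ?case using eng.IH by (simp only: comp_assoc) (simp only: comp_assoc[symmetric])
qed

text \<open>The quotient of \<open>u\<close> and \<open>v\<close> lies in the generated subgroup and
  commutes with its generators, so it is a nontrivial central element.\<close>

lemma center_embeds:
  assumes U: "symmetric_subset RG U" and uv: "u \<in> U" "v \<in> U" "u \<noteq> v"
    and comm: "\<And>x. x \<in> U \<Longrightarrow> (finv (op_of u) \<circ> op_of v) \<circ> op_of x = op_of x \<circ> (finv (op_of u) \<circ> op_of v)"
  shows "embeds_in_product_with_Z RG (generate RG U)"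
proof -
  interpret group RG by (rule raag_group)
  have Uc: "U \<subseteq> carrier RG" using U by (simp add: symmetric_subset_def)
  let ?K = "generate RG U"
  have K: "subgroup ?K RG" using Uc by (rule generate_is_subgroup)
  define z where "z = inv\<^bsub>RG\<^esub> u \<otimes>\<^bsub>RG\<^esub> v"
  have zK: "z \<in> ?K" unfolding z_def using uv by (intro generate.eng generate.inv generate.incl)
  have Kc: "?K \<subseteq> carrier RG" by (rule subgroup.subset[OF K])
  have ops: "op_of x \<in> ops" if "x \<in> ?K" for x using that Kc op_of_image by blast
  have uvc: "u \<in> carrier RG" "v \<in> carrier RG" using uv Uc by auto
  have op_z: "op_of z = finv (op_of u) \<circ> op_of v"
    unfolding z_def using uvc by (simp add: op_of_mult op_of_inv)
  have "z \<noteq> \<one>\<^bsub>RG\<^esub>"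
  proof
    assume "z = \<one>\<^bsub>RG\<^esub>"
    then have "v = u" unfolding z_def using uvc by (metis inv_equality inv_inv inv_closed l_inv r_cancel_one' inv_solve_left one_closed r_one)
    then show False using uv by simp
  qed
  then have nid: "op_of z \<noteq> id"
    using inj_onD[OF op_of_inj _ _ one_closed, of z] zK Kc op_of_one by auto
  obtain \<sigma> :: "('v vec \<Rightarrow> 'v vec) \<Rightarrow> int" where \<sigma>: "\<sigma> (op_of z) \<noteq> 0"
    "\<And>g k. g \<in> ops \<Longrightarrow> g \<circ> op_of z = op_of z \<circ> g \<Longrightarrow> k \<in> ops \<Longrightarrow> k \<circ> op_of z = op_of z \<circ> k \<Longrightarrow>
      \<sigma> (g \<circ> k) = \<sigma> g + \<sigma> k"
    by (rule centralizer_hom[OF ops[OF zK] nid]) blast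
  have cz: "op_of x \<circ> op_of z = op_of z \<circ> op_of x" if "x \<in> ?K" for x
  proof (rule commuting_generate[OF Uc _ _ that])
    show "z \<in> carrier RG" using zK Kc by blast
    show "op_of u \<circ> op_of z = op_of z \<circ> op_of u" if "u \<in> U" for u
      using comm[OF that] unfolding op_z by (rule HOL.sym)
  qed
  show ?thesis
  proof (rule central_hom_embeds[where z = z and f = "\<lambda>x. \<sigma> (op_of x)", OF raag_group K zK \<sigma>(1)])
    fix x assume x: "x \<in> ?K"
    have xz: "x \<in> carrier RG" "z \<in> carrier RG" using x zK Kc by auto
    have "op_of (x \<otimes>\<^bsub>RG\<^esub> z) = op_of (z \<otimes>\<^bsub>RG\<^esub> x)"
      unfolding op_of_mult[OF xz] op_of_mult[OF xz(2,1)] by (rule cz[OF x])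
    then show "x \<otimes>\<^bsub>RG\<^esub> z = z \<otimes>\<^bsub>RG\<^esub> x"
      using xz by (intro inj_onD[OF op_of_inj]) auto
    fix y assume y: "y \<in> ?K"
    then have "op_of (x \<otimes>\<^bsub>RG\<^esub> y) = op_of x \<circ> op_of y" using xz Kc by (intro op_of_mult) auto
    then show "\<sigma> (op_of (x \<otimes>\<^bsub>RG\<^esub> y)) = \<sigma> (op_of x) + \<sigma> (op_of y)"
      using \<sigma>(2)[OF ops[OF x] cz[OF x] ops[OF y] cz[OF y]] by simp
  qed
qed

lemma raag_growth:
  "\<exists>\<alpha> \<beta> :: real. \<alpha> > 0 \<and> \<beta> > 0 \<and> (\<forall>U. finite U \<and> symmetric_subset RG U \<longrightarrow>
    embeds_in_product_with_Z RG (generate RG U) \<or>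
    (\<forall>n. real (card (set_power RG U n)) \<ge> (\<alpha> * real (card U)) powr (\<beta> * real n)))"
proof -
  from ops_growth obtain \<alpha> \<beta> :: real where ab: "\<alpha> > 0" "\<beta> > 0" and growth: "\<forall>U. finite U \<longrightarrow> U \<subseteq> ops \<longrightarrow>
    (\<forall>u\<in>U. finv u \<in> U) \<longrightarrow>
    (\<forall>u\<in>U. \<forall>v\<in>U. u \<noteq> v \<longrightarrow> (\<exists>x\<in>U. (finv u \<circ> v) \<circ> x \<noteq> x \<circ> (finv u \<circ> v))) \<longrightarrow>
    (\<forall>j. real (card (word_set U j)) \<ge> (\<alpha> * real (card U)) powr (\<beta> * real j))"
    by (elim exE conjE)
  show ?thesis
  proof (rule exI[of _ \<alpha>], rule exI[of _ \<beta>], intro conjI allI impI)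
    fix U assume U: "finite U \<and> symmetric_subset RG U"
    have Uc: "U \<subseteq> carrier RG" using U by (simp add: symmetric_subset_def)
    show "embeds_in_product_with_Z RG (generate RG U) \<or>
      (\<forall>n. real (card (set_power RG U n)) \<ge> (\<alpha> * real (card U)) powr (\<beta> * real n))"
    proof (cases "\<exists>u\<in>U. \<exists>v\<in>U. u \<noteq> v \<and> (\<forall>x\<in>U. (finv (op_of u) \<circ> op_of v) \<circ> op_of x = op_of x \<circ> (finv (op_of u) \<circ> op_of v))")
      case True
      then show ?thesis using center_embeds U by blast
    next
      case False
      let ?U = "op_of ` U"
      have inj: "inj_on op_of A" if "A \<subseteq> carrier RG" for A using op_of_inj that by (rule inj_on_subset)
      have cU: "card ?U = card U" using inj[OF Uc] by (rule card_image)
      have cP: "card (set_power RG U n) = card (word_set ?U n)" for n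
        using card_image[OF inj[OF set_power_carrier[OF Uc]]] op_of_set_power[OF Uc] by metis
      have fin: "finite ?U" and sub: "?U \<subseteq> ops" using U Uc op_of_image by auto
      have inv: "\<forall>g\<in>?U. finv g \<in> ?U"
      proof
        fix g assume "g \<in> ?U"
        then obtain u where u: "u \<in> U" "g = op_of u" by blast
        then have "inv\<^bsub>RG\<^esub> u \<in> U" using U by (auto simp: symmetric_subset_def)
        moreover have "finv g = op_of (inv\<^bsub>RG\<^esub> u)" using u Uc op_of_inv by auto
        ultimately show "finv g \<in> ?U" by blast
      qed
      have cent: "\<forall>g\<in>?U. \<forall>k\<in>?U. g \<noteq> k \<longrightarrow> (\<exists>x\<in>?U. (finv g \<circ> k) \<circ> x \<noteq> x \<circ> (finv g \<circ> k))"
      proof (intro ballI impI)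
        fix g k assume "g \<in> ?U" "k \<in> ?U" "g \<noteq> k"
        then obtain u v where "u \<in> U" "v \<in> U" "g = op_of u" "k = op_of v" "u \<noteq> v" by blast
        with False show "\<exists>x\<in>?U. (finv g \<circ> k) \<circ> x \<noteq> x \<circ> (finv g \<circ> k)" by (metis imageI)
      qed
      have "real (card (word_set ?U n)) \<ge> (\<alpha> * real (card ?U)) powr (\<beta> * real n)" for n
        using growth fin sub inv cent by simp
      then show ?thesis using cU cP by simp
    qed
  qed (use ab in blast)+
qed

end

theorem theorem4p47:
  fixes V :: "'v set" and E :: "('v \<times> 'v) set"
  assumes "finite_simple_graph V E"
  shows "\<exists>\<alpha> \<beta> :: real. \<alpha> > 0 \<and> \<beta> > 0 \<and>
    (\<forall>U. finite U \<and> symmetric_subset (raag V E) U \<longrightarrow>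
       embeds_in_product_with_Z (raag V E) (generate (raag V E) U) \<or>
       (\<forall>n :: nat. real (card (set_power (raag V E) U n)) \<ge> (\<alpha> * real (card U)) powr (\<beta> * real n)))"
proof -
  interpret raag_graph V E using assms by unfold_locales
  show ?thesis by (rule raag_growth)
qed

end
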